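(* Let $(X,d,m)$ be a non-compact homogeneous ultrametric measure space, $L$ a homogeneous hierarchical Laplacian on it, and $0\le V\in L^1_{loc}(X,m)$. Then the quadratic form $$Q(u,u)=Q_L(u,u)+Q_V(u,u),\qquad dom(Q)=dom(Q_L)\cap dom(Q_V),$$ is a regular Dirichlet form in $L^2(X,m)$. In particular, it is the form of a non-negative self-adjoint operator $H$, i.e. $Q(u,u)=(H^{1/2}u,H^{1/2}u)$, and the set $\mathcal D$ is a core for $Q$.
   Context: An ultrametric satisfies $d(x,y)\le\max\{d(x,z),d(z,y)\}$. All ultrametric spaces here are separable and proper (closed balls are compact). An ultrametric measure space $(X,d,m)$ is homogeneous if its group of isometries acts transitively and preserves $m$; such a space can be identified with a locally compact Abelian group equipped with a translation-invariant ultrametric $d$ (generating the same balls) and Haar measure $m$. Let $\mathcal B$ be the set of all open balls, $\mathcal B(x)$ the set of balls containing $x$, and $\mathcal D$ the set of locally constant functions with compact support. Let $C:\mathcal B\to(0,\infty)$ satisfy: (i) $C(A)=C(B)$ if the balls $A,B$ have the same diameter; (ii) $\lambda(B):=\sum_{T\in\mathcal B:\,B\subseteq T}C(T)<\infty$ for every non-singleton ball $B$; (iii) $\lambda(B)\to+\infty$ as $B\to\{b\}$, for every $b\in X$. The homogeneous hierarchical Laplacian associated with $C$ is $$Lf(x)=\sum_{B\in\mathcal B(x)}C(B)\Big(f(x)-\frac1{m(B)}\int_B f\,dm\Big),\qquad f\in\mathcal D .$$ $L:\mathcal D\to L^2(X,m)$ is non-negative and essentially self-adjoint; $L$ also denotes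 its self-adjoint closure, and $Q_L(u,u)=(L^{1/2}u,L^{1/2}u)$ with $dom(Q_L)=dom(L^{1/2})$. For the potential $V$, $Q_V(u,u)=\int_X V|u|^2dm$ with $dom(Q_V)=\{u\in L^2(X,m):\int_X |V||u|^2dm<\infty\}$. A Dirichlet form is a densely defined closed non-negative Markovian symmetric form. *)

theory Defs
  imports "HOL-Analysis.Analysis"
begin

section \<open>Ultrametric measure spaces\<close>

definition ultrametric_measure_space :: "'a::metric_space measure \<Rightarrow> bool" where
  "ultrametric_measure_space m \<longleftrightarrow>
     (\<forall>x y z::'a. dist x y \<le> max (dist x z) (dist z y)) \<and>
     (\<exists>S::'a set. countable S \<and> closure S = UNIV) \<and>
     (\<forall>(x::'a) r. compact (cball x r)) \<and>
     sets m = sets borel \<and>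
     (\<forall>K. compact K \<longrightarrow> emeasure m K < \<infinity>) \<and>
     (\<forall>U. open U \<and> U \<noteq> {} \<longrightarrow> 0 < emeasure m U)"

definition isometries :: "('a::metric_space \<Rightarrow> 'a) set" where
  "isometries = {g. bij g \<and> (\<forall>x y. dist (g x) (g y) = dist x y)}"

definition homogeneous :: "'a::metric_space measure \<Rightarrow> bool" where
  "homogeneous m \<longleftrightarrow>
     (\<forall>x y::'a. \<exists>g\<in>isometries. g x = y) \<and> (\<forall>g\<in>isometries. distr m m g = m)"

text \<open>Balls are sets: different centres and radii may give the same ball.\<close>

definition balls :: "'a::metric_space set set" where
  "balls = {ball x r | x r. 0 < r}"

definition balls_at :: "'a::metric_space \<Rightarrow> 'a set set" where
  "balls_at x = {B \<in> balls. x \<in> B}"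

definition compactly_supported :: "('a::topological_space \<Rightarrow> real) \<Rightarrow> bool" where
  "compactly_supported f \<longleftrightarrow> compact (closure {x. f x \<noteq> 0})"

definition test_functions :: "('a::topological_space \<Rightarrow> real) set" where
  "test_functions =
     {f. (\<forall>x. \<exists>U. open U \<and> x \<in> U \<and> f constant_on U) \<and> compactly_supported f}"

definition continuous_compact :: "('a::topological_space \<Rightarrow> real) set" where
  "continuous_compact = {f. continuous_on UNIV f \<and> compactly_supported f}"

definition locally_integrable :: "'a::topological_space measure \<Rightarrow> ('a \<Rightarrow> real) \<Rightarrow> bool" where
  "locally_integrable m V \<longleftrightarrow>
     V \<in> borel_measurable m \<and> (\<forall>K. compact K \<longrightarrow> set_integrable m K V)"


section \<open>The hierarchical Laplacian on test functions\<close>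

definition ball_lambda :: "('a::metric_space set \<Rightarrow> real) \<Rightarrow> 'a set \<Rightarrow> real" where
  "ball_lambda C B = (\<Sum>\<^sub>\<infinity>T\<in>{T \<in> balls. B \<subseteq> T}. C T)"

text \<open>As \<^term>\<open>C\<close> is positive, finiteness of \<^term>\<open>ball_lambda C B\<close> is summability. The
  convergence of a ball to a point \<^term>\<open>b\<close> is read as a punctured limit (\<^term>\<open>B \<noteq> {b}\<close>), so
  the last condition says nothing at an isolated point.\<close>

definition choice_function :: "('a::metric_space set \<Rightarrow> real) \<Rightarrow> bool" where
  "choice_function C \<longleftrightarrow>
     (\<forall>B\<in>balls. 0 < C B) \<and>
     (\<forall>A\<in>balls. \<forall>B\<in>balls. diameter A = diameter B \<longrightarrow> C A = C B) \<and>
     (\<forall>B\<in>balls. (\<forall>b. B \<noteq> {b}) \<longrightarrow> C summable_on {T \<in> balls. B \<subseteq> T}) \<and>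
     (\<forall>b K. \<exists>e>0. \<forall>B\<in>balls_at b. B \<noteq> {b} \<and> diameter B < e \<longrightarrow> K < ball_lambda C B)"

definition hier_laplacian ::
  "'a::metric_space measure \<Rightarrow> ('a set \<Rightarrow> real) \<Rightarrow> ('a \<Rightarrow> real) \<Rightarrow> 'a \<Rightarrow> real" where
  "hier_laplacian m C f x =
     (\<Sum>\<^sub>\<infinity>B\<in>balls_at x. C B * (f x - 1 / measure m B * (LINT y:B|m. f y)))"


section \<open>Unbounded operators in real \<open>L\<^sup>2\<close>\<close>

text \<open>Elements of \<open>L\<^sup>2\<close> are represented by functions, without passing to classes modulo
  equality almost everywhere. An operator is a set of pairs \<^term>\<open>(f, g)\<close> (its graph);
  the adjoint and the closure below are invariant under changing \<^term>\<open>f\<close> and \<^term>\<open>g\<close> on null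
  sets, and for a densely defined self-adjoint graph \<^term>\<open>g\<close> is determined by \<^term>\<open>f\<close> up to
  null sets. Composition of operators is relational composition.\<close>

definition l2_space :: "'a measure \<Rightarrow> ('a \<Rightarrow> real) set" where
  "l2_space m = {f \<in> borel_measurable m. integrable m (\<lambda>x. (f x)\<^sup>2)}"

definition l2_inner :: "'a measure \<Rightarrow> ('a \<Rightarrow> real) \<Rightarrow> ('a \<Rightarrow> real) \<Rightarrow> real" where
  "l2_inner m f g = (LINT x|m. f x * g x)"

definition l2_norm :: "'a measure \<Rightarrow> ('a \<Rightarrow> real) \<Rightarrow> real" where
  "l2_norm m f = sqrt (l2_inner m f f)"

definition l2_dense :: "'a measure \<Rightarrow> ('a \<Rightarrow> real) set \<Rightarrow> bool" where
  "l2_dense m S \<longleftrightarrow> S \<subseteq> l2_space m \<and>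
     (\<forall>f\<in>l2_space m. \<forall>e>0. \<exists>g\<in>S. l2_norm m (\<lambda>x. f x - g x) < e)"

type_synonym 'a op_graph = "(('a \<Rightarrow> real) \<times> ('a \<Rightarrow> real)) set"

definition op_closure :: "'a measure \<Rightarrow> 'a op_graph \<Rightarrow> 'a op_graph" where
  "op_closure m A = {(f, g) \<in> l2_space m \<times> l2_space m.
     \<forall>e>0. \<exists>(u, v) \<in> A \<inter> l2_space m \<times> l2_space m.
       l2_norm m (\<lambda>x. f x - u x) < e \<and> l2_norm m (\<lambda>x. g x - v x) < e}"

definition op_adjoint :: "'a measure \<Rightarrow> 'a op_graph \<Rightarrow> 'a op_graph" where
  "op_adjoint m A = {(f, g) \<in> l2_space m \<times> l2_space m.
     \<forall>(u, v) \<in> A. l2_inner m v f = l2_inner m u g}"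

definition nonneg_selfadjoint :: "'a measure \<Rightarrow> 'a op_graph \<Rightarrow> bool" where
  "nonneg_selfadjoint m A \<longleftrightarrow>
     l2_dense m (Domain A) \<and> op_adjoint m A = A \<and> (\<forall>(f, g) \<in> A. 0 \<le> l2_inner m g f)"

text \<open>A non-negative self-adjoint operator has exactly one non-negative self-adjoint square root,
  so the choice operator has no influence on the value.\<close>

definition op_sqrt :: "'a measure \<Rightarrow> 'a op_graph \<Rightarrow> 'a op_graph" where
  "op_sqrt m A = (SOME S. nonneg_selfadjoint m S \<and> S O S = A)"

definition op_apply :: "'a op_graph \<Rightarrow> ('a \<Rightarrow> real) \<Rightarrow> 'a \<Rightarrow> real" where
  "op_apply A f = (SOME g. (f, g) \<in> A)"

definition op_form_dom :: "'a measure \<Rightarrow> 'a op_graph \<Rightarrow> ('a \<Rightarrow> real) set" where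
  "op_form_dom m A = Domain (op_sqrt m A)"

definition op_form ::
  "'a measure \<Rightarrow> 'a op_graph \<Rightarrow> ('a \<Rightarrow> real) \<Rightarrow> ('a \<Rightarrow> real) \<Rightarrow> real" where
  "op_form m A u v = l2_inner m (op_apply (op_sqrt m A) u) (op_apply (op_sqrt m A) v)"


section \<open>Dirichlet forms\<close>

text \<open>A form is given by its domain \<^term>\<open>D\<close> and its bilinear version \<^term>\<open>E\<close>; the quadratic
  form is the diagonal. Compatibility with equality almost everywhere makes it a form on \<open>L\<^sup>2\<close>.\<close>

definition symmetric_form ::
  "'a measure \<Rightarrow> ('a \<Rightarrow> real) set \<Rightarrow> (('a \<Rightarrow> real) \<Rightarrow> ('a \<Rightarrow> real) \<Rightarrow> real) \<Rightarrow> bool" where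
  "symmetric_form m D E \<longleftrightarrow>
     D \<noteq> {} \<and> D \<subseteq> l2_space m \<and>
     (\<forall>u\<in>D. \<forall>u'\<in>l2_space m. (AE x in m. u x = u' x) \<longrightarrow>
        u' \<in> D \<and> (\<forall>w\<in>D. E u' w = E u w)) \<and>
     (\<forall>u\<in>D. \<forall>v\<in>D. \<forall>a b. (\<lambda>x. a * u x + b * v x) \<in> D \<and>
        (\<forall>w\<in>D. E (\<lambda>x. a * u x + b * v x) w = a * E u w + b * E v w)) \<and>
     (\<forall>u\<in>D. \<forall>v\<in>D. E u v = E v u)"

definition form_norm ::
  "'a measure \<Rightarrow> (('a \<Rightarrow> real) \<Rightarrow> ('a \<Rightarrow> real) \<Rightarrow> real) \<Rightarrow> ('a \<Rightarrow> real) \<Rightarrow> real" where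
  "form_norm m E u = sqrt (E u u + l2_inner m u u)"

definition closed_form ::
  "'a measure \<Rightarrow> ('a \<Rightarrow> real) set \<Rightarrow> (('a \<Rightarrow> real) \<Rightarrow> ('a \<Rightarrow> real) \<Rightarrow> real) \<Rightarrow> bool" where
  "closed_form m D E \<longleftrightarrow>
     (\<forall>u. (\<forall>n::nat. u n \<in> D) \<and>
        (\<forall>e>0. \<exists>N. \<forall>j\<ge>N. \<forall>k\<ge>N. form_norm m E (\<lambda>x. u j x - u k x) < e) \<longrightarrow>
        (\<exists>w\<in>D. (\<lambda>n. form_norm m E (\<lambda>x. u n x - w x)) \<longlonglongrightarrow> 0))"

definition markovian_form ::
  "('a \<Rightarrow> real) set \<Rightarrow> (('a \<Rightarrow> real) \<Rightarrow> ('a \<Rightarrow> real) \<Rightarrow> real) \<Rightarrow> bool" where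
  "markovian_form D E \<longleftrightarrow>
     (\<forall>u\<in>D. (\<lambda>x. min (max (u x) 0) 1) \<in> D \<and>
        E (\<lambda>x. min (max (u x) 0) 1) (\<lambda>x. min (max (u x) 0) 1) \<le> E u u)"

definition dirichlet_form ::
  "'a measure \<Rightarrow> ('a \<Rightarrow> real) set \<Rightarrow> (('a \<Rightarrow> real) \<Rightarrow> ('a \<Rightarrow> real) \<Rightarrow> real) \<Rightarrow> bool" where
  "dirichlet_form m D E \<longleftrightarrow>
     symmetric_form m D E \<and> l2_dense m D \<and> (\<forall>u\<in>D. 0 \<le> E u u) \<and>
     closed_form m D E \<and> markovian_form D E"

text \<open>A core in the sense of Fukushima: dense in the domain for the form norm and in the continuous
  compactly supported functions for the uniform norm.\<close>

definition form_core ::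
  "'a::topological_space measure \<Rightarrow> ('a \<Rightarrow> real) set \<Rightarrow> (('a \<Rightarrow> real) \<Rightarrow> ('a \<Rightarrow> real) \<Rightarrow> real) \<Rightarrow>
    ('a \<Rightarrow> real) set \<Rightarrow> bool" where
  "form_core m D E S \<longleftrightarrow>
     S \<subseteq> D \<inter> continuous_compact \<and>
     (\<forall>u\<in>D. \<forall>e>0. \<exists>w\<in>S. form_norm m E (\<lambda>x. u x - w x) < e) \<and>
     (\<forall>u\<in>continuous_compact. \<forall>e>0. \<exists>w\<in>S. \<forall>x. \<bar>u x - w x\<bar> < e)"

definition regular_dirichlet_form ::
  "'a::topological_space measure \<Rightarrow> ('a \<Rightarrow> real) set \<Rightarrow> (('a \<Rightarrow> real) \<Rightarrow> ('a \<Rightarrow> real) \<Rightarrow> real) \<Rightarrow>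
    bool" where
  "regular_dirichlet_form m D E \<longleftrightarrow>
     dirichlet_form m D E \<and> form_core m D E (D \<inter> continuous_compact)"


section \<open>The form of the hierarchical Schroedinger operator\<close>

definition laplacian_op :: "'a::metric_space measure \<Rightarrow> ('a set \<Rightarrow> real) \<Rightarrow> 'a op_graph" where
  "laplacian_op m C = op_closure m {(f, hier_laplacian m C f) | f. f \<in> test_functions}"

definition QL_dom :: "'a::metric_space measure \<Rightarrow> ('a set \<Rightarrow> real) \<Rightarrow> ('a \<Rightarrow> real) set" where
  "QL_dom m C = op_form_dom m (laplacian_op m C)"

definition QL :: "'a::metric_space measure \<Rightarrow> ('a set \<Rightarrow> real) \<Rightarrow>
    ('a \<Rightarrow> real) \<Rightarrow> ('a \<Rightarrow> real) \<Rightarrow> real" where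
  "QL m C = op_form m (laplacian_op m C)"

definition QV_dom :: "'a measure \<Rightarrow> ('a \<Rightarrow> real) \<Rightarrow> ('a \<Rightarrow> real) set" where
  "QV_dom m V = {u \<in> l2_space m. integrable m (\<lambda>x. \<bar>V x\<bar> * (u x)\<^sup>2)}"

definition QV :: "'a measure \<Rightarrow> ('a \<Rightarrow> real) \<Rightarrow> ('a \<Rightarrow> real) \<Rightarrow> ('a \<Rightarrow> real) \<Rightarrow> real" where
  "QV m V u v = (LINT x|m. V x * u x * v x)"

definition Q_dom :: "'a::metric_space measure \<Rightarrow> ('a set \<Rightarrow> real) \<Rightarrow> ('a \<Rightarrow> real) \<Rightarrow>
    ('a \<Rightarrow> real) set" where
  "Q_dom m C V = QL_dom m C \<inter> QV_dom m V"

definition Q_form :: "'a::metric_space measure \<Rightarrow> ('a set \<Rightarrow> real) \<Rightarrow> ('a \<Rightarrow> real) \<Rightarrow>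
    ('a \<Rightarrow> real) \<Rightarrow> ('a \<Rightarrow> real) \<Rightarrow> real" where
  "Q_form m C V u v = QL m C u v + QV m V u v"

end

(* The form of L is the sum over the balls B of C(B) times the squared L2 norm of the deviation of u
   from its mean on B. This explicit form is closed by Fatou, and normal contractions decrease each
   summand because the mean is the best constant approximation. Its operator is the closure of L on
   test functions: the range of L + 1 is dense, since a function orthogonal to it is killed by
   averaging at any scale r (where L is bounded) and cutting off at a large ball. Uniqueness of the
   nonnegative square root, obtained from bounded resolvents, identifies it with the form of the
   closure.
   The potential only changes the L2 norm: its form norm is the norm for the measure of density
   1 + |V|, so the sum is closed and Markovian. A function of the domain is approximated by
   truncating its values, restricting it to a large ball, and averaging it over small balls; none of
   these steps increases the form of L by more than a vanishing amount, which turns L2 convergence into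
   convergence in the form norm. *)
theory Submission
  imports Defs "HOL-Library.Function_Algebras"
begin

text \<open>Functions equal almost everywhere are not identified, so the inner product of
  \<open>l2_space\<close> is only semidefinite and operators are linear only up to null functions;
  the abstract part therefore works in semi-inner product spaces and tests identities by inner
  products. Since \<open>op_sqrt\<close> is a choice, the operator of the explicit form must be
  shown to have some square root, which comes from a power series in the resolvent, and the
  resulting form must not depend on the root. Roots are never compared with each other: u -> |S u|^2
  is a closed form with operator \<open>S O S\<close>, and a closed form is recovered from its
  operator.

  Homogeneity enters chiefly through one number: isometries preserve diameters, so the total weight
  of the balls strictly containing \<open>ball x r\<close> is the same for all x, and a weighted
  Cauchy-Schwarz inequality turns it into a bound for L at scale r. The potential fixes the order of
  the approximations: averages converge in L2(m), and local integrability of V supplies a dominating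
  function once the averaged function is bounded with bounded support.\<close>

instantiation "fun" :: (type, real_vector) real_vector
begin

definition scaleR_fun :: "real \<Rightarrow> ('a \<Rightarrow> 'b) \<Rightarrow> 'a \<Rightarrow> 'b" where
  "scaleR_fun r f = (\<lambda>x. r *\<^sub>R f x)"

instance
  by standard (simp_all add: scaleR_fun_def fun_eq_iff scaleR_add_right scaleR_add_left)

end

lemma scaleR_fun_apply [simp]: "(r *\<^sub>R f) x = r *\<^sub>R f x"
  by (simp add: scaleR_fun_def)

section \<open>Semi-inner product spaces\<close>

text \<open>The laws are demanded only on \<open>H\<close>, because an integral is additive only
  where the products are integrable, and definiteness is left out because functions equal almost
  everywhere stay distinct vectors.\<close>

locale semi_inner =
  fixes H :: "'v::real_vector set" and ip :: "'v \<Rightarrow> 'v \<Rightarrow> real"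
  assumes subspace: "subspace H"
    and ip_commute: "\<And>x y. x \<in> H \<Longrightarrow> y \<in> H \<Longrightarrow> ip x y = ip y x"
    and ip_add_left: "\<And>x y z. x \<in> H \<Longrightarrow> y \<in> H \<Longrightarrow> z \<in> H \<Longrightarrow> ip (x + y) z = ip x z + ip y z"
    and ip_scale_left: "\<And>a x z. x \<in> H \<Longrightarrow> z \<in> H \<Longrightarrow> ip (a *\<^sub>R x) z = a * ip x z"
    and ip_ge_0: "\<And>x. x \<in> H \<Longrightarrow> 0 \<le> ip x x"
begin

definition nrm :: "'v \<Rightarrow> real" where
  "nrm x = sqrt (ip x x)"

lemma mem [simp]:
  "0 \<in> H"
  "x \<in> H \<Longrightarrow> y \<in> H \<Longrightarrow> x + y \<in> H"
  "x \<in> H \<Longrightarrow> y \<in> H \<Longrightarrow> x - y \<in> H"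
  "x \<in> H \<Longrightarrow> a *\<^sub>R x \<in> H"
  "x \<in> H \<Longrightarrow> - x \<in> H"
  using subspace by (auto simp: subspace_0 subspace_add subspace_diff subspace_scale subspace_neg)

lemma ip_add_right: "x \<in> H \<Longrightarrow> y \<in> H \<Longrightarrow> z \<in> H \<Longrightarrow> ip z (x + y) = ip z x + ip z y"
  using ip_add_left[of x y z] by (simp add: ip_commute[of z])

lemma ip_scale_right: "x \<in> H \<Longrightarrow> z \<in> H \<Longrightarrow> ip z (a *\<^sub>R x) = a * ip z x"
  using ip_scale_left[of x z a] by (simp add: ip_commute[of z])

lemma ip_diff_left: "x \<in> H \<Longrightarrow> y \<in> H \<Longrightarrow> z \<in> H \<Longrightarrow> ip (x - y) z = ip x z - ip y z"
  using ip_add_left[of x "(-1) *\<^sub>R y" z] ip_scale_left[of y z "-1"] mem(4)[of y "-1"]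
  by (simp del: mem(4))

lemma ip_diff_right: "x \<in> H \<Longrightarrow> y \<in> H \<Longrightarrow> z \<in> H \<Longrightarrow> ip z (x - y) = ip z x - ip z y"
  using ip_diff_left[of x y z] by (simp add: ip_commute[of z])

lemma ip_zero [simp]: "x \<in> H \<Longrightarrow> ip 0 x = 0" "x \<in> H \<Longrightarrow> ip x 0 = 0"
  using ip_scale_left[of 0 x 0] ip_scale_right[of 0 x 0] by auto

lemmas ip_simps = ip_add_left ip_add_right ip_diff_left ip_diff_right ip_scale_left ip_scale_right

lemma nrm_ge_0 [simp]: "x \<in> H \<Longrightarrow> 0 \<le> nrm x"
  by (simp add: nrm_def ip_ge_0)

lemma nrm_zero [simp]: "nrm 0 = 0"
  by (simp add: nrm_def)

lemma nrm_sq: "x \<in> H \<Longrightarrow> (nrm x)\<^sup>2 = ip x x"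
  by (simp add: nrm_def ip_ge_0)

lemma cauchy_schwarz_sq:
  assumes x: "x \<in> H" and y: "y \<in> H"
  shows "(ip x y)\<^sup>2 \<le> ip x x * ip y y"
proof -
  define a b c where "a = ip x x" and "b = ip x y" and "c = ip y y"
  have pos: "0 \<le> a * t\<^sup>2 + 2 * b * t + c" for t
  proof -
    have "0 \<le> ip (t *\<^sub>R x + y) (t *\<^sub>R x + y)"
      using x y by (intro ip_ge_0) simp
    also have "\<dots> = a * t\<^sup>2 + 2 * b * t + c"
      using x y by (simp add: ip_simps a_def b_def c_def ip_commute[of y x] power2_eq_square algebra_simps)
    finally show ?thesis .
  qed
  have a0: "0 \<le> a"
    using x by (simp add: a_def ip_ge_0)
  show ?thesis
  proof (cases "a = 0")
    case True
    have "b = 0"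
    proof (rule ccontr)
      assume "b \<noteq> 0"
      \<comment> \<open>With \<open>a = 0\<close> the polynomial is affine; at this argument its
        value is -1.\<close>
      then show False
        using pos[of "- (c + 1) / (2 * b)"] True by simp
    qed
    then show ?thesis
      using True by (simp add: a_def b_def)
  next
    case False
    with a0 have "0 < a" by simp
    moreover have "a * (- b / a)\<^sup>2 + 2 * b * (- b / a) + c = c - b\<^sup>2 / a"
      using False by (simp add: power2_eq_square field_simps)
    ultimately have "b\<^sup>2 / a \<le> c"
      using pos[of "- b / a"] by simp
    then show ?thesis
      using \<open>0 < a\<close> by (simp add: field_simps a_def b_def c_def)
  qed
qed

lemma cauchy_schwarz:
  assumes "x \<in> H" "y \<in> H"
  shows "\<bar>ip x y\<bar> \<le> nrm x * nrm y"
proof -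
  have "sqrt ((ip x y)\<^sup>2) \<le> sqrt (ip x x * ip y y)"
    using cauchy_schwarz_sq[OF assms] by (rule real_sqrt_le_mono)
  then show ?thesis
    by (simp add: nrm_def real_sqrt_mult)
qed

lemma ip_eq_0_if_nrm_eq_0:
  assumes "x \<in> H" "y \<in> H" "nrm x = 0"
  shows "ip x y = 0" "ip y x = 0"
  using cauchy_schwarz[of x y] cauchy_schwarz[of y x] assms by auto

lemma nrm_minus_commute: "x \<in> H \<Longrightarrow> y \<in> H \<Longrightarrow> nrm (x - y) = nrm (y - x)"
  by (simp add: nrm_def ip_simps)

lemma nrm_triangle:
  assumes "x \<in> H" "y \<in> H"
  shows "nrm (x + y) \<le> nrm x + nrm y"
proof -
  have "(nrm (x + y))\<^sup>2 = (nrm x)\<^sup>2 + 2 * ip x y + (nrm y)\<^sup>2"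
    using assms by (simp add: nrm_sq ip_simps ip_commute[of y x])
  also have "\<dots> \<le> (nrm x + nrm y)\<^sup>2"
    using cauchy_schwarz[OF assms] by (simp add: power2_sum)
  finally show ?thesis
    by (rule power2_le_imp_le) (use assms in simp)
qed

lemma nrm_triangle_sub:
  assumes "x \<in> H" "y \<in> H" "z \<in> H"
  shows "nrm (x - z) \<le> nrm (x - y) + nrm (y - z)"
  using nrm_triangle[of "x - y" "y - z"] assms by simp

lemma nrm_reverse_triangle:
  assumes "x \<in> H" "y \<in> H"
  shows "\<bar>nrm x - nrm y\<bar> \<le> nrm (x - y)"
  using nrm_triangle[of "x - y" y] nrm_triangle[of "y - x" x] nrm_minus_commute[of x y] assms by simp

lemma tendsto_nrm:
  assumes "\<And>n. u n \<in> H" "w \<in> H" "(\<lambda>n. nrm (u n - w)) \<longlonglongrightarrow> 0"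
  shows "(\<lambda>n. nrm (u n)) \<longlonglongrightarrow> nrm w"
proof (rule LIM_zero_cancel, rule Lim_null_comparison[OF _ assms(3)])
  show "\<forall>\<^sub>F n in sequentially. norm (nrm (u n) - nrm w) \<le> nrm (u n - w)"
    using nrm_reverse_triangle assms by simp
qed

lemma tendsto_ip:
  assumes "\<And>n. u n \<in> H" "w \<in> H" "(\<lambda>n. nrm (u n - w)) \<longlonglongrightarrow> 0"
    and "\<And>n. v n \<in> H" "z \<in> H" "(\<lambda>n. nrm (v n - z)) \<longlonglongrightarrow> 0"
  shows "(\<lambda>n. ip (u n) (v n)) \<longlonglongrightarrow> ip w z"
proof (rule LIM_zero_cancel, rule Lim_null_comparison)
  show "(\<lambda>n. nrm (u n - w) * nrm (v n) + nrm w * nrm (v n - z)) \<longlonglongrightarrow> 0"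
    using tendsto_nrm[OF assms(4,5,6)] assms(3,6) by (auto intro!: tendsto_eq_intros)
  have "\<bar>ip (u n) (v n) - ip w z\<bar> \<le> nrm (u n - w) * nrm (v n) + nrm w * nrm (v n - z)" for n
  proof -
    have "ip (u n) (v n) - ip w z = ip (u n - w) (v n) + ip w (v n - z)"
      using assms by (simp add: ip_simps)
    then show ?thesis
      using cauchy_schwarz[of "u n - w" "v n"] cauchy_schwarz[of w "v n - z"] assms
      by simp
  qed
  then show "\<forall>\<^sub>F n in sequentially. norm (ip (u n) (v n) - ip w z)
      \<le> nrm (u n - w) * nrm (v n) + nrm w * nrm (v n - z)"
    by simp
qed

lemma tendsto_ip_left:
  assumes "\<And>n. u n \<in> H" "w \<in> H" "(\<lambda>n. nrm (u n - w)) \<longlonglongrightarrow> 0" "z \<in> H"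
  shows "(\<lambda>n. ip (u n) z) \<longlonglongrightarrow> ip w z"
  using tendsto_ip[of u w "\<lambda>_. z" z] assms by simp

lemma nrm_eq_0_if_le: "x \<in> H \<Longrightarrow> nrm x \<le> 0 \<Longrightarrow> nrm x = 0"
  using nrm_ge_0[of x] by linarith

lemma nrm_eq_0_if_orth:
  assumes "x \<in> H" "\<And>y. y \<in> H \<Longrightarrow> ip x y = 0"
  shows "nrm x = 0"
  using assms by (simp add: nrm_def)

definition cauchy_seq :: "(nat \<Rightarrow> 'v) \<Rightarrow> bool" where
  "cauchy_seq u \<longleftrightarrow> (\<forall>e>0. \<exists>N. \<forall>j\<ge>N. \<forall>k\<ge>N. nrm (u j - u k) < e)"

lemma cauchy_seq_if_convergent:
  assumes "\<And>n. u n \<in> H" "w \<in> H" "(\<lambda>n. nrm (u n - w)) \<longlonglongrightarrow> 0"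
  shows "cauchy_seq u"
  unfolding cauchy_seq_def
proof (intro allI impI)
  fix e :: real assume "0 < e"
  then obtain N where N: "\<And>n. n \<ge> N \<Longrightarrow> nrm (u n - w) < e / 2"
    using LIMSEQ_D[OF assms(3), of "e / 2"] assms(1,2) by force
  have "nrm (u j - u k) < e" if "j \<ge> N" "k \<ge> N" for j k
    using nrm_triangle_sub[of "u j" w "u k"] nrm_minus_commute[of "u k" w] N[OF that(1)] N[OF that(2)]
      assms(1,2) by simp
  then show "\<exists>N. \<forall>j\<ge>N. \<forall>k\<ge>N. nrm (u j - u k) < e" by blast
qed

end

section \<open>Riesz representation and orthogonal projection\<close>

locale semi_hilbert = semi_inner +
  assumes complete: "\<And>u. (\<And>n::nat. u n \<in> H) \<Longrightarrow> cauchy_seq u \<Longrightarrow> \<exists>w\<in>H. (\<lambda>n. nrm (u n - w)) \<longlonglongrightarrow> 0"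
begin

text \<open>The vector is obtained by minimising \<^term>\<open>ip x x - 2 * \<phi> x\<close> over \<^term>\<open>U\<close>; taking
  \<^term>\<open>U = H\<close> gives the Riesz representation and \<^term>\<open>\<phi> = ip h\<close> the orthogonal projection.\<close>

lemma riesz_subspace:
  assumes U: "real_vector.subspace U" "U \<subseteq> H"
    and add: "\<And>x y. x \<in> H \<Longrightarrow> y \<in> H \<Longrightarrow> \<phi> (x + y) = \<phi> x + \<phi> y"
    and scale: "\<And>a x. x \<in> H \<Longrightarrow> \<phi> (a *\<^sub>R x) = a * \<phi> x"
    and bound: "\<And>x. x \<in> H \<Longrightarrow> \<bar>\<phi> x\<bar> \<le> K * nrm x"
  obtains p u where "p \<in> H" "\<And>n. u n \<in> U" "(\<lambda>n. nrm (u n - p)) \<longlonglongrightarrow> 0"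
    "\<And>w. w \<in> U \<Longrightarrow> ip p w = \<phi> w"
proof -
  define J where "J x = ip x x - 2 * \<phi> x" for x
  have UH: "x \<in> H" if "x \<in> U" for x
    using that U by auto
  have Umem: "x + y \<in> U" "a *\<^sub>R x \<in> U" if "x \<in> U" "y \<in> U" for x y a
    using U that by (auto simp: subspace_def)
  \<comment> \<open>The bound on \<open>\<phi>\<close> gives
    \<open>J x >= (nrm x)^2 - 2 K (nrm x)\<close>, and completing the square bounds this below by
    \<open>- K^2\<close>.\<close>
  have low: "- K\<^sup>2 \<le> J x" if "x \<in> U" for x
  proof -
    have "\<phi> x \<le> K * nrm x"
      using bound[of x] UH[OF that] by linarith
    moreover have "0 \<le> (nrm x - K)\<^sup>2" by simp
    ultimately show ?thesis
      using nrm_sq[OF UH[OF that]] by (simp add: J_def power2_diff algebra_simps)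
  qed
  define I where "I = Inf (J ` U)"
  have bdd: "bdd_below (J ` U)"
    using low by (intro bdd_belowI[of _ "- K\<^sup>2"]) auto
  have ne: "U \<noteq> {}"
    using U(1) subspace_0 by blast
  have I_le: "I \<le> J x" if "x \<in> U" for x
    unfolding I_def using bdd that by (intro cInf_lower) auto
  have "\<exists>x\<in>U. J x < I + 1 / real (Suc n)" for n
  proof -
    have "I < I + 1 / real (Suc n)" by simp
    then show ?thesis
      unfolding I_def using cInf_lessD[of "J ` U" "Inf (J ` U) + 1 / real (Suc n)"] ne by auto
  qed
  then obtain u where u: "\<And>n. u n \<in> U" "\<And>n. J (u n) < I + 1 / real (Suc n)"
    by metis
  have uH: "u n \<in> H" for n
    using u UH by blast
  \<comment> \<open>Parallelogram law: the linear part of \<open>J\<close> cancels, so a minimising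
    sequence is Cauchy.\<close>
  have para: "(nrm (u j - u k))\<^sup>2 \<le> 2 / real (Suc j) + 2 / real (Suc k)" for j k
  proof -
    have "(nrm (u j - u k))\<^sup>2 = 2 * J (u j) + 2 * J (u k) - 4 * J ((1/2) *\<^sub>R (u j + u k))"
      using uH[of j] uH[of k]
      by (simp add: nrm_sq J_def ip_simps add scale ip_commute[of "u k" "u j"] algebra_simps)
    moreover have "I \<le> J ((1/2) *\<^sub>R (u j + u k))"
      using u by (intro I_le Umem)
    ultimately show ?thesis
      using u(2)[of j] u(2)[of k] by simp
  qed
  have "cauchy_seq u"
    unfolding cauchy_seq_def
  proof (intro allI impI)
    fix e :: real assume e: "0 < e"
    obtain N where N: "4 / e\<^sup>2 < real N"
      using reals_Archimedean2 by blast
    have "nrm (u j - u k) < e" if "j \<ge> N" "k \<ge> N" for j k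
    proof -
      have Npos: "0 < real N"
        using N e by (smt (verit) divide_pos_pos zero_less_power)
      have "2 / real (Suc i) < 2 / real N" if "i \<ge> N" for i
        using that Npos by (intro divide_strict_left_mono) auto
      from this[OF that(1)] this[OF that(2)] have "(nrm (u j - u k))\<^sup>2 < 4 / real N"
        using para[of j k] by simp
      also have "\<dots> < e\<^sup>2"
        using N Npos e by (simp add: field_simps)
      finally show ?thesis
        by (rule power2_less_imp_less) (use e in simp)
    qed
    then show "\<exists>N. \<forall>j\<ge>N. \<forall>k\<ge>N. nrm (u j - u k) < e" by blast
  qed
  \<comment> \<open>A limit of elements of \<open>U\<close> is only known to lie in
    \<open>H\<close>; this is why the conclusion also hands out the sequence
    \<open>u\<close>.\<close>
  then obtain p where p: "p \<in> H" "(\<lambda>n. nrm (u n - p)) \<longlonglongrightarrow> 0"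
    using complete[of u] uH by blast
  have "ip p w = \<phi> w" if w: "w \<in> U" for w
  proof -
    have wH: "w \<in> H" using w UH by blast
    have *: "0 \<le> 2 * t * (ip p w - \<phi> w) + t\<^sup>2 * ip w w" for t
    proof (rule tendsto_lowerbound)
      show "(\<lambda>n. 1 / real (Suc n) + 2 * t * (ip (u n) w - \<phi> w) + t\<^sup>2 * ip w w)
          \<longlonglongrightarrow> 2 * t * (ip p w - \<phi> w) + t\<^sup>2 * ip w w"
        using tendsto_add[OF tendsto_add[OF LIMSEQ_inverse_real_of_nat tendsto_mult[OF tendsto_const[of "2 * t"]
            tendsto_diff[OF tendsto_ip_left[OF uH p(1) p(2) wH] tendsto_const[of "\<phi> w"]]]]
            tendsto_const[of "t\<^sup>2 * ip w w"]]
        by (simp add: inverse_eq_divide)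
      have "0 \<le> 1 / real (Suc n) + 2 * t * (ip (u n) w - \<phi> w) + t\<^sup>2 * ip w w" for n
      proof -
        have "I \<le> J (u n + t *\<^sub>R w)"
          using u w by (intro I_le Umem)
        also have "\<dots> = J (u n) + 2 * t * (ip (u n) w - \<phi> w) + t\<^sup>2 * ip w w"
          using uH[of n] wH
          by (simp add: J_def ip_simps add scale ip_commute[of w "u n"] power2_eq_square algebra_simps)
        finally show ?thesis
          using u(2)[of n] by simp
      qed
      then show "\<forall>\<^sub>F n in sequentially. 0 \<le> 1 / real (Suc n) + 2 * t * (ip (u n) w - \<phi> w) + t\<^sup>2 * ip w w"
        by simp
    qed simp
    define d where "d = ip p w - \<phi> w"
    define c where "c = ip w w"
    have c0: "0 \<le> c" using wH by (simp add: c_def ip_ge_0)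
    \<comment> \<open>The parameter \<open>t = - d / (c + 1)\<close> makes the expression negative
      unless \<open>d = 0\<close>; the added 1 covers \<open>c = 0\<close>.\<close>
    have "0 \<le> 2 * (- d / (c + 1)) * d + (- d / (c + 1))\<^sup>2 * c"
      using *[of "- d / (c + 1)"] by (simp add: d_def c_def)
    also have "\<dots> = - (d\<^sup>2 * (c + 2)) / (c + 1)\<^sup>2"
      using c0 by (simp add: divide_simps power2_eq_square) (simp add: algebra_simps)
    finally have "d\<^sup>2 * (c + 2) \<le> 0"
      using c0 by (simp add: divide_le_0_iff)
    then have "d = 0"
      using c0 by (simp add: mult_le_0_iff)
    then show ?thesis by (simp add: d_def)
  qed
  then show ?thesis
    using that p u(1) by blast
qed

lemma riesz:
  assumes "\<And>x y. x \<in> H \<Longrightarrow> y \<in> H \<Longrightarrow> \<phi> (x + y) = \<phi> x + \<phi> y"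
    and "\<And>a x. x \<in> H \<Longrightarrow> \<phi> (a *\<^sub>R x) = a * \<phi> x"
    and "\<And>x. x \<in> H \<Longrightarrow> \<bar>\<phi> x\<bar> \<le> K * nrm x"
  shows "\<exists>p\<in>H. \<forall>w\<in>H. ip p w = \<phi> w"
  by (rule riesz_subspace[OF subspace subset_refl assms]) auto

text \<open>The projection \<open>p\<close> of \<open>h\<close> satisfies
  \<open>ip (p - h) w = 0\<close> for all \<open>w\<close> in \<open>U\<close>, so
  \<open>p - h\<close> is null and the sequence approaching \<open>p\<close> approaches
  \<open>h\<close>. Density of operator domains, cores and ranges is derived from this
  criterion.\<close>

lemma dense_if_orth_null:
  assumes U: "real_vector.subspace U" "U \<subseteq> H"
    and orth: "\<And>h. h \<in> H \<Longrightarrow> (\<And>u. u \<in> U \<Longrightarrow> ip h u = 0) \<Longrightarrow> nrm h = 0"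
    and h: "h \<in> H"
  shows "\<exists>u. (\<forall>n. u n \<in> U) \<and> (\<lambda>n. nrm (u n - h)) \<longlonglongrightarrow> 0"
proof -
  obtain p u where p: "p \<in> H" and u: "\<And>n. u n \<in> U" "(\<lambda>n. nrm (u n - p)) \<longlonglongrightarrow> 0"
    and pw: "\<And>w. w \<in> U \<Longrightarrow> ip p w = ip h w"
  proof (rule riesz_subspace[OF U, of "ip h" "nrm h"])
  qed (use h cauchy_schwarz[of h] in \<open>auto simp: ip_simps\<close>)
  have "nrm (p - h) = 0"
  proof (rule orth)
    show "ip (p - h) w = 0" if "w \<in> U" for w
      using pw[OF that] p h U that by (simp add: ip_simps subset_iff)
  qed (use p h in simp)
  then have "nrm (u n - h) \<le> nrm (u n - p)" for n
    using nrm_triangle_sub[of "u n" p h] p h U u(1)[of n] by auto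
  then have "(\<lambda>n. nrm (u n - h)) \<longlonglongrightarrow> 0"
    using u(1) h U by (intro Lim_null_comparison[OF _ u(2)] always_eventually allI) (simp add: subset_iff)
  then show ?thesis
    using u(1) by blast
qed

end

lemma infsum_diff_real:
  fixes f g :: "'i \<Rightarrow> real"
  assumes "f summable_on A" "g summable_on A"
  shows "(\<Sum>\<^sub>\<infinity>x\<in>A. f x - g x) = infsum f A - infsum g A"
  using infsum_add[OF assms(1), of "\<lambda>x. - g x"] assms(2) by (simp add: infsum_uminus summable_on_uminus)

section \<open>Square roots of bounded positive operators\<close>

text \<open>The Taylor coefficients of \<^term>\<open>1 - sqrt (1 - z)\<close>, whose generating function \<open>c\<close>
  satisfies \<open>2 c = z + c\<^sup>2\<close>.\<close>

fun sqrt_coeff :: "nat \<Rightarrow> real" where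
  "sqrt_coeff n = (if n = 0 then 0 else if n = 1 then 1 / 2
     else (\<Sum>i\<in>{1..<n}. sqrt_coeff i * sqrt_coeff (n - i)) / 2)"

declare sqrt_coeff.simps [simp del]

lemma sqrt_coeff_0 [simp]: "sqrt_coeff 0 = 0"
  by (simp add: sqrt_coeff.simps)

lemma sqrt_coeff_nonneg [simp]: "0 \<le> sqrt_coeff n"
proof (induction n rule: less_induct)
  case (less n)
  then show ?case
    by (subst sqrt_coeff.simps) (auto intro!: sum_nonneg mult_nonneg_nonneg)
qed

text \<open>Coefficientwise form of \<open>c^2 = 2 c - z\<close>. Since
  \<open>sqrt_coeff 0 = 0\<close>, the end terms of the convolution vanish, and for
  \<open>n >= 2\<close> the defining recursion remains.\<close>

lemma sqrt_coeff_convolution: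
  "(\<Sum>i\<le>n. sqrt_coeff i * sqrt_coeff (n - i)) = 2 * sqrt_coeff n - (if n = 1 then 1 else 0)"
proof -
  consider "n = 0" | "n = 1" | "2 \<le> n" by linarith
  then show ?thesis
  proof cases
    case 3
    then have "(\<Sum>i\<le>n. sqrt_coeff i * sqrt_coeff (n - i)) = (\<Sum>i\<in>{1..<n}. sqrt_coeff i * sqrt_coeff (n - i))"
      by (intro sum.mono_neutral_right) (auto simp: not_le not_less Suc_le_eq)
    with 3 show ?thesis
      by (subst (3) sqrt_coeff.simps) simp
  qed (simp_all add: sqrt_coeff.simps[of 1] sqrt_coeff.simps[of "Suc 0"])
qed

text \<open>With \<open>s N\<close> for the partial sum, the convolution identity gives
  \<open>2 * s (N + 1) <= 1 + (s N)^2\<close>: as the coefficient at 0 vanishes, a pair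
  \<open>i + j <= N + 1\<close> with nonzero product has both indices at most \<open>N\<close>. The
  bound 1 then propagates.\<close>

lemma sum_sqrt_coeff_le: "(\<Sum>n\<le>N. sqrt_coeff n) \<le> 1"
proof (induction N)
  case (Suc N)
  let ?c = sqrt_coeff
  have "2 * (\<Sum>n\<le>Suc N. ?c n) = (\<Sum>n\<le>Suc N. if n = 1 then 1 else 0) + (\<Sum>n\<le>Suc N. \<Sum>i\<le>n. ?c i * ?c (n - i))"
    by (simp only: sqrt_coeff_convolution sum_distrib_left flip: sum.distrib) simp
  also have "(\<Sum>n\<le>Suc N. if n = 1 then 1 else (0::real)) = 1"
    by (simp add: sum.delta)
  also have "(\<Sum>n\<le>Suc N. \<Sum>i\<le>n. ?c i * ?c (n - i)) = (\<Sum>(i,j)\<in>{(i,j). i + j \<le> Suc N}. ?c i * ?c j)"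
    by (rule sum.triangle_reindex_eq[symmetric])
  also have "\<dots> \<le> (\<Sum>(i,j)\<in>{..N} \<times> {..N}. ?c i * ?c j)"
  proof -
    have fin: "finite {(i,j). i + j \<le> Suc N}"
      by (rule finite_subset[of _ "{..Suc N} \<times> {..Suc N}"]) auto
    have "(\<Sum>(i,j)\<in>{(i,j). i + j \<le> Suc N}. ?c i * ?c j)
        = (\<Sum>(i,j)\<in>{(i,j). i + j \<le> Suc N \<and> i \<noteq> 0 \<and> j \<noteq> 0}. ?c i * ?c j)"
      using fin by (intro sum.mono_neutral_right) (auto intro!: Nat.gr0I)
    also have "\<dots> \<le> (\<Sum>(i,j)\<in>{..N} \<times> {..N}. ?c i * ?c j)"
      by (intro sum_mono2) auto
    finally show ?thesis .
  qed
  also have "\<dots> = (\<Sum>i\<le>N. ?c i)\<^sup>2"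
    by (simp add: power2_eq_square sum_product sum.cartesian_product)
  also have "\<dots> \<le> 1"
    using Suc by (intro power_le_one sum_nonneg) auto
  finally show ?case by simp
qed simp

lemma sum_finite_sqrt_coeff_le: "finite F \<Longrightarrow> sum sqrt_coeff F \<le> 1"
  using sum_mono2[of "{..Max F}" F sqrt_coeff] sum_sqrt_coeff_le[of "Max F"]
  by (force simp: subset_iff)

lemma sqrt_coeff_summable: "sqrt_coeff summable_on UNIV"
  by (rule nonneg_bdd_above_summable_on) (auto intro!: bdd_aboveI[of _ 1] sum_finite_sqrt_coeff_le)

lemma infsum_sqrt_coeff_le: "infsum sqrt_coeff UNIV \<le> 1"
  by (rule infsum_le_finite_sums[OF sqrt_coeff_summable sum_finite_sqrt_coeff_le])

text \<open>The second bound keeps the constant \<open>K\<close> itself, because the coefficients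
  sum to at most 1; this sharpness is what makes the square roots below nonnegative.\<close>

lemma sqrt_coeff_bounded_summable:
  fixes g :: "nat \<Rightarrow> real"
  assumes "\<And>n. \<bar>g n\<bar> \<le> K"
  shows "(\<lambda>n. sqrt_coeff n * g n) summable_on UNIV" "\<bar>\<Sum>\<^sub>\<infinity>n. sqrt_coeff n * g n\<bar> \<le> K"
proof -
  have K: "(\<lambda>n. sqrt_coeff n * K) summable_on UNIV"
    by (intro summable_on_cmult_left sqrt_coeff_summable)
  have abs: "(\<lambda>n. norm (sqrt_coeff n * g n)) summable_on UNIV"
    using assms by (intro summable_on_comparison_test[OF K]) (simp_all add: abs_mult mult_left_mono)
  then show "(\<lambda>n. sqrt_coeff n * g n) summable_on UNIV"
    by (rule abs_summable_summable)
  have "\<bar>\<Sum>\<^sub>\<infinity>n. sqrt_coeff n * g n\<bar> \<le> (\<Sum>\<^sub>\<infinity>n. norm (sqrt_coeff n * g n))"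
    using norm_infsum_bound[OF abs] by simp
  also have "\<dots> \<le> (\<Sum>\<^sub>\<infinity>n. sqrt_coeff n * K)"
    using assms by (intro infsum_mono[OF abs K]) (simp add: abs_mult mult_left_mono)
  also have "\<dots> = infsum sqrt_coeff UNIV * K"
    by (rule infsum_cmult_left) (simp add: sqrt_coeff_summable)
  also have "\<dots> \<le> 1 * K"
    using assms[of 0] by (intro mult_right_mono infsum_sqrt_coeff_le) simp
  finally show "\<bar>\<Sum>\<^sub>\<infinity>n. sqrt_coeff n * g n\<bar> \<le> K" by simp
qed

text \<open>The identity \<open>c^2 = 2 c - z\<close> with each power \<open>z^n\<close> replaced by
  the number \<open>g n\<close>; absolute summability allows the double series to be summed along
  antidiagonals. It is applied to \<open>g n = ip ((G ^^ n) x) y\<close>.\<close>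

lemma sqrt_coeff_double_sum:
  fixes g :: "nat \<Rightarrow> real"
  assumes g: "\<And>n. \<bar>g n\<bar> \<le> K"
  shows "(\<Sum>\<^sub>\<infinity>n. sqrt_coeff n * (\<Sum>\<^sub>\<infinity>m. sqrt_coeff m * g (n + m)))
    = 2 * (\<Sum>\<^sub>\<infinity>n. sqrt_coeff n * g n) - g 1"
proof -
  let ?c = sqrt_coeff
  let ?f = "\<lambda>(n, m). ?c n * ?c m * g (n + m)"
  have K0: "0 \<le> K" using g[of 0] by simp
  have "(\<lambda>p. norm (?f p)) summable_on UNIV \<times> UNIV"
  proof (rule nonneg_bdd_above_summable_on)
    have "sum (\<lambda>p. norm (?f p)) F \<le> K" if F: "finite F" for F
    proof -
      have "sum (\<lambda>p. norm (?f p)) F \<le> sum (\<lambda>(n, m). ?c n * ?c m * K) (fst ` F \<times> snd ` F)"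
      proof (rule order_trans)
        show "sum (\<lambda>p. norm (?f p)) F \<le> sum (\<lambda>(n, m). ?c n * ?c m * K) F"
          using g by (intro sum_mono) (auto simp: abs_mult intro!: mult_left_mono)
        show "sum (\<lambda>(n, m). ?c n * ?c m * K) F \<le> sum (\<lambda>(n, m). ?c n * ?c m * K) (fst ` F \<times> snd ` F)"
          using F K0 by (intro sum_mono2) (auto simp: rev_image_eqI)
      qed
      also have "\<dots> = sum ?c (fst ` F) * sum ?c (snd ` F) * K"
        by (simp add: sum_product sum.cartesian_product case_prod_unfold flip: sum_distrib_right)
      also have "\<dots> \<le> 1 * 1 * K"
        using F K0 by (intro mult_right_mono mult_mono sum_finite_sqrt_coeff_le) (auto intro!: sum_nonneg)
      finally show ?thesis by simp
    qed
    then show "bdd_above (sum (\<lambda>p. norm (?f p)) ` {F. F \<subseteq> UNIV \<times> UNIV \<and> finite F})"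
      by (intro bdd_aboveI[of _ K]) auto
  qed auto
  then have sf: "?f summable_on UNIV \<times> UNIV"
    by (rule abs_summable_summable)
  have bij: "bij_betw (\<lambda>(k, i). (i, k - i)) (SIGMA k:UNIV. {..k::nat}) (UNIV \<times> UNIV)"
    by (rule bij_betw_byWitness[where f' = "\<lambda>(i, j). (i + j, i)"]) auto
  have one: "((\<lambda>k. if k = 1 then g 1 else 0) has_sum g 1) (UNIV :: nat set)"
    by (rule has_sum_finite_neutralI[where B = "{1}"]) auto
  have "(\<Sum>\<^sub>\<infinity>n. ?c n * (\<Sum>\<^sub>\<infinity>m. ?c m * g (n + m))) = (\<Sum>\<^sub>\<infinity>n. \<Sum>\<^sub>\<infinity>m. ?f (n, m))"
    by (intro infsum_cong) (simp add: mult.assoc infsum_cmult_right')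
  also have "\<dots> = infsum ?f (UNIV \<times> UNIV)"
    by (rule infsum_Sigma_banach[OF sf])
  also have "\<dots> = infsum (\<lambda>p. ?f (case p of (k, i) \<Rightarrow> (i, k - i))) (SIGMA k:UNIV. {..k})"
    by (rule infsum_reindex_bij_betw[OF bij, symmetric])
  also have "\<dots> = (\<Sum>\<^sub>\<infinity>k. \<Sum>\<^sub>\<infinity>i\<in>{..k}. ?f (i, k - i))"
    using infsum_Sigma_banach[of "\<lambda>p. ?f (case p of (k, i) \<Rightarrow> (i, k - i))" UNIV "\<lambda>k. {..k}"]
      summable_on_reindex_bij_betw[OF bij, of ?f] sf by simp
  also have "\<dots> = (\<Sum>\<^sub>\<infinity>k. 2 * (?c k * g k) - (if k = 1 then g 1 else 0))"
  proof (intro infsum_cong)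
    fix k
    have "(\<Sum>\<^sub>\<infinity>i\<in>{..k}. ?f (i, k - i)) = (\<Sum>i\<le>k. ?c i * ?c (k - i)) * g k"
      by (simp add: sum_distrib_right)
    then show "(\<Sum>\<^sub>\<infinity>i\<in>{..k}. ?f (i, k - i)) = 2 * (?c k * g k) - (if k = 1 then g 1 else 0)"
      unfolding sqrt_coeff_convolution by (simp add: left_diff_distrib)
  qed
  also have "\<dots> = (\<Sum>\<^sub>\<infinity>k. 2 * (?c k * g k)) - (\<Sum>\<^sub>\<infinity>k::nat. if k = 1 then g 1 else 0)"
  proof (rule infsum_diff_real)
    show "(\<lambda>k. 2 * (?c k * g k)) summable_on UNIV"
      by (intro summable_on_cmult_right sqrt_coeff_bounded_summable(1)[OF g])
    show "(\<lambda>k. if k = 1 then g 1 else 0) summable_on (UNIV :: nat set)"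
      by (rule has_sum_imp_summable[OF one])
  qed
  also have "(\<Sum>\<^sub>\<infinity>k::nat. if k = 1 then g 1 else 0) = g 1"
    by (rule infsumI[OF one])
  also have "(\<Sum>\<^sub>\<infinity>k. 2 * (?c k * g k)) = 2 * (\<Sum>\<^sub>\<infinity>k. ?c k * g k)"
    by (rule infsum_cmult_right')
  finally show ?thesis .
qed

section \<open>Symmetric operators and positive contractions\<close>

context semi_inner
begin

text \<open>Vectors of norm zero are not identified, so a symmetric operator is linear only up to them.\<close>

definition sym_op :: "('v \<Rightarrow> 'v) \<Rightarrow> bool" where
  "sym_op G \<longleftrightarrow> (\<forall>x\<in>H. G x \<in> H) \<and> (\<forall>x\<in>H. \<forall>y\<in>H. ip (G x) y = ip x (G y))"

definition pos_contr :: "('v \<Rightarrow> 'v) \<Rightarrow> bool" where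
  "pos_contr G \<longleftrightarrow> sym_op G \<and> (\<forall>x\<in>H. 0 \<le> ip (G x) x \<and> ip (G x) x \<le> ip x x)"

text \<open>Tested against vectors \<open>y\<close>, since the two products may differ by a null
  vector.\<close>

definition commuting :: "('v \<Rightarrow> 'v) \<Rightarrow> ('v \<Rightarrow> 'v) \<Rightarrow> bool" where
  "commuting A B \<longleftrightarrow> (\<forall>x\<in>H. \<forall>y\<in>H. ip (A (B x)) y = ip (B (A x)) y)"

lemma sym_opD:
  assumes "sym_op G"
  shows "x \<in> H \<Longrightarrow> G x \<in> H" "x \<in> H \<Longrightarrow> y \<in> H \<Longrightarrow> ip (G x) y = ip x (G y)"
  using assms by (auto simp: sym_op_def)

lemma pos_contrD:
  assumes "pos_contr G"
  shows "sym_op G" "x \<in> H \<Longrightarrow> G x \<in> H" "x \<in> H \<Longrightarrow> y \<in> H \<Longrightarrow> ip (G x) y = ip x (G y)"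
    "x \<in> H \<Longrightarrow> 0 \<le> ip (G x) x" "x \<in> H \<Longrightarrow> ip (G x) x \<le> ip x x"
  using assms by (auto simp: pos_contr_def sym_op_def)

lemma sym_op_linear:
  assumes "sym_op G" "x \<in> H" "y \<in> H" "z \<in> H"
  shows "ip (G (x + y)) z = ip (G x) z + ip (G y) z" "ip (G (a *\<^sub>R x)) z = a * ip (G x) z"
    "ip (G (x - y)) z = ip (G x) z - ip (G y) z"
  using assms by (simp_all add: sym_opD ip_simps)

lemma sym_op_funpow:
  assumes "sym_op G"
  shows "sym_op (G ^^ n)"
proof (induction n)
  case 0
  then show ?case by (simp add: sym_op_def)
next
  case (Suc n)
  have "ip (G ((G ^^ n) x)) y = ip x (G ((G ^^ n) y))" if "x \<in> H" "y \<in> H" for x y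
  proof -
    have "ip (G ((G ^^ n) x)) y = ip x ((G ^^ n) (G y))"
      using that by (simp add: sym_opD[OF assms] sym_opD[OF Suc])
    then show ?thesis by (simp add: funpow_swap1)
  qed
  then show ?case
    using sym_opD[OF assms] sym_opD[OF Suc] by (simp add: sym_op_def)
qed

text \<open>Operator inequality \<open>G^2 <= G\<close>: the Cauchy-Schwarz inequality of the
  semi-inner product \<open>ip (G x) y\<close> is applied to \<open>x\<close> and
  \<open>G x\<close>; its factor \<open>ip (G (G x)) (G x)\<close> is at most
  \<open>ip (G x) (G x)\<close>, which cancels.\<close>

lemma pos_contr_sq_le:
  assumes G: "pos_contr G" and x: "x \<in> H"
  shows "ip (G x) (G x) \<le> ip (G x) x"
proof -
  note [simp] = pos_contrD(2)[OF G]
  interpret G: semi_inner H "\<lambda>x y. ip (G x) y"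
    using pos_contrD[OF G] subspace sym_op_linear[of G]
    by unfold_locales (simp_all add: ip_commute)
  let ?a = "ip (G x) (G x)"
  have "?a * ?a \<le> ip (G x) x * ip (G (G x)) (G x)"
    using G.cauchy_schwarz_sq[of x "G x"] x by (simp add: power2_eq_square)
  also have "\<dots> \<le> ip (G x) x * ?a"
    using pos_contrD(4,5)[OF G] x by (intro mult_left_mono) auto
  finally have *: "?a * ?a \<le> ip (G x) x * ?a" .
  show ?thesis
  proof (cases "?a = 0")
    case True
    then show ?thesis using pos_contrD(4)[OF G x] by simp
  next
    case False
    then have "0 < ?a" using ip_ge_0[of "G x"] x by simp
    then show ?thesis using * by simp
  qed
qed

lemma pos_contr_nrm_le:
  assumes "pos_contr G" "x \<in> H"
  shows "nrm (G x) \<le> nrm x"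
  using pos_contr_sq_le[OF assms] pos_contrD(5)[OF assms]
  by (simp add: nrm_def)

lemma pos_contr_funpow_nrm_le:
  assumes "pos_contr G" "x \<in> H"
  shows "nrm ((G ^^ n) x) \<le> nrm x"
proof (induction n)
  case (Suc n)
  have "(G ^^ n) x \<in> H"
    using sym_opD(1)[OF sym_op_funpow] pos_contrD(1) assms by blast
  then show ?case
    using pos_contr_nrm_le[OF assms(1)] Suc by fastforce
qed simp

lemma pos_contr_funpow_abs_le:
  assumes "pos_contr G" "x \<in> H" "y \<in> H"
  shows "\<bar>ip ((G ^^ n) x) y\<bar> \<le> nrm x * nrm y"
proof -
  have "(G ^^ n) x \<in> H"
    using sym_opD(1)[OF sym_op_funpow] pos_contrD(1) assms by blast
  then have "\<bar>ip ((G ^^ n) x) y\<bar> \<le> nrm ((G ^^ n) x) * nrm y"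
    using assms by (intro cauchy_schwarz)
  also have "\<dots> \<le> nrm x * nrm y"
    using assms by (intro mult_right_mono pos_contr_funpow_nrm_le) auto
  finally show ?thesis .
qed

lemma ip_funpow_add:
  assumes "sym_op G" "x \<in> H" "y \<in> H"
  shows "ip ((G ^^ (i + j)) x) y = ip ((G ^^ j) x) ((G ^^ i) y)"
  using assms sym_opD[OF sym_op_funpow[OF assms(1)]] by (simp add: funpow_add)

text \<open>Even powers are read as \<open>ip z z\<close> and odd ones as \<open>ip (G z) z\<close>
  with \<open>z = (G ^^ j) x\<close>; passing to the next power then uses \<open>G <= 1\<close> and
  \<open>G^2 <= G\<close> alternately.\<close>

lemma pos_contr_funpow:
  assumes G: "pos_contr G" and x: "x \<in> H"
  shows "0 \<le> ip ((G ^^ n) x) x" "ip ((G ^^ Suc n) x) x \<le> ip ((G ^^ n) x) x"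
proof -
  note s = pos_contrD(1)[OF G]
  have mem: "(G ^^ j) x \<in> H" for j
    using sym_opD(1)[OF sym_op_funpow[OF s]] x by blast
  have eq: "ip ((G ^^ (2 * j)) x) x = ip ((G ^^ j) x) ((G ^^ j) x)"
    "ip ((G ^^ Suc (2 * j)) x) x = ip (G ((G ^^ j) x)) ((G ^^ j) x)"
    "ip ((G ^^ Suc (Suc (2 * j))) x) x = ip (G ((G ^^ j) x)) (G ((G ^^ j) x))" for j
    using ip_funpow_add[OF s x x, of j j] ip_funpow_add[OF s x x, of j "Suc j"]
      ip_funpow_add[OF s x x, of "Suc j" "Suc j"] by (simp_all add: mult_2)
  have "0 \<le> ip ((G ^^ n) x) x \<and> ip ((G ^^ Suc n) x) x \<le> ip ((G ^^ n) x) x"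
  proof (cases "even n")
    case True
    then obtain j where "n = 2 * j" by blast
    then show ?thesis
      using eq[of j] mem[of j] ip_ge_0 pos_contrD(5)[OF G] by simp
  next
    case False
    then obtain j where "n = Suc (2 * j)" by (metis oddE Suc_eq_plus1)
    then show ?thesis
      using eq[of j] mem[of j] pos_contrD(4)[OF G] pos_contr_sq_le[OF G] by simp
  qed
  then show "0 \<le> ip ((G ^^ n) x) x" "ip ((G ^^ Suc n) x) x \<le> ip ((G ^^ n) x) x" by auto
qed

lemma pos_contr_funpow_le:
  assumes "pos_contr G" "x \<in> H" "i \<le> j"
  shows "ip ((G ^^ j) x) x \<le> ip ((G ^^ i) x) x"
  using assms(3) by (induction rule: dec_induct) (use pos_contr_funpow(2)[OF assms(1,2)] order_trans in auto)

lemma commuting_funpow: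
  assumes A: "sym_op A" and B: "sym_op B" and "commuting A B" and x: "x \<in> H" "y \<in> H"
  shows "ip (A ((B ^^ n) x)) y = ip ((B ^^ n) (A x)) y"
  using x
proof (induction n arbitrary: y)
  case (Suc n)
  note [simp] = sym_opD(1)[OF A] sym_opD(1)[OF B] sym_opD(1)[OF sym_op_funpow[OF B]]
  have "ip (A ((B ^^ Suc n) x)) y = ip (B (A ((B ^^ n) x))) y"
    using assms(3) Suc.prems by (simp add: commuting_def)
  also have "\<dots> = ip (A ((B ^^ n) x)) (B y)"
    using Suc.prems by (simp add: sym_opD(2)[OF B])
  also have "\<dots> = ip ((B ^^ n) (A x)) (B y)"
    using Suc by simp
  also have "\<dots> = ip ((B ^^ Suc n) (A x)) y"
    using Suc.prems by (simp add: sym_opD(2)[OF B])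
  finally show ?case .
qed simp

end

section \<open>Square roots from the coefficient series\<close>

context semi_hilbert
begin

text \<open>\<open>T = 1 - \<Sum>\<^sub>n c\<^sub>n G\<^sup>n\<close> is the square root of \<open>1 - G\<close>.\<close>

lemma sqrt_series:
  assumes G: "pos_contr G"
  obtains T where "pos_contr T"
    "\<And>x y. x \<in> H \<Longrightarrow> y \<in> H \<Longrightarrow> ip (T x) y = ip x y - (\<Sum>\<^sub>\<infinity>n. sqrt_coeff n * ip ((G ^^ n) x) y)"
    "\<And>x y. x \<in> H \<Longrightarrow> y \<in> H \<Longrightarrow> ip (T (T x)) y = ip x y - ip (G x) y"
proof -
  note s = pos_contrD(1)[OF G]
  note sn = sym_opD[OF sym_op_funpow[OF s]]
  let ?t = "\<lambda>x y. ip x y - (\<Sum>\<^sub>\<infinity>n. sqrt_coeff n * ip ((G ^^ n) x) y)"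
  note summ = sqrt_coeff_bounded_summable[of "\<lambda>n. ip ((G ^^ n) x) y" "nrm x * nrm y" for x y,
      OF pos_contr_funpow_abs_le[OF G]]
  \<comment> \<open>\<open>T x\<close> is found by representing the functional \<open>?t x\<close>,
    so only convergence of the scalar series is used.\<close>
  have "\<exists>p\<in>H. \<forall>y\<in>H. ip p y = ?t x y" if x: "x \<in> H" for x
  proof (rule riesz[of "?t x" "2 * nrm x"])
    show "?t x (y + z) = ?t x y + ?t x z" if "y \<in> H" "z \<in> H" for y z
      using infsum_add[OF summ(1)[OF x that(1)] summ(1)[OF x that(2)]] x that sn(1)
      by (simp add: ip_simps algebra_simps)
    show "?t x (a *\<^sub>R y) = a * ?t x y" if "y \<in> H" for y a
      using x that sn(1) infsum_cmult_right'[of a "\<lambda>n. sqrt_coeff n * ip ((G ^^ n) x) y" UNIV]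
      by (simp add: ip_simps algebra_simps)
    show "\<bar>?t x y\<bar> \<le> 2 * nrm x * nrm y" if "y \<in> H" for y
      using summ(2)[OF x that] cauchy_schwarz[OF x that] by linarith
  qed
  then obtain T where T: "\<And>x. x \<in> H \<Longrightarrow> T x \<in> H" "\<And>x y. x \<in> H \<Longrightarrow> y \<in> H \<Longrightarrow> ip (T x) y = ?t x y"
    by metis
  have sT: "sym_op T"
    unfolding sym_op_def
  proof (intro conjI ballI)
    fix x y assume xy: "x \<in> H" "y \<in> H"
    have "ip (T x) y = ?t y x"
      using xy T(2) sn ip_commute by simp
    then show "ip (T x) y = ip x (T y)"
      using xy T by (simp add: ip_commute[of x])
  qed (use T in auto)
  have pT: "pos_contr T"
    unfolding pos_contr_def
  proof (intro conjI ballI sT)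
    fix x assume x: "x \<in> H"
    have "(\<Sum>\<^sub>\<infinity>n. sqrt_coeff n * ip ((G ^^ n) x) x) \<le> ip x x"
      using summ(2)[OF x x] x by (simp add: nrm_sq flip: power2_eq_square)
    then show "0 \<le> ip (T x) x"
      using T x by simp
    show "ip (T x) x \<le> ip x x"
      using T x infsum_nonneg[of UNIV "\<lambda>n. sqrt_coeff n * ip ((G ^^ n) x) x"] pos_contr_funpow(1)[OF G x]
      by simp
  qed
  have "ip (T (T x)) y = ip x y - ip (G x) y" if xy: "x \<in> H" "y \<in> H" for x y
  proof -
    define g where "g n = ip ((G ^^ n) x) y" for n
    have g: "\<bar>g n\<bar> \<le> nrm x * nrm y" for n
      unfolding g_def by (rule pos_contr_funpow_abs_le[OF G xy])
    \<comment> \<open>Moving \<open>G ^^ n\<close> to the right-hand argument reduces this to the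
      definition of \<open>T x\<close>, and \<open>ip_funpow_add\<close> shifts the index of
      \<open>g\<close>.\<close>
    have gT: "ip ((G ^^ n) (T x)) y = g n - (\<Sum>\<^sub>\<infinity>m. sqrt_coeff m * g (n + m))" for n
    proof -
      have "ip ((G ^^ n) (T x)) y = ?t x ((G ^^ n) y)"
        using xy T sn by simp
      then show ?thesis
        using xy by (simp add: g_def sn ip_funpow_add[OF s] flip: sn(2))
    qed
    have gs: "\<bar>g (n + m)\<bar> \<le> nrm x * nrm y" for n m by (rule g)
    have "ip (T (T x)) y = ip (T x) y - (\<Sum>\<^sub>\<infinity>n. sqrt_coeff n * ip ((G ^^ n) (T x)) y)"
      using xy T by simp
    also have "(\<Sum>\<^sub>\<infinity>n. sqrt_coeff n * ip ((G ^^ n) (T x)) y)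
        = (\<Sum>\<^sub>\<infinity>n. sqrt_coeff n * g n - sqrt_coeff n * (\<Sum>\<^sub>\<infinity>m. sqrt_coeff m * g (n + m)))"
      by (simp add: gT right_diff_distrib)
    also have "\<dots> = (\<Sum>\<^sub>\<infinity>n. sqrt_coeff n * g n)
        - (\<Sum>\<^sub>\<infinity>n. sqrt_coeff n * (\<Sum>\<^sub>\<infinity>m. sqrt_coeff m * g (n + m)))"
      by (rule infsum_diff_real[OF sqrt_coeff_bounded_summable(1)[of g, OF g]
            sqrt_coeff_bounded_summable(1)[of "\<lambda>n. \<Sum>\<^sub>\<infinity>m. sqrt_coeff m * g (n + m)",
              OF sqrt_coeff_bounded_summable(2)[of "\<lambda>m. g (n + m)" for n, OF gs]]])
    \<comment> \<open>With \<open>S\<close> for the single series, the total is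
      \<open>(ip x y - S) - (S - (2 S - g 1)) = ip x y - g 1\<close>.\<close>
    also have "(\<Sum>\<^sub>\<infinity>n. sqrt_coeff n * (\<Sum>\<^sub>\<infinity>m. sqrt_coeff m * g (n + m)))
        = 2 * (\<Sum>\<^sub>\<infinity>n. sqrt_coeff n * g n) - g 1"
      by (rule sqrt_coeff_double_sum[OF g])
    finally show ?thesis
      using xy T by (simp add: g_def)
  qed
  then show ?thesis
    using that[OF pT] T by blast
qed

text \<open>\<open>R\<close> is the root of \<open>G\<close> and \<open>T\<close> that of
  \<open>1 - G\<close>. As \<open>G\<close> and \<open>B = 1 - G\<close> are both positive
  contractions, one series produces both, \<open>R\<close> being the root of \<open>1 - B\<close>.
  The last two claims make \<open>T R\<close> symmetric and nonnegative, as the unbounded root built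
  from the pair requires.\<close>

lemma sqrt_pair:
  assumes G: "pos_contr G"
  obtains R T where "sym_op R" "sym_op T"
    "\<And>x y. x \<in> H \<Longrightarrow> y \<in> H \<Longrightarrow> ip (R (R x)) y = ip (G x) y"
    "\<And>x y. x \<in> H \<Longrightarrow> y \<in> H \<Longrightarrow> ip (T (T x)) y = ip x y - ip (G x) y"
    "commuting T R" "\<And>x. x \<in> H \<Longrightarrow> 0 \<le> ip (T (R x)) x"
proof -
  note sG = pos_contrD(1)[OF G]
  define B where "B x = x - G x" for x
  have B: "pos_contr B"
    using pos_contrD[OF G] by (auto simp: pos_contr_def sym_op_def B_def ip_simps)
  note sB = pos_contrD(1)[OF B]
  obtain T where T: "pos_contr T"
    "\<And>x y. x \<in> H \<Longrightarrow> y \<in> H \<Longrightarrow> ip (T x) y = ip x y - (\<Sum>\<^sub>\<infinity>n. sqrt_coeff n * ip ((G ^^ n) x) y)"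
    "\<And>x y. x \<in> H \<Longrightarrow> y \<in> H \<Longrightarrow> ip (T (T x)) y = ip x y - ip (G x) y"
    using sqrt_series[OF G] by blast
  obtain R where R: "pos_contr R"
    "\<And>x y. x \<in> H \<Longrightarrow> y \<in> H \<Longrightarrow> ip (R x) y = ip x y - (\<Sum>\<^sub>\<infinity>n. sqrt_coeff n * ip ((B ^^ n) x) y)"
    "\<And>x y. x \<in> H \<Longrightarrow> y \<in> H \<Longrightarrow> ip (R (R x)) y = ip x y - ip (B x) y"
    using sqrt_series[OF B] by blast
  note sT = pos_contrD(1)[OF T(1)] and sR = pos_contrD(1)[OF R(1)]
  \<comment> \<open>What commutes with \<open>F\<close> commutes with the series in
    \<open>F\<close>. Used twice: \<open>B\<close> commutes with \<open>G\<close>, hence with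
    \<open>T\<close>; then \<open>T\<close> commutes with \<open>B\<close>, hence with
    \<open>R\<close>.\<close>
  have commuting_series: "commuting A S"
    if A: "sym_op A" and F: "sym_op F" and AF: "commuting A F" and S: "sym_op S"
      and series: "\<And>x y. x \<in> H \<Longrightarrow> y \<in> H \<Longrightarrow> ip (S x) y = ip x y - (\<Sum>\<^sub>\<infinity>n. sqrt_coeff n * ip ((F ^^ n) x) y)"
    for A F S
    unfolding commuting_def
  proof (intro ballI)
    fix x y assume xy: "x \<in> H" "y \<in> H"
    have "ip (A (S x)) y = ip x (A y) - (\<Sum>\<^sub>\<infinity>n. sqrt_coeff n * ip ((F ^^ n) x) (A y))"
      using xy series sym_opD[OF A] sym_opD[OF S] by simp
    also have "\<dots> = ip (A x) y - (\<Sum>\<^sub>\<infinity>n. sqrt_coeff n * ip (A ((F ^^ n) x)) y)"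
      using xy sym_opD[OF A] sym_opD[OF sym_op_funpow[OF F]] by simp
    also have "\<dots> = ip (S (A x)) y"
      using xy series sym_opD[OF A] commuting_funpow[OF A F AF] by simp
    finally show "ip (A (S x)) y = ip (S (A x)) y" .
  qed
  have comm_sym: "commuting A F \<Longrightarrow> commuting F A" for A F
    by (simp add: commuting_def)
  have "commuting B G"
    using sym_opD[OF sG] by (simp add: commuting_def B_def ip_simps sym_op_linear(3)[OF sG])
  from commuting_series[OF sB sG this sT T(2)] have "commuting T B"
    by (rule comm_sym)
  from commuting_series[OF sT sB this sR R(2)] have TR: "commuting T R" .
  have RR: "ip (R (R x)) y = ip (G x) y" if "x \<in> H" "y \<in> H" for x y
    using R(3)[OF that] that sym_opD[OF sG] by (simp add: B_def ip_simps)
  have "0 \<le> ip (T (R x)) x" if x: "x \<in> H" for x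
  proof -
    have Rn: "(R ^^ n) z \<in> H" if "z \<in> H" for n z
      using that sym_opD(1)[OF sym_op_funpow[OF sR]] by blast
    have Gn: "(G ^^ n) z \<in> H" if "z \<in> H" for n z
      using that sym_opD(1)[OF sym_op_funpow[OF sG]] by blast
    have pow: "ip ((G ^^ n) z) y = ip ((R ^^ (2 * n)) z) y" if "z \<in> H" "y \<in> H" for n y z
      using that
    proof (induction n arbitrary: y)
      case (Suc n)
      have "ip ((G ^^ Suc n) z) y = ip (R (R ((G ^^ n) z))) y"
        using Suc.prems RR Gn by simp
      also have "\<dots> = ip ((G ^^ n) z) (R (R y))"
        using Suc.prems sym_opD[OF sR] Gn by simp
      also have "\<dots> = ip ((R ^^ (2 * n)) z) (R (R y))"
        using Suc sym_opD[OF sR] by simp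
      also have "\<dots> = ip ((R ^^ (2 * Suc n)) z) y"
        using Suc.prems sym_opD[OF sR] Rn by simp
      finally show ?case .
    qed simp
    \<comment> \<open>\<open>s n\<close> is the value of the odd power \<open>R ^^ (2 n + 1)\<close>
      and so at most \<open>ip (R x) x\<close>; since the coefficients sum to at most 1, the series
      cannot exceed \<open>ip (R x) x\<close>.\<close>
    define s where "s n = ip ((G ^^ n) (R x)) x" for n
    have s_eq: "s n = ip ((R ^^ Suc (2 * n)) x) x" for n
      using pow[of "R x" x n] x sym_opD[OF sR] by (simp add: s_def funpow_swap1)
    have s_le: "\<bar>s n\<bar> \<le> ip (R x) x" for n
      using pos_contr_funpow_le[OF R(1) x, of "Suc 0" "Suc (2 * n)"] pos_contr_funpow(1)[OF R(1) x, of "Suc (2 * n)"]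
      by (simp add: s_eq del: funpow.simps(2)) simp
    have "ip (T (R x)) x = ip (R x) x - (\<Sum>\<^sub>\<infinity>n. sqrt_coeff n * s n)"
      using T(2) x sym_opD[OF sR] by (simp add: s_def)
    then show ?thesis
      using sqrt_coeff_bounded_summable(2)[of s, OF s_le] by linarith
  qed
  then show ?thesis
    using that[OF sR sT RR T(3) TR] by blast
qed

end

section \<open>The space of square integrable functions\<close>

lemma l2_spaceD:
  assumes "f \<in> l2_space m"
  shows "f \<in> borel_measurable m" "integrable m (\<lambda>x. (f x)\<^sup>2)"
  using assms by (auto simp: l2_space_def)

lemma l2_integrable_mult:
  assumes "f \<in> l2_space m" "g \<in> l2_space m"
  shows "integrable m (\<lambda>x. f x * g x)"
proof (rule Bochner_Integration.integrable_bound)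
  show "integrable m (\<lambda>x. (f x)\<^sup>2 + (g x)\<^sup>2)"
    using assms by (auto simp: l2_space_def)
  have "\<bar>f x * g x\<bar> \<le> (f x)\<^sup>2 + (g x)\<^sup>2" for x
  proof -
    have "2 * \<bar>f x * g x\<bar> \<le> (f x)\<^sup>2 + (g x)\<^sup>2"
      using sum_squares_bound[of "\<bar>f x\<bar>" "\<bar>g x\<bar>"] by (simp add: abs_mult mult.assoc)
    then show ?thesis by simp
  qed
  then show "AE x in m. norm (f x * g x) \<le> norm ((f x)\<^sup>2 + (g x)\<^sup>2)"
    by simp
qed (use assms in \<open>auto simp: l2_space_def\<close>)

lemma l2_space_combine:
  assumes "f \<in> l2_space m" "g \<in> l2_space m"
  shows "(\<lambda>x. a * f x + b * g x) \<in> l2_space m"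
proof -
  have "integrable m (\<lambda>x. a\<^sup>2 * (f x)\<^sup>2 + 2 * a * b * (f x * g x) + b\<^sup>2 * (g x)\<^sup>2)"
    using assms l2_integrable_mult[OF assms] by (auto simp: l2_space_def)
  moreover have "(\<lambda>x. a\<^sup>2 * (f x)\<^sup>2 + 2 * a * b * (f x * g x) + b\<^sup>2 * (g x)\<^sup>2) = (\<lambda>x. (a * f x + b * g x)\<^sup>2)"
    by (auto simp: power2_eq_square algebra_simps)
  ultimately show ?thesis
    using assms by (auto simp: l2_space_def)
qed

text \<open>Turns the pointwise combinations in \<open>symmetric_form\<close> into operations of the
  vector space of functions.\<close>

lemma combine_fun_eq: "(\<lambda>x. a * f x + b * g x) = a *\<^sub>R f + b *\<^sub>R (g :: 'a \<Rightarrow> real)"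
  by (simp add: fun_eq_iff)

lemma l2_space_subspace: "subspace (l2_space m)"
  unfolding subspace_def
proof (intro conjI ballI allI)
  show "0 \<in> l2_space m" by (simp add: l2_space_def zero_fun_def)
  show "f + g \<in> l2_space m" if "f \<in> l2_space m" "g \<in> l2_space m" for f g
    using l2_space_combine[OF that, of 1 1] by (simp only: combine_fun_eq scaleR_one)
  show "c *\<^sub>R f \<in> l2_space m" if "f \<in> l2_space m" for c f
    using l2_space_combine[OF that that, of c 0] by (simp only: combine_fun_eq scaleR_zero_left add_0_right)
qed

lemma l2_semi_inner: "semi_inner (l2_space m) (l2_inner m)"
proof
  show "subspace (l2_space m)" by (rule l2_space_subspace)
qed (auto simp: l2_inner_def mult.commute distrib_left l2_integrable_mult mult.assoc mult.left_commute)

lemma l2_nrm_eq: "semi_inner.nrm (l2_inner m) = l2_norm m"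
  by (rule ext) (simp add: semi_inner.nrm_def[OF l2_semi_inner] l2_norm_def)

lemma l2_norm_nn_integral:
  assumes "f \<in> l2_space m"
  shows "(\<integral>\<^sup>+x. ennreal ((f x)\<^sup>2) \<partial>m) = ennreal ((l2_norm m f)\<^sup>2)"
  using assms l2_spaceD(2)[OF assms]
  by (subst nn_integral_eq_integral) (auto simp: l2_norm_def l2_inner_def power2_eq_square)

lemma l2_spaceI_nn_integral:
  assumes "f \<in> borel_measurable m" "(\<integral>\<^sup>+x. ennreal ((f x)\<^sup>2) \<partial>m) \<le> ennreal (c\<^sup>2)" "0 \<le> c"
  shows "f \<in> l2_space m" "l2_norm m f \<le> c"
proof -
  have "integrable m (\<lambda>x. (f x)\<^sup>2)"
    using assms le_less_trans[OF assms(2) ennreal_less_top] by (intro integrableI_bounded) auto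
  then show *: "f \<in> l2_space m"
    using assms(1) by (simp add: l2_space_def)
  have "(l2_norm m f)\<^sup>2 \<le> c\<^sup>2"
    using assms(2) l2_norm_nn_integral[OF *] by simp
  then show "l2_norm m f \<le> c"
    using assms(3) by (rule power2_le_imp_le)
qed

text \<open>A subsequence with \<open>\<parallel>v (k + 1) - v k\<parallel> < 2\<^sup>-\<^sup>k\<close> converges almost everywhere because
  \<open>\<bar>d\<bar> \<le> (2\<^sup>k d\<^sup>2 + 2\<^sup>-\<^sup>k) / 2\<close> and \<open>\<Sum>\<^sub>k 2\<^sup>k (v (k + 1) - v k)\<^sup>2\<close> is integrable.\<close>

lemma l2_fast_cauchy_AE_convergent:
  assumes v: "\<And>k. v k \<in> l2_space m" and fast: "\<And>k. l2_norm m (v (Suc k) - v k) \<le> (1/2) ^ k"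
  shows "AE x in m. convergent (\<lambda>k. v k x)"
proof -
  interpret semi_inner "l2_space m" "l2_inner m" by (rule l2_semi_inner)
  have [measurable]: "v k \<in> borel_measurable m" for k
    using v by (rule l2_spaceD)
  have d: "v (Suc k) - v k \<in> l2_space m" for k
    using v by simp
  let ?f = "\<lambda>k x. ennreal (2 ^ k * (v (Suc k) x - v k x)\<^sup>2)"
  have bound: "(\<integral>\<^sup>+x. ?f k x \<partial>m) \<le> ennreal ((1/2) ^ k)" for k
  proof -
    have "(\<integral>\<^sup>+x. ?f k x \<partial>m) = ennreal (2 ^ k) * (\<integral>\<^sup>+x. ennreal (((v (Suc k) - v k) x)\<^sup>2) \<partial>m)"
      by (subst nn_integral_cmult[symmetric]) (auto simp: ennreal_mult)
    also have "\<dots> = ennreal (2 ^ k) * ennreal ((l2_norm m (v (Suc k) - v k))\<^sup>2)"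
      by (subst l2_norm_nn_integral[OF d]) simp
    also have "\<dots> = ennreal (2 ^ k * (l2_norm m (v (Suc k) - v k))\<^sup>2)"
      by (simp add: ennreal_mult)
    also have "\<dots> \<le> ennreal (2 ^ k * ((1/2) ^ k)\<^sup>2)"
      using fast[of k] nrm_ge_0[OF d] by (intro ennreal_leI mult_left_mono power_mono) (auto simp: l2_nrm_eq)
    also have "2 ^ k * ((1/2) ^ k)\<^sup>2 = ((1/2) ^ k :: real)"
      by (simp add: power2_eq_square flip: mult.assoc power_mult_distrib)
    finally show ?thesis .
  qed
  have "(\<integral>\<^sup>+x. (\<Sum>k. ?f k x) \<partial>m) = (\<Sum>k. \<integral>\<^sup>+x. ?f k x \<partial>m)"
    by (rule nn_integral_suminf) measurable
  also have "\<dots> \<le> (\<Sum>k. ennreal ((1/2) ^ k))"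
    by (intro suminf_le bound) auto
  also have "\<dots> < \<infinity>"
    by (subst suminf_ennreal2) (auto simp: ennreal_less_top)
  finally have "AE x in m. (\<Sum>k. ?f k x) \<noteq> \<infinity>"
    by (intro nn_integral_noteq_infinite) auto
  then show ?thesis
  proof (rule AE_mp, intro AE_I2 impI)
    fix x assume "(\<Sum>k. ?f k x) \<noteq> \<infinity>"
    then have s: "summable (\<lambda>k. 2 ^ k * (v (Suc k) x - v k x)\<^sup>2)"
      by (intro summable_suminf_not_top) auto
    have "summable (\<lambda>k. v (Suc k) x - v k x)"
    proof (rule summable_comparison_test')
      show "summable (\<lambda>k. (2 ^ k * (v (Suc k) x - v k x)\<^sup>2 + (1/2) ^ k) / 2)"
        by (intro summable_divide summable_add s summable_geometric) simp
      show "norm (v (Suc k) x - v k x) \<le> (2 ^ k * (v (Suc k) x - v k x)\<^sup>2 + (1/2) ^ k) / 2" for k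
      proof -
        define d where "d = \<bar>v (Suc k) x - v k x\<bar>"
        have "0 \<le> (2 ^ k * d - 1)\<^sup>2 / 2 ^ k" by simp
        also have "\<dots> = 2 ^ k * d\<^sup>2 - 2 * d + (1/2) ^ k"
          by (simp add: power2_eq_square power_one_over field_simps)
        finally show ?thesis by (simp add: d_def)
      qed
    qed
    then have "convergent (\<lambda>n. (\<Sum>k<n. v (Suc k) x - v k x) + v 0 x)"
      by (intro convergent_add convergent_const) (simp add: summable_iff_convergent)
    then show "convergent (\<lambda>k. v k x)"
      using sum_lessThan_telescope[of "\<lambda>k. v k x"] by simp
  qed
qed

text \<open>Riesz-Fischer. Along a fast subsequence \<open>v\<close> the pointwise limit
  \<open>w\<close> exists almost everywhere; Fatou applied to \<open>u j - v i\<close> as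
  \<open>i\<close> grows gives at once that \<open>u j - w\<close> is square integrable and that its
  norm is small.\<close>

lemma l2_complete:
  assumes u: "\<And>n. u n \<in> l2_space m"
    and cauchy: "semi_inner.cauchy_seq (l2_inner m) u"
  shows "\<exists>w\<in>l2_space m. (\<lambda>n. l2_norm m (u n - w)) \<longlonglongrightarrow> 0"
proof -
  interpret semi_inner "l2_space m" "l2_inner m" by (rule l2_semi_inner)
  note [simp] = l2_nrm_eq[of m]
  have "\<exists>N. \<forall>j\<ge>N. \<forall>k\<ge>N. l2_norm m (u j - u k) < (1/2) ^ i" for i
    using cauchy unfolding cauchy_seq_def by simp
  then obtain N where N: "\<And>i j k. j \<ge> N i \<Longrightarrow> k \<ge> N i \<Longrightarrow> l2_norm m (u j - u k) < (1/2) ^ i"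
    by metis
  \<comment> \<open>The maximum places the index \<open>r i\<close> beyond \<open>N k\<close> for
    every \<open>k <= i\<close>, not only beyond \<open>N i\<close>.\<close>
  define r where "r i = Max (N ` {..i})" for i
  have r_ge: "N i \<le> r j" if "i \<le> j" for i j
    using that by (auto simp: r_def)
  define v where "v i = u (r i)" for i
  have v: "v i \<in> l2_space m" for i
    using u by (simp add: v_def)
  have [measurable]: "v i \<in> borel_measurable m" for i
    using v by (rule l2_spaceD)
  have vN: "l2_norm m (u j - v i) \<le> (1/2) ^ k" if "N k \<le> j" "k \<le> i" for i j k
    using N[OF that(1) r_ge[OF that(2)]] by (simp add: v_def)
  have "AE x in m. convergent (\<lambda>k. v k x)"
    using vN[OF r_ge] by (intro l2_fast_cauchy_AE_convergent v) (simp add: v_def)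
  then have lim: "AE x in m. (\<lambda>k. v k x) \<longlonglongrightarrow> lim (\<lambda>k. v k x)"
    by (simp add: convergent_LIMSEQ_iff)
  define w where "w x = lim (\<lambda>k. v k x)" for x
  have [measurable]: "w \<in> borel_measurable m"
    unfolding w_def by measurable
  have bound: "u j - w \<in> l2_space m \<and> l2_norm m (u j - w) \<le> (1/2) ^ k" if "N k \<le> j" for j k
  proof -
    have [measurable]: "u j \<in> borel_measurable m"
      using u by (rule l2_spaceD)
    have "(\<integral>\<^sup>+x. ennreal (((u j - w) x)\<^sup>2) \<partial>m) = (\<integral>\<^sup>+x. liminf (\<lambda>i. ennreal ((u j x - v i x)\<^sup>2)) \<partial>m)"
    proof (rule nn_integral_cong_AE, rule AE_mp[OF lim], intro AE_I2 impI)
      fix x assume "(\<lambda>k. v k x) \<longlonglongrightarrow> lim (\<lambda>k. v k x)"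
      then have "(\<lambda>i. ennreal ((u j x - v i x)\<^sup>2)) \<longlonglongrightarrow> ennreal ((u j x - w x)\<^sup>2)"
        unfolding w_def by (intro tendsto_intros)
      then show "ennreal (((u j - w) x)\<^sup>2) = liminf (\<lambda>i. ennreal ((u j x - v i x)\<^sup>2))"
        using lim_imp_Liminf[OF sequentially_bot] by fastforce
    qed
    also have "\<dots> \<le> liminf (\<lambda>i. \<integral>\<^sup>+x. ennreal ((u j x - v i x)\<^sup>2) \<partial>m)"
      by (rule nn_integral_liminf) measurable
    also have "\<dots> \<le> ennreal (((1/2) ^ k)\<^sup>2)"
    proof (rule Liminf_le)
      have "(\<integral>\<^sup>+x. ennreal ((u j x - v i x)\<^sup>2) \<partial>m) \<le> ennreal (((1/2) ^ k)\<^sup>2)" if "k \<le> i" for i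
      proof -
        have d: "u j - v i \<in> l2_space m" using u v by simp
        have "(\<integral>\<^sup>+x. ennreal ((u j x - v i x)\<^sup>2) \<partial>m) = ennreal ((l2_norm m (u j - v i))\<^sup>2)"
          using l2_norm_nn_integral[OF d] by simp
        also have "\<dots> \<le> ennreal (((1/2) ^ k)\<^sup>2)"
          using vN[OF \<open>N k \<le> j\<close> that] nrm_ge_0[OF d] by (intro ennreal_leI power_mono) auto
        finally show ?thesis .
      qed
      then show "\<forall>\<^sub>F i in sequentially. (\<integral>\<^sup>+x. ennreal ((u j x - v i x)\<^sup>2) \<partial>m) \<le> ennreal (((1/2) ^ k)\<^sup>2)"
        by (rule eventually_mono[OF eventually_ge_at_top])
    qed simp
    finally show ?thesis
      using l2_spaceI_nn_integral[of "u j - w" m "(1/2) ^ k"] by (simp add: fun_diff_def)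
  qed
  have w: "w \<in> l2_space m"
    using mem(3)[OF u[of "N 0"] bound[of 0 "N 0", THEN conjunct1]] by simp
  moreover have "(\<lambda>n. l2_norm m (u n - w)) \<longlonglongrightarrow> 0"
  proof (rule LIMSEQ_I)
    fix e :: real assume "0 < e"
    then obtain k where "(1/2) ^ k < e"
      using real_arch_pow_inv[of e "1/2"] by auto
    then have "norm (l2_norm m (u n - w) - 0) < e" if "n \<ge> N k" for n
      using bound[OF that] nrm_ge_0[of "u n - w"] by simp
    then show "\<exists>no. \<forall>n\<ge>no. norm (l2_norm m (u n - w) - 0) < e" by blast
  qed
  ultimately show ?thesis by blast
qed

lemma l2_semi_hilbert: "semi_hilbert (l2_space m) (l2_inner m)"
proof -
  interpret semi_inner "l2_space m" "l2_inner m" by (rule l2_semi_inner)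
  show ?thesis
    by unfold_locales (use l2_complete in \<open>auto simp: l2_nrm_eq\<close>)
qed

lemma l2_norm_eq_0_iff:
  assumes "f \<in> l2_space m"
  shows "l2_norm m f = 0 \<longleftrightarrow> (AE x in m. f x = 0)"
proof -
  have "l2_norm m f = 0 \<longleftrightarrow> (LINT x|m. (f x)\<^sup>2) = 0"
    by (simp add: l2_norm_def l2_inner_def power2_eq_square)
  also have "\<dots> \<longleftrightarrow> (AE x in m. (f x)\<^sup>2 = 0)"
    using l2_spaceD[OF assms] by (intro integral_nonneg_eq_0_iff_AE) auto
  finally show ?thesis by simp
qed

lemma l2_norm_diff_eq_0_iff:
  assumes "f \<in> l2_space m" "g \<in> l2_space m"
  shows "l2_norm m (f - g) = 0 \<longleftrightarrow> (AE x in m. f x = g x)"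
  using l2_norm_eq_0_iff[of "f - g" m] subspace_diff[OF l2_space_subspace assms] by simp

text \<open>Bridge between the two ways of neglecting null functions: forms are stated with almost
  everywhere equality, operators are compared through inner products.\<close>

lemma l2_AE_eq_iff:
  assumes "f \<in> l2_space m" "g \<in> l2_space m"
  shows "(AE x in m. f x = g x) \<longleftrightarrow> (\<forall>y\<in>l2_space m. l2_inner m f y = l2_inner m g y)"
proof -
  interpret l2: semi_hilbert "l2_space m" "l2_inner m" rewrites "semi_inner.nrm (l2_inner m) = l2_norm m"
    by (rule l2_semi_hilbert l2_nrm_eq)+
  show ?thesis
  proof
    assume "AE x in m. f x = g x"
    then have "l2_norm m (f - g) = 0"
      using l2_norm_diff_eq_0_iff assms by blast
    then have "l2_inner m (f - g) y = 0" if "y \<in> l2_space m" for y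
      using l2.ip_eq_0_if_nrm_eq_0(1) assms that l2.mem(3) by blast
    then show "\<forall>y\<in>l2_space m. l2_inner m f y = l2_inner m g y"
      using assms by (simp add: l2.ip_diff_left)
  next
    assume *: "\<forall>y\<in>l2_space m. l2_inner m f y = l2_inner m g y"
    have "l2_norm m (f - g) = 0"
      using assms * by (intro l2.nrm_eq_0_if_orth) (auto simp: l2.ip_diff_left)
    then show "AE x in m. f x = g x"
      using l2_norm_diff_eq_0_iff assms by blast
  qed
qed

text \<open>The squares of \<open>u n - w\<close> tend to 0 in \<open>L1\<close>, so a subsequence
  of them tends to 0 almost everywhere.\<close>

lemma l2_subseq_AE:
  assumes u: "\<And>n. u n \<in> l2_space m" "w \<in> l2_space m" and lim: "(\<lambda>n. l2_norm m (u n - w)) \<longlonglongrightarrow> 0"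
  obtains r where "strict_mono r" "AE x in m. (\<lambda>n. u (r n) x) \<longlonglongrightarrow> w x"
proof -
  interpret l2: semi_hilbert "l2_space m" "l2_inner m" rewrites "semi_inner.nrm (l2_inner m) = l2_norm m"
    by (rule l2_semi_hilbert l2_nrm_eq)+
  have "\<exists>r. strict_mono r \<and> (AE x in m. (\<lambda>n. ((u (r n) - w) x)\<^sup>2) \<longlonglongrightarrow> 0)"
  proof (rule tendsto_L1_AE_subseq)
    show "integrable m (\<lambda>x. ((u n - w) x)\<^sup>2)" for n
      using l2_spaceD(2)[of "u n - w" m] u by (simp del: minus_apply fun_diff_def)
    have "(\<lambda>n. (l2_norm m (u n - w))\<^sup>2) \<longlonglongrightarrow> 0"
      using tendsto_power[OF lim, of 2] by simp
    moreover have "(l2_norm m (u n - w))\<^sup>2 = (LINT x|m. norm (((u n - w) x)\<^sup>2))" for n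
      using u by (simp add: l2.nrm_sq) (simp add: l2_inner_def power2_eq_square)
    ultimately show "(\<lambda>n. LINT x|m. norm (((u n - w) x)\<^sup>2)) \<longlonglongrightarrow> 0" by simp
  qed
  then obtain r where r: "strict_mono r" "AE x in m. (\<lambda>n. ((u (r n) - w) x)\<^sup>2) \<longlonglongrightarrow> 0" by blast
  from r(2) have "AE x in m. (\<lambda>n. u (r n) x) \<longlonglongrightarrow> w x"
  proof (rule AE_mp, intro AE_I2 impI)
    fix x assume "(\<lambda>n. ((u (r n) - w) x)\<^sup>2) \<longlonglongrightarrow> 0"
    then have "(\<lambda>n. u (r n) x - w x) \<longlonglongrightarrow> 0"
      using tendsto_real_sqrt[of "\<lambda>n. (u (r n) x - w x)\<^sup>2" 0 sequentially]
      by (simp add: tendsto_rabs_zero_iff)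
    then show "(\<lambda>n. u (r n) x) \<longlonglongrightarrow> w x"
      by (rule LIM_zero_cancel)
  qed
  with r(1) show ?thesis using that by blast
qed

lemma l2_dense_iff:
  "l2_dense m S \<longleftrightarrow> S \<subseteq> l2_space m \<and> (\<forall>f\<in>l2_space m. \<forall>e>0. \<exists>g\<in>S. l2_norm m (f - g) < e)"
  by (simp only: l2_dense_def fun_diff_def)

lemma l2_denseD:
  assumes "l2_dense m S"
  shows "S \<subseteq> l2_space m" "f \<in> l2_space m \<Longrightarrow> 0 < e \<Longrightarrow> \<exists>g\<in>S. l2_norm m (f - g) < e"
  using assms unfolding l2_dense_iff by auto

lemma l2_denseI:
  assumes "subspace S" "S \<subseteq> l2_space m"
    and orth: "\<And>h. h \<in> l2_space m \<Longrightarrow> (\<And>u. u \<in> S \<Longrightarrow> l2_inner m h u = 0) \<Longrightarrow> l2_norm m h = 0"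
  shows "l2_dense m S"
  unfolding l2_dense_iff
proof (intro conjI ballI allI impI assms(2))
  interpret l2: semi_hilbert "l2_space m" "l2_inner m" rewrites "semi_inner.nrm (l2_inner m) = l2_norm m"
    by (rule l2_semi_hilbert l2_nrm_eq)+
  fix f e assume f: "f \<in> l2_space m" and e: "0 < (e::real)"
  obtain u where u: "\<And>n. u n \<in> S" "(\<lambda>n. l2_norm m (u n - f)) \<longlonglongrightarrow> 0"
    using l2.dense_if_orth_null[OF assms(1,2) orth f] by auto
  from LIMSEQ_D[OF u(2) e] obtain n where "norm (l2_norm m (u n - f) - 0) < e"
    by blast
  then have "l2_norm m (u n - f) < e"
    by simp
  then have "l2_norm m (f - u n) < e"
    using l2.nrm_minus_commute[of f "u n"] f u(1)[of n] assms(2) by auto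
  then show "\<exists>g\<in>S. l2_norm m (f - g) < e"
    using u(1) by blast
qed

text \<open>Otherwise some \<open>g\<close> in \<open>S\<close> is closer to \<open>h\<close> than
  \<open>l2_norm m h\<close>, and then \<open>l2_inner m h h = l2_inner m h (h - g)\<close> would be
  less than the square of \<open>l2_norm m h\<close>.\<close>

lemma l2_dense_orth:
  assumes "l2_dense m S" "h \<in> l2_space m" "\<And>u. u \<in> S \<Longrightarrow> l2_inner m h u = 0"
  shows "l2_norm m h = 0"
proof -
  interpret l2: semi_hilbert "l2_space m" "l2_inner m" rewrites "semi_inner.nrm (l2_inner m) = l2_norm m"
    by (rule l2_semi_hilbert l2_nrm_eq)+
  show ?thesis
  proof (rule ccontr)
    assume "l2_norm m h \<noteq> 0"
    then have "0 < l2_norm m h"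
      using l2.nrm_ge_0[OF assms(2)] by simp
    then obtain g where g: "g \<in> S" "l2_norm m (h - g) < l2_norm m h"
      using l2_denseD(2)[OF assms(1,2)] by blast
    have gl: "g \<in> l2_space m" using g l2_denseD(1)[OF assms(1)] by blast
    have "(l2_norm m h)\<^sup>2 = l2_inner m h (h - g)"
      using assms g gl by (simp add: l2.nrm_sq l2.ip_diff_right)
    also have "\<dots> \<le> l2_norm m h * l2_norm m (h - g)"
      using l2.cauchy_schwarz[of h "h - g"] assms gl by simp
    also have "\<dots> < l2_norm m h * l2_norm m h"
      using g \<open>0 < l2_norm m h\<close> by simp
    finally show False by (simp add: power2_eq_square)
  qed
qed

section \<open>Closed forms and self-adjoint operators\<close>

lemma closed_form_iff:
  "closed_form m D E \<longleftrightarrow>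
    (\<forall>u. (\<forall>n::nat. u n \<in> D) \<and> (\<forall>e>0. \<exists>N. \<forall>j\<ge>N. \<forall>k\<ge>N. form_norm m E (u j - u k) < e) \<longrightarrow>
      (\<exists>w\<in>D. (\<lambda>n. form_norm m E (u n - w)) \<longlonglongrightarrow> 0))"
  by (simp only: closed_form_def fun_diff_def)

locale dense_closed_form =
  fixes m :: "'a measure" and D :: "('a \<Rightarrow> real) set" and E :: "('a \<Rightarrow> real) \<Rightarrow> ('a \<Rightarrow> real) \<Rightarrow> real"
  assumes symmetric: "symmetric_form m D E"
    and dense: "l2_dense m D"
    and nonneg: "\<And>u. u \<in> D \<Longrightarrow> 0 \<le> E u u"
    and closed: "closed_form m D E"
begin

sublocale L: semi_hilbert "l2_space m" "l2_inner m"
  rewrites "semi_inner.nrm (l2_inner m) = l2_norm m"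
  by (rule l2_semi_hilbert l2_nrm_eq)+

lemma dom_l2: "u \<in> D \<Longrightarrow> u \<in> l2_space m"
  using symmetric by (auto simp: symmetric_form_def)

lemma dom_AE:
  assumes "u \<in> D" "u' \<in> l2_space m" "AE x in m. u x = u' x"
  shows "u' \<in> D" "w \<in> D \<Longrightarrow> E u' w = E u w"
  using symmetric assms unfolding symmetric_form_def by blast+

lemma combine:
  assumes "u \<in> D" "v \<in> D"
  shows "a *\<^sub>R u + b *\<^sub>R v \<in> D" "w \<in> D \<Longrightarrow> E (a *\<^sub>R u + b *\<^sub>R v) w = a * E u w + b * E v w"
  using symmetric assms unfolding symmetric_form_def combine_fun_eq by blast+

lemma form_commute: "u \<in> D \<Longrightarrow> v \<in> D \<Longrightarrow> E u v = E v u"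
  using symmetric unfolding symmetric_form_def by blast

lemma dom_subspace: "subspace D"
  unfolding subspace_def
proof (intro conjI ballI allI)
  obtain u where "u \<in> D"
    using symmetric by (auto simp: symmetric_form_def)
  then show "0 \<in> D"
    using combine(1)[of u u 0 0] by simp
  show "u + v \<in> D" if "u \<in> D" "v \<in> D" for u v
    using combine(1)[OF that, of 1 1] by simp
  show "c *\<^sub>R u \<in> D" if "u \<in> D" for c u
    using combine(1)[OF that that, of c 0] by simp
qed

text \<open>\<open>form_norm\<close> is the norm of this semi-inner product, so closedness of the
  form is completeness of \<open>(D, E1)\<close>, and Riesz representation becomes
  available.\<close>

definition E1 :: "('a \<Rightarrow> real) \<Rightarrow> ('a \<Rightarrow> real) \<Rightarrow> real" where
  "E1 u v = E u v + l2_inner m u v"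

lemma E1_semi_inner: "semi_inner D E1"
proof
  show "subspace D" by (rule dom_subspace)
  show "E1 x y = E1 y x" if "x \<in> D" "y \<in> D" for x y
    using that by (simp add: E1_def form_commute[of x y] L.ip_commute[of x y] dom_l2)
  show "E1 (x + y) z = E1 x z + E1 y z" if "x \<in> D" "y \<in> D" "z \<in> D" for x y z
    using that combine(2)[of x y z 1 1] by (simp add: E1_def L.ip_add_left dom_l2)
  show "E1 (a *\<^sub>R x) z = a * E1 x z" if "x \<in> D" "z \<in> D" for a x z
    using that combine(2)[of x x z a 0] by (simp add: E1_def L.ip_scale_left dom_l2 distrib_left)
  show "0 \<le> E1 x x" if "x \<in> D" for x
    using that nonneg L.ip_ge_0 by (simp add: E1_def dom_l2)
qed

lemma E1_nrm_eq: "semi_inner.nrm E1 = form_norm m E"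
  by (rule ext) (simp add: semi_inner.nrm_def[OF E1_semi_inner] form_norm_def E1_def)

lemma E1_semi_hilbert: "semi_hilbert D E1"
proof -
  interpret semi_inner D E1 by (rule E1_semi_inner)
  show ?thesis
  proof
    fix u :: "nat \<Rightarrow> 'a \<Rightarrow> real" assume u: "\<And>n. u n \<in> D" "cauchy_seq u"
    then show "\<exists>w\<in>D. (\<lambda>n. nrm (u n - w)) \<longlonglongrightarrow> 0"
      using closed[unfolded closed_form_iff, rule_format, of u] unfolding cauchy_seq_def E1_nrm_eq by blast
  qed
qed

sublocale F: semi_hilbert D E1
  rewrites "semi_inner.nrm E1 = form_norm m E"
  by (rule E1_semi_hilbert E1_nrm_eq)+

lemma form_eq: "E u v = E1 u v - l2_inner m u v"
  by (simp add: E1_def)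

lemma l2_norm_le_form_norm: "u \<in> D \<Longrightarrow> l2_norm m u \<le> form_norm m E u"
  using nonneg by (simp add: form_norm_def l2_norm_def)

text \<open>\<open>E\<close> sees only classes modulo null sets, so a function that is null in
  \<open>L2\<close> has the same energy as 0.\<close>

lemma form_norm_null:
  assumes "u \<in> D" "l2_norm m u = 0"
  shows "form_norm m E u = 0"
proof -
  have "AE x in m. (0::'a \<Rightarrow> real) x = u x"
    using assms l2_norm_eq_0_iff[OF dom_l2[OF assms(1)]] by auto
  then have "E u u = E 0 u"
    using dom_AE(2)[of 0 u u] assms dom_l2 by simp
  also have "\<dots> = 0"
    using combine(2)[of 0 0 u 0 0] assms by simp
  finally show ?thesis
    using assms by (simp add: form_norm_def l2_norm_def)
qed

lemma form_norm_tendsto_l2: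
  assumes "\<And>n. u n \<in> D" "w \<in> D" "(\<lambda>n. form_norm m E (u n - w)) \<longlonglongrightarrow> 0"
  shows "(\<lambda>n. l2_norm m (u n - w)) \<longlonglongrightarrow> 0"
  using assms by (intro Lim_null_comparison[OF _ assms(3)] always_eventually allI)
    (simp add: l2_norm_le_form_norm dom_l2)

text \<open>The self-adjoint operator \<open>A\<close> attached to the form by the first
  representation theorem.\<close>

definition form_op :: "'a op_graph" where
  "form_op = {(f, g). f \<in> D \<and> g \<in> l2_space m \<and> (\<forall>w\<in>D. E f w = l2_inner m g w)}"

text \<open>A value of \<open>(A + 1)^-1\<close> at \<open>g\<close>, with \<open>A\<close> the
  operator of the form; it is determined only up to a null function, hence the choice.\<close>

definition resolvent :: "('a \<Rightarrow> real) \<Rightarrow> 'a \<Rightarrow> real" where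
  "resolvent g = (SOME f. f \<in> D \<and> (\<forall>w\<in>D. E1 f w = l2_inner m g w))"

lemma resolvent:
  assumes g: "g \<in> l2_space m"
  shows "resolvent g \<in> D" "w \<in> D \<Longrightarrow> E1 (resolvent g) w = l2_inner m g w"
proof -
  have "\<exists>p\<in>D. \<forall>w\<in>D. E1 p w = l2_inner m g w"
  proof (rule F.riesz[of _ "l2_norm m g"])
    show "\<bar>l2_inner m g x\<bar> \<le> l2_norm m g * form_norm m E x" if "x \<in> D" for x
    proof -
      have "\<bar>l2_inner m g x\<bar> \<le> l2_norm m g * l2_norm m x"
        using L.cauchy_schwarz g dom_l2 that by blast
      also have "\<dots> \<le> l2_norm m g * form_norm m E x"
        using that g by (intro mult_left_mono l2_norm_le_form_norm) auto
      finally show ?thesis .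
    qed
  qed (use g dom_l2 in \<open>simp_all add: L.ip_simps\<close>)
  then have "\<exists>p. p \<in> D \<and> (\<forall>w\<in>D. E1 p w = l2_inner m g w)" by blast
  from someI_ex[OF this] have "resolvent g \<in> D \<and> (\<forall>w\<in>D. E1 (resolvent g) w = l2_inner m g w)"
    unfolding resolvent_def .
  then show "resolvent g \<in> D" "w \<in> D \<Longrightarrow> E1 (resolvent g) w = l2_inner m g w" by auto
qed

lemma resolvent_l2 [simp]: "g \<in> l2_space m \<Longrightarrow> resolvent g \<in> l2_space m"
  by (simp add: resolvent(1) dom_l2)

lemma resolvent_ip:
  assumes "g \<in> l2_space m" "h \<in> l2_space m"
  shows "l2_inner m (resolvent g) h = E1 (resolvent g) (resolvent h)"
proof -
  have "l2_inner m (resolvent g) h = l2_inner m h (resolvent g)"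
    using assms by (intro L.ip_commute) auto
  also have "\<dots> = E1 (resolvent h) (resolvent g)"
    using resolvent(2)[OF assms(2) resolvent(1)[OF assms(1)]] by simp
  also have "\<dots> = E1 (resolvent g) (resolvent h)"
    using assms by (intro F.ip_commute resolvent(1))
  finally show ?thesis .
qed

text \<open>With \<open>R\<close> for the resolvent,
  \<open>|R g|^2 <= E1 (R g) (R g) = <R g, g> <= |R g| |g|\<close>; hence
  \<open>|R g| <= |g|\<close>, and then \<open><R g, g> <= <g, g>\<close>.\<close>

lemma resolvent_pos_contr: "L.pos_contr resolvent"
  unfolding L.pos_contr_def L.sym_op_def
proof (intro conjI ballI)
  fix g assume g: "g \<in> l2_space m"
  show "resolvent g \<in> l2_space m" using g by simp
  show "0 \<le> l2_inner m (resolvent g) g"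
    using g by (simp add: resolvent_ip F.ip_ge_0 resolvent(1))
  have "(l2_norm m (resolvent g))\<^sup>2 \<le> (form_norm m E (resolvent g))\<^sup>2"
    using g by (intro power_mono l2_norm_le_form_norm) (simp_all add: resolvent(1))
  also have "\<dots> = l2_inner m (resolvent g) g"
    using g by (simp add: F.nrm_sq resolvent(1) resolvent_ip)
  finally have *: "(l2_norm m (resolvent g))\<^sup>2 \<le> l2_inner m (resolvent g) g" .
  moreover have cs: "l2_inner m (resolvent g) g \<le> l2_norm m (resolvent g) * l2_norm m g"
    using L.cauchy_schwarz[of "resolvent g" g] g by simp
  ultimately have le: "l2_norm m (resolvent g) * l2_norm m (resolvent g) \<le> l2_norm m (resolvent g) * l2_norm m g"
    by (simp add: power2_eq_square)
  have cancel: "a \<le> b" if "a * a \<le> a * b" "0 \<le> a" "0 \<le> b" for a b :: real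
    using that by (cases "a = 0") (auto simp: mult_le_cancel_left)
  have "l2_norm m (resolvent g) \<le> l2_norm m g"
    by (rule cancel[OF le]) (use g in simp_all)
  then have "l2_norm m (resolvent g) * l2_norm m g \<le> l2_norm m g * l2_norm m g"
    using g by (intro mult_right_mono) auto
  also have "\<dots> = l2_inner m g g"
    using L.nrm_sq[of g] g by (simp add: power2_eq_square)
  finally show "l2_inner m (resolvent g) g \<le> l2_inner m g g"
    using cs by simp
next
  fix g h assume "g \<in> l2_space m" "h \<in> l2_space m"
  then show "l2_inner m (resolvent g) h = l2_inner m g (resolvent h)"
    using resolvent_ip[of g h] resolvent_ip[of h g] F.ip_commute[of "resolvent g" "resolvent h"] resolvent(1)
      L.ip_commute[of g "resolvent h"] by simp
qed

lemma resolvent_form_op: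
  assumes "g \<in> l2_space m"
  shows "(resolvent g, g - resolvent g) \<in> form_op"
  using resolvent[OF assms] assms by (simp add: form_op_def form_eq L.ip_diff_left dom_l2)

lemma form_opD:
  assumes "(f, g) \<in> form_op"
  shows "f \<in> D" "f \<in> l2_space m" "g \<in> l2_space m" "w \<in> D \<Longrightarrow> E f w = l2_inner m g w"
  using assms dom_l2 by (auto simp: form_op_def)

text \<open>\<open>f\<close> and \<open>resolvent (f + g)\<close> have the same
  \<open>E1\<close>-products with all of \<open>D\<close>, so they agree up to a null
  function.\<close>

lemma form_op_resolvent:
  assumes "(f, g) \<in> form_op"
  shows "l2_norm m (f - resolvent (f + g)) = 0"
proof -
  note fg = form_opD[OF assms]
  let ?r = "resolvent (f + g)"
  have r: "?r \<in> D" using fg by (simp add: resolvent(1))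
  have "E1 f w = E1 ?r w" if "w \<in> D" for w
  proof -
    have "E1 f w = l2_inner m (f + g) w"
      using that fg(1-3) fg(4)[OF that] by (simp add: E1_def L.ip_add_left dom_l2)
    then show ?thesis
      using that fg(2,3) by (simp add: resolvent(2))
  qed
  then have "form_norm m E (f - ?r) = 0"
    using fg r by (intro F.nrm_eq_0_if_orth) (simp_all add: F.ip_diff_left)
  then show ?thesis
    using l2_norm_le_form_norm[of "f - ?r"] fg r by (intro L.nrm_eq_0_if_le) (simp_all add: dom_l2)
qed

lemma form_op_dom_subspace: "subspace (Domain form_op)"
  unfolding subspace_def
proof (intro conjI ballI allI)
  have "(0, 0) \<in> form_op"
    by (auto simp: form_op_def form_eq dom_l2)
  then show "0 \<in> Domain form_op" by blast
  fix f assume "f \<in> Domain form_op"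
  then obtain g where g: "(f, g) \<in> form_op" by blast
  note fg = form_opD[OF g]
  show "c *\<^sub>R f \<in> Domain form_op" for c
  proof -
    have "(c *\<^sub>R f, c *\<^sub>R g) \<in> form_op"
      using fg by (simp add: form_op_def form_eq F.ip_simps L.ip_simps dom_l2 flip: right_diff_distrib)
    then show ?thesis by blast
  qed
  fix f' assume "f' \<in> Domain form_op"
  then obtain g' where g': "(f', g') \<in> form_op" by blast
  note fg' = form_opD[OF g']
  have "E (f + f') w = E f w + E f' w" if "w \<in> D" for w
    using combine(2)[of f f' w 1 1] that fg fg' by (simp add: L.ip_add_left dom_l2)
  then have "(f + f', g + g') \<in> form_op"
    using fg fg' by (simp add: form_op_def L.ip_simps dom_l2)
  then show "f + f' \<in> Domain form_op" by blast
qed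

text \<open>If \<open>h\<close> is orthogonal to the domain, then
  \<open>E1 (R h) (R h) = <h, R h> = 0\<close> with \<open>R\<close> the resolvent; so
  \<open><h, w> = E1 (R h) w = 0\<close> on \<open>D\<close>, which is dense.\<close>

lemma form_op_dense: "l2_dense m (Domain form_op)"
proof (rule l2_denseI[OF form_op_dom_subspace])
  show "Domain form_op \<subseteq> l2_space m"
    using form_opD by blast
  fix h assume h: "h \<in> l2_space m" and orth: "\<And>u. u \<in> Domain form_op \<Longrightarrow> l2_inner m h u = 0"
  have r: "resolvent h \<in> D" using h by (rule resolvent)
  have "E1 (resolvent h) (resolvent h) = 0"
    using h r orth resolvent_form_op[OF h] by (auto simp: resolvent(2))
  then have "form_norm m E (resolvent h) = 0"
    using F.nrm_sq[OF r] by simp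
  then have "l2_inner m h w = 0" if "w \<in> D" for w
    using F.ip_eq_0_if_nrm_eq_0(1)[OF r that] resolvent(2)[OF h that] by simp
  then show "l2_norm m h = 0"
    using l2_dense_orth[OF dense h] by blast
qed

text \<open>A vector \<open>h\<close> of \<open>D\<close> that is \<open>E1\<close>-orthogonal to
  the range of the resolvent \<open>R\<close> satisfies \<open><h, h> = E1 (R h) h = 0\<close>.
  Density in the form norm is what allows a form to be recovered from its operator.\<close>

lemma form_op_core:
  assumes "u \<in> D"
  shows "\<exists>v. (\<forall>n. v n \<in> Domain form_op) \<and> (\<lambda>n. form_norm m E (v n - u)) \<longlonglongrightarrow> 0"
proof (rule F.dense_if_orth_null[OF form_op_dom_subspace _ _ assms])
  show "Domain form_op \<subseteq> D"
    using form_opD by blast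
  fix h assume h: "h \<in> D" and orth: "\<And>u. u \<in> Domain form_op \<Longrightarrow> E1 h u = 0"
  have hl: "h \<in> l2_space m" using h by (rule dom_l2)
  have "l2_inner m h h = E1 h (resolvent h)"
    using h hl F.ip_commute[of h "resolvent h"] by (simp add: resolvent)
  also have "\<dots> = 0"
    using orth resolvent_form_op[OF hl] by blast
  finally have "l2_norm m h = 0"
    by (simp add: l2_norm_def)
  then show "form_norm m E h = 0"
    using h by (intro form_norm_null)
qed

text \<open>For \<open>(f, g)\<close> in the adjoint, testing with the pairs
  \<open>(R y, y - R y)\<close>, \<open>R\<close> the resolvent, shows
  \<open><y, f> = <y, R (f + g)>\<close> for every \<open>y\<close>. So \<open>f\<close> equals
  \<open>R (f + g)\<close> almost everywhere, and the invariance of \<open>D\<close> and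
  \<open>E\<close> under such changes gives the claim for \<open>f\<close> itself.\<close>

lemma form_op_adjoint: "op_adjoint m form_op = form_op"
proof (intro equalityI subrelI)
  fix f g assume "(f, g) \<in> op_adjoint m form_op"
  then have fg: "f \<in> l2_space m" "g \<in> l2_space m"
    and adj: "\<And>u v. (u, v) \<in> form_op \<Longrightarrow> l2_inner m v f = l2_inner m u g"
    by (auto simp: op_adjoint_def)
  define f' where "f' = resolvent (f + g)"
  have f': "f' \<in> D" "f' \<in> l2_space m" "(f', f + g - f') \<in> form_op"
    using fg resolvent(1)[of "f + g"] resolvent_form_op[of "f + g"] by (simp_all add: f'_def)
  have "l2_inner m f y = l2_inner m f' y" if y: "y \<in> l2_space m" for y
  proof -
    have "l2_inner m (y - resolvent y) f = l2_inner m (resolvent y) g"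
      by (rule adj[OF resolvent_form_op[OF y]])
    then have "l2_inner m y f = l2_inner m (resolvent y) (f + g)"
      using y fg by (simp add: L.ip_simps)
    also have "\<dots> = l2_inner m y f'"
      unfolding f'_def using y fg L.pos_contrD(3)[OF resolvent_pos_contr] by simp
    finally show ?thesis
      using y fg f' L.ip_commute[of f y] L.ip_commute[of f' y] by simp
  qed
  then have ae: "AE x in m. f' x = f x"
    using l2_AE_eq_iff[of f' m f] f' fg by simp
  show "(f, g) \<in> form_op"
    unfolding form_op_def
  proof (intro CollectI case_prodI conjI ballI)
    show "f \<in> D" by (rule dom_AE(1)[OF f'(1) fg(1) ae])
    show "g \<in> l2_space m" by (rule fg)
    fix w assume w: "w \<in> D"
    have "E f w = E f' w" by (rule dom_AE(2)[OF f'(1) fg(1) ae w])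
    also have "\<dots> = l2_inner m (f + g - f') w" by (rule form_opD(4)[OF f'(3) w])
    also have "\<dots> = l2_inner m g w"
      using \<open>\<And>y. y \<in> l2_space m \<Longrightarrow> l2_inner m f y = l2_inner m f' y\<close>[of w] fg f' dom_l2[OF w]
      by (simp add: L.ip_simps)
    finally show "E f w = l2_inner m g w" .
  qed
next
  fix f g assume fg: "(f, g) \<in> form_op"
  have "l2_inner m v f = l2_inner m u g" if uv: "(u, v) \<in> form_op" for u v
  proof -
    have "l2_inner m v f = E u f"
      by (rule form_opD(4)[OF uv form_opD(1)[OF fg], symmetric])
    also have "\<dots> = E f u"
      by (rule form_commute[OF form_opD(1)[OF uv] form_opD(1)[OF fg]])
    also have "\<dots> = l2_inner m g u"
      by (rule form_opD(4)[OF fg form_opD(1)[OF uv]])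
    also have "\<dots> = l2_inner m u g"
      by (rule L.ip_commute[OF form_opD(3)[OF fg] form_opD(2)[OF uv]])
    finally show ?thesis .
  qed
  then show "(f, g) \<in> op_adjoint m form_op"
    using form_opD[OF fg] by (auto simp: op_adjoint_def)
qed

lemma form_op_selfadjoint: "nonneg_selfadjoint m form_op"
  unfolding nonneg_selfadjoint_def
proof (intro conjI form_op_dense form_op_adjoint ballI)
  fix p assume "p \<in> form_op"
  then obtain f g where p: "p = (f, g)" "(f, g) \<in> form_op" by (cases p) auto
  then show "case p of (f, g) \<Rightarrow> 0 \<le> l2_inner m g f"
    using form_opD(4)[OF p(2) form_opD(1)[OF p(2)]] nonneg[OF form_opD(1)[OF p(2)]] by simp
qed

text \<open>With \<open>G = (A + 1)\<^sup>-\<^sup>1\<close>, \<open>R = G\<^sup>1\<^sup>/\<^sup>2\<close> and \<open>T = (1 - G)\<^sup>1\<^sup>/\<^sup>2\<close>, the square root of \<open>A\<close> is \<open>T R\<^sup>-\<^sup>1\<close>;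
  its graph consists of the pairs \<open>(R w, T w)\<close>.\<close>

lemma form_op_sqrt_exists: "\<exists>S. nonneg_selfadjoint m S \<and> S O S = form_op"
proof (rule L.sqrt_pair[OF resolvent_pos_contr])
  fix R T
  assume R: "L.sym_op R" and T: "L.sym_op T"
    and RR: "\<And>x y. x \<in> l2_space m \<Longrightarrow> y \<in> l2_space m \<Longrightarrow> l2_inner m (R (R x)) y = l2_inner m (resolvent x) y"
    and TT: "\<And>x y. x \<in> l2_space m \<Longrightarrow> y \<in> l2_space m \<Longrightarrow>
      l2_inner m (T (T x)) y = l2_inner m x y - l2_inner m (resolvent x) y"
    and TR: "L.commuting T R" and TRpos: "\<And>x. x \<in> l2_space m \<Longrightarrow> 0 \<le> l2_inner m (T (R x)) x"
  note [simp] = L.sym_opD(1)[OF R] L.sym_opD(1)[OF T]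
  note Rs = L.sym_opD(2)[OF R] and Ts = L.sym_opD(2)[OF T]
  have comm: "l2_inner m (T (R x)) y = l2_inner m (R (T x)) y" if "x \<in> l2_space m" "y \<in> l2_space m" for x y
    using TR that by (simp add: L.commuting_def)
  define eqv where "eqv f g \<longleftrightarrow> (\<forall>y\<in>l2_space m. l2_inner m f y = l2_inner m g y)" for f g
  have eqvD: "l2_inner m f y = l2_inner m g y" "l2_inner m y f = l2_inner m y g"
    if "eqv f g" "f \<in> l2_space m" "g \<in> l2_space m" "y \<in> l2_space m" for f g y
    using that L.ip_commute[of y f] L.ip_commute[of y g] by (auto simp: eqv_def)
  define S where "S = {(f, g). f \<in> l2_space m \<and> g \<in> l2_space m \<and> (\<exists>w\<in>l2_space m. eqv f (R w) \<and> eqv g (T w))}"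
  have SD: "\<exists>w\<in>l2_space m. eqv f (R w) \<and> eqv g (T w)" "f \<in> l2_space m" "g \<in> l2_space m"
    if "(f, g) \<in> S" for f g
    using that by (auto simp: S_def)
  have SI: "(f, g) \<in> S" if "f \<in> l2_space m" "g \<in> l2_space m" "w \<in> l2_space m" "eqv f (R w)" "eqv g (T w)" for f g w
    using that by (auto simp: S_def)
  have ssym: "l2_inner m v f = l2_inner m u g" if fg: "(f, g) \<in> S" and uv: "(u, v) \<in> S" for f g u v
  proof -
    obtain w where w: "w \<in> l2_space m" "eqv f (R w)" "eqv g (T w)" using SD(1)[OF fg] by blast
    obtain z where z: "z \<in> l2_space m" "eqv u (R z)" "eqv v (T z)" using SD(1)[OF uv] by blast
    note l = SD(2,3)[OF fg] SD(2,3)[OF uv]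
    have "l2_inner m v f = l2_inner m (T z) (R w)"
      using eqvD(1)[OF z(3), of f] eqvD(2)[OF w(2), of "T z"] l w z by simp
    also have "\<dots> = l2_inner m (R z) (T w)"
      using comm[of z w] w z by (simp add: Rs Ts)
    also have "\<dots> = l2_inner m u g"
      using eqvD(1)[OF z(2), of g] eqvD(2)[OF w(3), of "R z"] l w z by simp
    finally show ?thesis .
  qed
  have smax: "(f, g) \<in> S"
    if f: "f \<in> l2_space m" and g: "g \<in> l2_space m"
      and adj: "\<And>u v. (u, v) \<in> S \<Longrightarrow> l2_inner m v f = l2_inner m u g" for f g
  proof (rule SI[OF f g])
    \<comment> \<open>If \<open>f = R w\<close> and \<open>g = T w\<close>, then
      \<open>R f + T g = (R^2 + T^2) w = w\<close>; this dictates the candidate.\<close>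
    define w0 where "w0 = R f + T g"
    have a: "l2_inner m (T w) f = l2_inner m (R w) g" if "w \<in> l2_space m" for w
      using that by (intro adj SI[of _ _ w]) (auto simp: eqv_def)
    have a': "l2_inner m (T f) w = l2_inner m (R g) w" if "w \<in> l2_space m" for w
      using a[OF that] f g that L.ip_commute[of "T f" w] L.ip_commute[of "R g" w] by (simp add: Rs Ts)
    show "w0 \<in> l2_space m" using f g by (simp add: w0_def)
    show "eqv f (R w0)"
      unfolding eqv_def
    proof
      fix y assume y: "y \<in> l2_space m"
      have "l2_inner m (R w0) y = l2_inner m (R (R f)) y + l2_inner m (R (T g)) y"
        unfolding w0_def using f g y by (intro L.sym_op_linear(1)[OF R]) auto
      also have "l2_inner m (R (T g)) y = l2_inner m (R g) (T y)"
        using comm[OF g y] f g y by (simp add: Ts)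
      also have "\<dots> = l2_inner m (T (T f)) y"
        using a'[of "T y"] f g y by (simp add: Ts)
      finally show "l2_inner m f y = l2_inner m (R w0) y"
        using f y by (simp add: RR TT)
    qed
    show "eqv g (T w0)"
      unfolding eqv_def
    proof
      fix y assume y: "y \<in> l2_space m"
      have "l2_inner m (T w0) y = l2_inner m (T (R f)) y + l2_inner m (T (T g)) y"
        unfolding w0_def using f g y by (intro L.sym_op_linear(1)[OF T]) auto
      also have "l2_inner m (T (R f)) y = l2_inner m (T f) (R y)"
        using comm[OF f y] f g y by (simp add: Rs)
      also have "\<dots> = l2_inner m (R (R g)) y"
        using a'[of "R y"] f g y by (simp add: Rs)
      finally show "l2_inner m g y = l2_inner m (T w0) y"
        using g y by (simp add: RR TT)
    qed
  qed
  have sub: "form_op \<subseteq> S O S"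
  proof (rule subrelI)
    fix f g assume fg: "(f, g) \<in> form_op"
    \<comment> \<open>Up to null functions \<open>f = R (R k)\<close> and
      \<open>g = T (T k)\<close>, and the intermediate vector \<open>T (R k) = R (T k)\<close> is
      the value of the root at \<open>f\<close>.\<close>
    define k where "k = f + g"
    have l: "f \<in> l2_space m" "g \<in> l2_space m" "k \<in> l2_space m"
      using form_opD[OF fg] by (simp_all add: k_def)
    have fk: "l2_inner m f y = l2_inner m (resolvent k) y" if "y \<in> l2_space m" for y
      using L.ip_eq_0_if_nrm_eq_0(1)[of "f - resolvent k" y] form_op_resolvent[OF fg] l that
      by (simp add: k_def[symmetric] L.ip_diff_left)
    have "(f, T (R k)) \<in> S"
      using l fk by (intro SI[of _ _ "R k"]) (auto simp: eqv_def RR)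
    moreover have "(T (R k), g) \<in> S"
    proof (rule SI[of _ _ "T k"])
      show "eqv (T (R k)) (R (T k))"
        using comm l by (auto simp: eqv_def)
      have "l2_inner m g y = l2_inner m (k - f) y" for y by (simp add: k_def)
      then show "eqv g (T (T k))"
        using l fk by (auto simp: eqv_def TT L.ip_diff_left)
    qed (use l in auto)
    ultimately show "(f, g) \<in> S O S" by blast
  qed
  \<comment> \<open>The inclusion just proved and the symmetry of \<open>S\<close> put
    \<open>S O S\<close> inside the adjoint of \<open>form_op\<close>, which is
    \<open>form_op\<close> again.\<close>
  have "S O S \<subseteq> op_adjoint m form_op"
  proof (rule subrelI)
    fix f h assume "(f, h) \<in> S O S"
    then obtain g where g: "(f, g) \<in> S" "(g, h) \<in> S" by blast
    have "l2_inner m v f = l2_inner m u h" if uv: "(u, v) \<in> form_op" for u v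
    proof -
      obtain z where z: "(u, z) \<in> S" "(z, v) \<in> S" using sub uv by blast
      show ?thesis
        using ssym[OF g(1) z(2)] ssym[OF g(2) z(1)] by simp
    qed
    then show "(f, h) \<in> op_adjoint m form_op"
      using SD(2)[OF g(1)] SD(3)[OF g(2)] by (auto simp: op_adjoint_def)
  qed
  then have SS: "S O S = form_op"
    using sub by (simp add: form_op_adjoint)
  have "nonneg_selfadjoint m S"
    unfolding nonneg_selfadjoint_def
  proof (intro conjI ballI)
    show "l2_dense m (Domain S)"
      unfolding l2_dense_iff
    proof (intro conjI ballI allI impI)
      show "Domain S \<subseteq> l2_space m" using SD(2) by blast
      fix f :: "'a \<Rightarrow> real" and e :: real assume "f \<in> l2_space m" "0 < e"
      then show "\<exists>g\<in>Domain S. l2_norm m (f - g) < e"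
        using l2_denseD(2)[OF form_op_dense] sub by blast
    qed
    show "op_adjoint m S = S"
      using smax ssym SD(2,3) unfolding op_adjoint_def by fast
    fix p assume "p \<in> S"
    then obtain f g where p: "p = (f, g)" "(f, g) \<in> S" by (cases p) auto
    obtain w where w: "w \<in> l2_space m" "eqv f (R w)" "eqv g (T w)" using SD(1)[OF p(2)] by blast
    have "l2_inner m g f = l2_inner m (T w) (R w)"
      using eqvD(1)[OF w(3), of f] eqvD(2)[OF w(2), of "T w"] w SD(2,3)[OF p(2)] by simp
    also have "\<dots> = l2_inner m (T (R w)) w"
      using comm[of w w] w by (simp add: Rs)
    finally show "case p of (f, g) \<Rightarrow> 0 \<le> l2_inner m g f"
      using TRpos[OF w(1)] p by simp
  qed
  with SS show ?thesis by blast
qed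

end

text \<open>Elements of the operator domain approximate \<open>u\<close> in the first form norm. The
  two forms agree there, so the sequence is Cauchy in the second form norm too, and its limit equals
  \<open>u\<close> almost everywhere because both form norms dominate the \<open>L2\<close> norm.
  Exchanging the forms gives the reverse inclusion.\<close>

lemma form_op_unique_subset:
  assumes "dense_closed_form m D E" "dense_closed_form m D' E'"
    and eq: "dense_closed_form.form_op m D E = dense_closed_form.form_op m D' E'"
    and u: "u \<in> D" and v: "v \<in> D"
  shows "u \<in> D'" "E' u v = E u v"
proof -
  interpret A: dense_closed_form m D E by fact
  interpret B: dense_closed_form m D' E' by fact
  have agree: "E x y = E' x y" if x: "x \<in> Domain A.form_op" and y: "y \<in> Domain A.form_op" for x y
  proof -
    obtain g where "(x, g) \<in> A.form_op" using x by blast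
    moreover have "y \<in> D" "y \<in> D'" using y A.form_opD(1) B.form_opD(1) eq by blast+
    ultimately show ?thesis using A.form_opD(4) B.form_opD(4) eq by metis
  qed
  have dom: "x \<in> D" "x \<in> D'" if "x \<in> Domain A.form_op" for x
    using that A.form_opD(1) B.form_opD(1) eq by blast+
  have approx: "\<exists>a w. (\<forall>n. a n \<in> Domain A.form_op) \<and> (\<lambda>n. form_norm m E (a n - x)) \<longlonglongrightarrow> 0
      \<and> w \<in> D' \<and> (\<lambda>n. form_norm m E' (a n - w)) \<longlonglongrightarrow> 0 \<and> (AE y in m. w y = x y)" if x: "x \<in> D" for x
  proof -
    obtain a where a: "\<And>n. a n \<in> Domain A.form_op" "(\<lambda>n. form_norm m E (a n - x)) \<longlonglongrightarrow> 0"
      using A.form_op_core[OF x] by auto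
    have "A.F.cauchy_seq a"
      by (rule A.F.cauchy_seq_if_convergent[OF dom(1)[OF a(1)] x a(2)])
    moreover have "form_norm m E (a j - a k) = form_norm m E' (a j - a k)" for j k
      using agree subspace_diff[OF A.form_op_dom_subspace a(1) a(1)]
      by (simp add: form_norm_def)
    ultimately have "B.F.cauchy_seq a"
      by (simp add: A.F.cauchy_seq_def B.F.cauchy_seq_def)
    then obtain w where w: "w \<in> D'" "(\<lambda>n. form_norm m E' (a n - w)) \<longlonglongrightarrow> 0"
      using B.F.complete[of a] a(1) dom(2) by blast
    have "(\<lambda>n. l2_norm m (w - a n) + l2_norm m (a n - x)) \<longlonglongrightarrow> 0"
      using tendsto_add[OF B.form_norm_tendsto_l2[OF dom(2)[OF a(1)] w] A.form_norm_tendsto_l2[OF dom(1)[OF a(1)] x a(2)]]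
        A.L.nrm_minus_commute[of w "a _"] w(1) a(1) dom B.dom_l2 by simp
    then have "l2_norm m (w - x) \<le> 0"
      using A.L.nrm_triangle_sub[of w "a _" x] w(1) a(1) dom B.dom_l2 A.dom_l2[OF x]
      by (intro LIMSEQ_le_const) auto
    then have "AE y in m. w y = x y"
      using l2_norm_diff_eq_0_iff[of w m x] A.L.nrm_eq_0_if_le[of "w - x"] w(1) x B.dom_l2 A.dom_l2 by simp
    then show ?thesis using a w by blast
  qed
  obtain a w where a: "\<And>n. a n \<in> Domain A.form_op" "(\<lambda>n. form_norm m E (a n - u)) \<longlonglongrightarrow> 0"
    and w: "w \<in> D'" "(\<lambda>n. form_norm m E' (a n - w)) \<longlonglongrightarrow> 0" "AE y in m. w y = u y"
    using approx[OF u] by blast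
  obtain b z where b: "\<And>n. b n \<in> Domain A.form_op" "(\<lambda>n. form_norm m E (b n - v)) \<longlonglongrightarrow> 0"
    and z: "z \<in> D'" "(\<lambda>n. form_norm m E' (b n - z)) \<longlonglongrightarrow> 0" "AE y in m. z y = v y"
    using approx[OF v] by blast
  have l: "u \<in> l2_space m" "v \<in> l2_space m" "w \<in> l2_space m" "z \<in> l2_space m"
    using u v w z A.dom_l2 B.dom_l2 by auto
  show u': "u \<in> D'"
    by (rule B.dom_AE(1)[OF w(1) l(1) w(3)])
  have v': "v \<in> D'"
    by (rule B.dom_AE(1)[OF z(1) l(2) z(3)])
  have "(\<lambda>n. A.E1 (a n) (b n)) \<longlonglongrightarrow> A.E1 u v"
    by (rule A.F.tendsto_ip[OF dom(1)[OF a(1)] u a(2) dom(1)[OF b(1)] v b(2)])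
  moreover have "(\<lambda>n. B.E1 (a n) (b n)) \<longlonglongrightarrow> B.E1 w z"
    by (rule B.F.tendsto_ip[OF dom(2)[OF a(1)] w(1,2) dom(2)[OF b(1)] z(1,2)])
  moreover have "A.E1 (a n) (b n) = B.E1 (a n) (b n)" for n
    using agree a b by (simp add: A.E1_def B.E1_def)
  ultimately have "A.E1 u v = B.E1 w z"
    using LIMSEQ_unique by simp
  moreover have "l2_inner m w z = l2_inner m u v"
    using l2_AE_eq_iff[of w m u] l2_AE_eq_iff[of z m v] w(3) z(3) l A.L.ip_commute by metis
  moreover have "E' w z = E' u v"
    using B.dom_AE(2)[OF w(1) l(1) w(3) z(1)] B.dom_AE(2)[OF z(1) l(2) z(3) u']
      B.form_commute u' v' z(1) by metis
  ultimately show "E' u v = E u v"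
    by (simp add: A.E1_def B.E1_def)
qed

section \<open>The form of the square of a self-adjoint operator\<close>

locale nonneg_selfadjoint_op =
  fixes m :: "'a measure" and S :: "'a op_graph"
  assumes selfadjoint: "nonneg_selfadjoint m S"
begin

sublocale L: semi_hilbert "l2_space m" "l2_inner m"
  rewrites "semi_inner.nrm (l2_inner m) = l2_norm m"
  by (rule l2_semi_hilbert l2_nrm_eq)+

lemma graph_l2: "(f, g) \<in> S \<Longrightarrow> f \<in> l2_space m" "(f, g) \<in> S \<Longrightarrow> g \<in> l2_space m"
  using selfadjoint unfolding nonneg_selfadjoint_def op_adjoint_def by auto

lemma graph_sym: "(f, g) \<in> S \<Longrightarrow> (u, v) \<in> S \<Longrightarrow> l2_inner m v f = l2_inner m u g"
  using selfadjoint unfolding nonneg_selfadjoint_def op_adjoint_def by blast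

lemma graphI:
  assumes "f \<in> l2_space m" "g \<in> l2_space m" "\<And>u v. (u, v) \<in> S \<Longrightarrow> l2_inner m v f = l2_inner m u g"
  shows "(f, g) \<in> S"
proof -
  have "(f, g) \<in> op_adjoint m S" using assms by (auto simp: op_adjoint_def)
  then show ?thesis using selfadjoint by (simp add: nonneg_selfadjoint_def)
qed

lemma graph_combine:
  assumes "(f, g) \<in> S" "(f', g') \<in> S"
  shows "(a *\<^sub>R f + b *\<^sub>R f', a *\<^sub>R g + b *\<^sub>R g') \<in> S"
proof (rule graphI)
  fix u v assume uv: "(u, v) \<in> S"
  show "l2_inner m v (a *\<^sub>R f + b *\<^sub>R f') = l2_inner m u (a *\<^sub>R g + b *\<^sub>R g')"
    using graph_sym[OF assms(1) uv] graph_sym[OF assms(2) uv] graph_l2[OF assms(1)] graph_l2[OF assms(2)]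
      graph_l2[OF uv] by (simp add: L.ip_simps)
qed (use assms graph_l2 in auto)

lemma graph_AE:
  assumes "(f, g) \<in> S" "f' \<in> l2_space m" "AE x in m. f x = f' x"
  shows "(f', g) \<in> S"
proof (rule graphI[OF assms(2)])
  show "g \<in> l2_space m" using assms graph_l2 by blast
  fix u v assume uv: "(u, v) \<in> S"
  have "l2_inner m f v = l2_inner m f' v"
    using l2_AE_eq_iff[of f m f'] assms graph_l2[OF assms(1)] graph_l2[OF uv] by blast
  then show "l2_inner m v f' = l2_inner m u g"
    using graph_sym[OF assms(1) uv] graph_l2[OF assms(1)] graph_l2[OF uv] assms(2)
      L.ip_commute[of v f] L.ip_commute[of v f'] by simp
qed

text \<open>By symmetry \<open>g - g'\<close> is orthogonal to the dense domain. Hence, inside inner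
  products, \<open>op_apply\<close> may be replaced by any value that the graph offers.\<close>

lemma graph_unique:
  assumes "(f, g) \<in> S" "(f, g') \<in> S" "y \<in> l2_space m"
  shows "l2_inner m g y = l2_inner m g' y"
proof -
  have "l2_norm m (g - g') = 0"
  proof (rule l2_dense_orth[of m "Domain S"])
    show "l2_dense m (Domain S)" using selfadjoint by (simp add: nonneg_selfadjoint_def)
    show "g - g' \<in> l2_space m" using assms graph_l2 by auto
    fix u assume "u \<in> Domain S"
    then obtain v where uv: "(u, v) \<in> S" by blast
    show "l2_inner m (g - g') u = 0"
      using graph_sym[OF assms(1) uv] graph_sym[OF assms(2) uv] graph_l2[OF assms(1)] graph_l2[OF assms(2)]
        graph_l2[OF uv] L.ip_commute[of g u] L.ip_commute[of g' u] by (simp add: L.ip_simps)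
  qed
  then show ?thesis
    using L.ip_eq_0_if_nrm_eq_0(1)[of "g - g'" y] assms graph_l2 by (simp add: L.ip_diff_left)
qed

lemma op_apply: "f \<in> Domain S \<Longrightarrow> (f, op_apply S f) \<in> S"
  unfolding op_apply_def using someI_ex[of "\<lambda>g. (f, g) \<in> S"] by blast

lemma op_apply_l2 [simp]: "f \<in> Domain S \<Longrightarrow> op_apply S f \<in> l2_space m"
  using op_apply graph_l2 by blast

definition sform :: "('a \<Rightarrow> real) \<Rightarrow> ('a \<Rightarrow> real) \<Rightarrow> real" where
  "sform u v = l2_inner m (op_apply S u) (op_apply S v)"

lemma sform_eq:
  assumes "(u, g) \<in> S" "(v, h) \<in> S"
  shows "sform u v = l2_inner m g h"
proof -
  have d: "u \<in> Domain S" "v \<in> Domain S" using assms by blast+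
  have "sform u v = l2_inner m g (op_apply S v)"
    unfolding sform_def using op_apply[OF d(1)] assms(1) d(2) by (intro graph_unique) auto
  also have "\<dots> = l2_inner m (op_apply S v) g"
    using d assms graph_l2 by (intro L.ip_commute) auto
  also have "\<dots> = l2_inner m h g"
    using op_apply[OF d(2)] assms graph_l2 by (intro graph_unique) auto
  also have "\<dots> = l2_inner m g h"
    using assms graph_l2 by (intro L.ip_commute) auto
  finally show ?thesis .
qed

lemma graph_diff: "(f, g) \<in> S \<Longrightarrow> (f', g') \<in> S \<Longrightarrow> (f - f', g - g') \<in> S"
  using graph_combine[of f g f' g' 1 "-1"] by simp

lemma graph_closed:
  assumes uv: "\<And>n. (u n, v n) \<in> S" and wz: "w \<in> l2_space m" "z \<in> l2_space m"
    and lim: "(\<lambda>n. l2_norm m (u n - w)) \<longlonglongrightarrow> 0" "(\<lambda>n. l2_norm m (v n - z)) \<longlonglongrightarrow> 0"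
  shows "(w, z) \<in> S"
proof (rule graphI[OF wz])
  fix a b assume ab: "(a, b) \<in> S"
  have l: "u n \<in> l2_space m" "v n \<in> l2_space m" "a \<in> l2_space m" "b \<in> l2_space m" for n
    using uv[of n] ab graph_l2 by auto
  have "(\<lambda>n. l2_inner m (u n) b) \<longlonglongrightarrow> l2_inner m w b"
    using lim l wz by (intro L.tendsto_ip_left)
  moreover have "(\<lambda>n. l2_inner m (v n) a) \<longlonglongrightarrow> l2_inner m z a"
    using lim l wz by (intro L.tendsto_ip_left)
  moreover have "l2_inner m (u n) b = l2_inner m (v n) a" for n
    using graph_sym[OF uv[of n] ab] l L.ip_commute[of "u n" b] L.ip_commute[of "v n" a] by simp
  ultimately have "l2_inner m w b = l2_inner m z a"
    using LIMSEQ_unique by simp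
  then show "l2_inner m b w = l2_inner m a z"
    using l wz L.ip_commute[of b w] L.ip_commute[of a z] by simp
qed

text \<open>On the graph the squared form norm is \<open>|S u|^2 + |u|^2\<close>, so closedness of
  the form is closedness of the graph of a self-adjoint operator.\<close>

lemma sform_dense_closed: "dense_closed_form m (Domain S) sform"
proof
  have dom: "Domain S \<subseteq> l2_space m" using graph_l2 by blast
  show dense: "l2_dense m (Domain S)" using selfadjoint by (simp add: nonneg_selfadjoint_def)
  show "symmetric_form m (Domain S) sform"
    unfolding symmetric_form_def combine_fun_eq
  proof (intro conjI ballI impI allI dom)
    have "0 \<in> l2_space m" by simp
    then show "Domain S \<noteq> {}" using l2_denseD(2)[OF dense, of 0 1] by auto
  next
    fix u u' assume "u \<in> Domain S" and u': "u' \<in> l2_space m" "AE x in m. u x = u' x"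
    then have *: "(u', op_apply S u) \<in> S" using graph_AE op_apply by blast
    then show "u' \<in> Domain S" by blast
    fix w assume "w \<in> Domain S"
    then show "sform u' w = sform u w"
      using sform_eq[OF * op_apply] by (simp add: sform_def)
  next
    fix u v :: "'a \<Rightarrow> real" and a b :: real
    assume "u \<in> Domain S" "v \<in> Domain S"
    then have *: "(a *\<^sub>R u + b *\<^sub>R v, a *\<^sub>R op_apply S u + b *\<^sub>R op_apply S v) \<in> S"
      using graph_combine op_apply by blast
    then show "a *\<^sub>R u + b *\<^sub>R v \<in> Domain S" by blast
    fix w assume "w \<in> Domain S"
    then show "sform (a *\<^sub>R u + b *\<^sub>R v) w = a * sform u w + b * sform v w"
      using sform_eq[OF * op_apply] \<open>u \<in> Domain S\<close> \<open>v \<in> Domain S\<close>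
      by (simp add: sform_def L.ip_simps)
  next
    fix u v assume "u \<in> Domain S" "v \<in> Domain S"
    then show "sform u v = sform v u"
      by (simp add: sform_def L.ip_commute[of "op_apply S u" "op_apply S v"])
  qed
  show "0 \<le> sform u u" if "u \<in> Domain S" for u
    using that L.ip_ge_0 by (simp add: sform_def)
  show "closed_form m (Domain S) sform"
    unfolding closed_form_iff
  proof (intro allI impI, elim conjE)
    fix u :: "nat \<Rightarrow> 'a \<Rightarrow> real"
    assume "\<forall>n. u n \<in> Domain S" and cauchy: "\<forall>e>0. \<exists>N. \<forall>j\<ge>N. \<forall>k\<ge>N. form_norm m sform (u j - u k) < e"
    then have u: "u n \<in> Domain S" for n by blast
    define v where "v n = op_apply S (u n)" for n
    have uv: "(u n, v n) \<in> S" for n using op_apply[OF u] by (simp add: v_def)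
    have l: "u n \<in> l2_space m" "v n \<in> l2_space m" for n using graph_l2[OF uv] by auto
    have fn: "form_norm m sform x = sqrt ((l2_norm m y)\<^sup>2 + (l2_norm m x)\<^sup>2)" if "(x, y) \<in> S" for x y
      using sform_eq[OF that that] graph_l2[OF that] by (simp add: form_norm_def L.nrm_sq)
    have le: "l2_norm m (u j - u k) \<le> form_norm m sform (u j - u k)"
      "l2_norm m (v j - v k) \<le> form_norm m sform (u j - u k)" for j k
      unfolding fn[OF graph_diff[OF uv uv]] by (simp_all add: real_le_rsqrt)
    have "L.cauchy_seq u" "L.cauchy_seq v"
      unfolding L.cauchy_seq_def using cauchy le[THEN order.strict_trans1] by meson+
    then obtain w z where wz: "w \<in> l2_space m" "(\<lambda>n. l2_norm m (u n - w)) \<longlonglongrightarrow> 0"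
        "z \<in> l2_space m" "(\<lambda>n. l2_norm m (v n - z)) \<longlonglongrightarrow> 0"
      using L.complete[of u] L.complete[of v] l by blast
    have S: "(w, z) \<in> S"
      by (rule graph_closed[OF uv wz(1,3,2,4)])
    have "(\<lambda>n. sqrt ((l2_norm m (v n - z))\<^sup>2 + (l2_norm m (u n - w))\<^sup>2)) \<longlonglongrightarrow> sqrt (0\<^sup>2 + 0\<^sup>2)"
      by (intro tendsto_intros wz)
    then have "(\<lambda>n. form_norm m sform (u n - w)) \<longlonglongrightarrow> 0"
      by (simp add: fn[OF graph_diff[OF uv S]])
    then show "\<exists>w\<in>Domain S. (\<lambda>n. form_norm m sform (u n - w)) \<longlonglongrightarrow> 0"
      using S by blast
  qed
qed

text \<open>\<open><S f, S u> = <g, u>\<close> for all \<open>u\<close> in the domain says that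
  \<open>(S f, g)\<close> lies in the adjoint of \<open>S\<close>, which is
  \<open>S\<close>.\<close>

lemma form_op_sform: "dense_closed_form.form_op m (Domain S) sform = S O S"
proof -
  interpret A: dense_closed_form m "Domain S" sform by (rule sform_dense_closed)
  show ?thesis
  proof (intro equalityI subrelI)
    fix f g assume "(f, g) \<in> A.form_op"
    note fg = A.form_opD[OF this]
    have "(op_apply S f, g) \<in> S"
    proof (rule graphI)
      fix u v assume uv: "(u, v) \<in> S"
      then have "sform f u = l2_inner m g u" using fg(4) by blast
      then show "l2_inner m v (op_apply S f) = l2_inner m u g"
        using sform_eq[OF op_apply[OF fg(1)] uv] graph_l2[OF uv] fg
          L.ip_commute[of v "op_apply S f"] L.ip_commute[of u g] by simp
    qed (use fg in auto)
    then show "(f, g) \<in> S O S" using op_apply[OF fg(1)] by blast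
  next
    fix f g assume "(f, g) \<in> S O S"
    then obtain z where z: "(f, z) \<in> S" "(z, g) \<in> S" by blast
    have "sform f w = l2_inner m g w" if "w \<in> Domain S" for w
      using sform_eq[OF z(1) op_apply[OF that]] graph_sym[OF z(2) op_apply[OF that]] graph_l2[OF z(1)]
        graph_l2[OF z(2)] that graph_l2(1)[OF op_apply[OF that]]
        L.ip_commute[of z "op_apply S w"] L.ip_commute[of g w] by simp
    then show "(f, g) \<in> A.form_op"
      using z graph_l2 by (auto simp: A.form_op_def)
  qed
qed

end

context dense_closed_form
begin

text \<open>Whichever root \<open>S\<close> the choice operator returns, \<open>S.sform\<close> is a
  closed form with operator \<open>S O S = form_op\<close>; recovery of a form from its operator,
  used in both directions, identifies it with \<open>E\<close>.\<close>

theorem op_form_form_op: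
  "op_form_dom m form_op = D" "u \<in> D \<Longrightarrow> v \<in> D \<Longrightarrow> op_form m form_op u v = E u v"
proof -
  define S where "S = op_sqrt m form_op"
  have "nonneg_selfadjoint m S \<and> S O S = form_op"
    unfolding S_def op_sqrt_def by (rule someI_ex[OF form_op_sqrt_exists])
  then interpret S: nonneg_selfadjoint_op m S
    by unfold_locales blast
  have SS: "S O S = form_op" using \<open>nonneg_selfadjoint m S \<and> S O S = form_op\<close> by blast
  have eq: "form_op = dense_closed_form.form_op m (Domain S) S.sform"
    by (simp add: S.form_op_sform SS)
  have A: "dense_closed_form m D E" by unfold_locales
  note uniq = form_op_unique_subset[OF A S.sform_dense_closed eq]
  have "D \<subseteq> Domain S" using uniq(1) by blast
  moreover have "Domain S \<subseteq> D"
    using form_op_unique_subset(1)[OF S.sform_dense_closed A eq[symmetric]] by blast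
  ultimately show "op_form_dom m form_op = D"
    by (simp add: op_form_dom_def S_def)
  show "op_form m form_op u v = E u v" if "u \<in> D" "v \<in> D"
    using uniq(2)[OF that] by (simp add: S.sform_def op_form_def flip: S_def)
qed

end

section \<open>Balls in a homogeneous ultrametric measure space\<close>

locale hierarchical_space =
  fixes m :: "'a::metric_space measure" and C :: "'a set \<Rightarrow> real"
  assumes ultrametric_space: "ultrametric_measure_space m"
    and homogeneous: "homogeneous m"
    and noncompact: "\<not> compact (UNIV :: 'a set)"
    and choice_function: "choice_function C"
begin

lemma ultrametric: "dist x y \<le> max (dist x z) (dist z (y::'a))"
  using ultrametric_space by (simp add: ultrametric_measure_space_def)

lemma dist_less_trans: "dist x y < r \<Longrightarrow> dist y z < r \<Longrightarrow> dist x (z::'a) < r"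
  using ultrametric[of x z y] by linarith

lemma sets_eq: "sets m = sets borel"
  using ultrametric_space by (simp add: ultrametric_measure_space_def)

lemma space_eq [simp]: "space m = UNIV"
  using sets_eq_imp_space_eq[OF sets_eq] by simp

lemma measurable_eq: "borel_measurable m = borel_measurable borel"
  by (rule measurable_cong_sets[OF sets_eq refl])

lemma ball_eq: "y \<in> ball x r \<Longrightarrow> ball y r = ball (x::'a) r"
  using dist_less_trans by (auto simp: dist_commute)

lemma ballsI [simp]: "0 < r \<Longrightarrow> ball x r \<in> balls"
  by (auto simp: balls_def)

lemma balls_centre:
  assumes "B \<in> balls" "y \<in> B"
  obtains r where "0 < r" "B = ball (y::'a) r"
proof -
  obtain x r where B: "0 < r" "B = ball x r" using assms(1) by (auto simp: balls_def)
  then have "B = ball y r" using ball_eq[of y x r] assms(2) by simp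
  with B(1) show ?thesis by (rule that)
qed

lemma balls_nonempty: "B \<in> balls \<Longrightarrow> B \<noteq> {}"
  by (auto simp: balls_def)

lemma balls_nested:
  assumes "A \<in> balls" "B \<in> balls" "A \<inter> B \<noteq> {}"
  shows "A \<subseteq> B \<or> B \<subseteq> (A :: 'a set)"
proof -
  obtain y where "y \<in> A" "y \<in> B" using assms by blast
  then obtain r s where "A = ball y r" "B = ball y s"
    using assms balls_centre by metis
  then show ?thesis by (cases "r \<le> s") auto
qed

lemma ball_subset_or_disjoint:
  fixes x z :: 'a
  assumes "r \<le> s"
  shows "ball x r \<subseteq> ball z s \<or> ball x r \<inter> ball z s = {}"
proof (cases "ball x r \<inter> ball z s = {}")
  case False
  then obtain y where y: "y \<in> ball x r" "y \<in> ball z s" by blast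
  have "ball x r = ball y r" "ball z s = ball y s"
    using ball_eq[OF y(1)] ball_eq[OF y(2)] by auto
  then show ?thesis using assms by auto
qed simp

lemma balls_open: "B \<in> balls \<Longrightarrow> open B"
  by (auto simp: balls_def)

lemma ball_closed: "closed (ball (x::'a) r)"
proof -
  have "open (- ball x r)"
    unfolding open_contains_ball
  proof
    fix y assume y: "y \<in> - ball x r"
    show "\<exists>e>0. ball y e \<subseteq> - ball x r"
    proof (cases "0 < r")
      case True
      have "y \<in> ball y r" using True by simp
      then have "ball y r \<subseteq> - ball x r"
        using y ball_subset_or_disjoint[of r r y x] by blast
      with True show ?thesis by blast
    next
      case False
      then have "\<not> dist x z < r" for z using zero_le_dist[of x z] by linarith
      then have "ball y 1 \<subseteq> - ball x r" by auto
      then show ?thesis using zero_less_one by blast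
    qed
  qed
  then show ?thesis by (simp add: closed_def)
qed

lemma ball_compact: "compact (ball (x::'a) r)"
proof -
  have "compact (cball x r)"
    using ultrametric_space by (simp add: ultrametric_measure_space_def)
  then have "compact (cball x r \<inter> ball x r)"
    using ball_closed by (rule compact_Int_closed)
  moreover have "cball x r \<inter> ball x r = ball x r" by auto
  ultimately show ?thesis by simp
qed

lemma balls_compact: "B \<in> balls \<Longrightarrow> compact (B :: 'a set)"
  using ball_compact by (auto simp: balls_def)

lemma balls_sets [measurable]: "B \<in> balls \<Longrightarrow> B \<in> sets m"
  by (simp add: sets_eq borel_open balls_open)

lemma ball_sets [measurable]: "ball x r \<in> sets m"
  by (simp add: sets_eq)

lemma compact_emeasure: "compact K \<Longrightarrow> emeasure m K < \<infinity>"
  using ultrametric_space by (simp add: ultrametric_measure_space_def)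

lemma balls_emeasure: "B \<in> balls \<Longrightarrow> emeasure m B < \<infinity>"
  by (rule compact_emeasure[OF balls_compact])

lemma balls_measure_pos:
  assumes "B \<in> balls"
  shows "0 < measure m B"
proof -
  have "0 < emeasure m B"
    using ultrametric_space balls_open[OF assms] balls_nonempty[OF assms]
    by (simp add: ultrametric_measure_space_def)
  then show ?thesis
    using balls_emeasure[OF assms] by (simp add: measure_def enn2real_positive_iff)
qed

section \<open>Isometries and the weights of balls\<close>

lemma isometry_ball:
  assumes "g \<in> isometries"
  shows "g ` ball x r = ball (g (x::'a)) r"
proof -
  have "y \<in> g ` ball x r" if "dist (g x) y < r" for y
  proof -
    obtain z where "y = g z" using assms unfolding isometries_def bij_def surj_def by blast
    then show ?thesis using assms that by (auto simp: isometries_def)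
  qed
  then show ?thesis
    using assms by (auto simp: isometries_def)
qed

lemma isometry_exists:
  obtains g where "g \<in> isometries" "g x = (y::'a)"
  using homogeneous unfolding homogeneous_def by blast

lemma isometry_inv:
  assumes "g \<in> isometries"
  shows "inv g \<in> isometries"
proof -
  have g: "bij g" "\<And>x y. dist (g x) (g y) = dist x y" using assms by (auto simp: isometries_def)
  have "dist (inv g x) (inv g y) = dist x y" for x y
    using g(2)[of "inv g x" "inv g y"] g(1) by (simp add: bij_is_surj surj_f_inv_f)
  then show ?thesis using g(1) by (simp add: isometries_def bij_imp_bij_inv)
qed

lemma isometry_balls:
  assumes "g \<in> isometries" "(B :: 'a set) \<in> balls"
  shows "g ` B \<in> balls"
proof -
  obtain x r where "0 < r" "B = ball x r" using assms(2) by (auto simp: balls_def)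
  then show ?thesis using isometry_ball[OF assms(1), of x r] by simp
qed

lemma isometry_diameter:
  assumes "g \<in> isometries"
  shows "diameter (g ` B) = diameter (B :: 'a set)"
proof -
  have "(\<lambda>(x, y). dist x y) ` (g ` B \<times> g ` B) = (\<lambda>(x, y). dist x y) ` (B \<times> B)"
  proof -
    have "g ` B \<times> g ` B = (\<lambda>(x, y). (g x, g y)) ` (B \<times> B)" by auto
    then show ?thesis using assms by (simp add: isometries_def image_image case_prod_unfold)
  qed
  then show ?thesis by (simp add: diameter_def)
qed

lemma C_pos: "B \<in> balls \<Longrightarrow> 0 < C B"
  by (rule choice_function[unfolded choice_function_def, THEN conjunct1, rule_format])

lemma C_diameter: "A \<in> balls \<Longrightarrow> B \<in> balls \<Longrightarrow> diameter A = diameter B \<Longrightarrow> C A = C B"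
  by (rule choice_function[unfolded choice_function_def, THEN conjunct2, THEN conjunct1, rule_format])

lemma C_summable: "B \<in> balls \<Longrightarrow> \<nexists>b. B = {b} \<Longrightarrow> C summable_on {T \<in> balls. B \<subseteq> T}"
  by (rule choice_function[unfolded choice_function_def, THEN conjunct2, THEN conjunct2, THEN conjunct1,
        rule_format]) auto

lemma C_isometry:
  assumes "g \<in> isometries" "B \<in> balls"
  shows "C (g ` B) = C B"
  by (rule C_diameter[OF isometry_balls[OF assms] assms(2) isometry_diameter[OF assms(1)]])

text \<open>Strict inclusion, because a function constant on \<open>B\<close> has no deviation on
  \<open>B\<close> itself, so that only larger balls contribute to \<open>L\<close> there.\<close>

definition above :: "'a set \<Rightarrow> 'a set set" where
  "above B = {T \<in> balls. B \<subset> T}"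

text \<open>For a ball \<open>B\<close> this is \<open>ball_lambda\<close> without the term of
  \<open>B\<close> itself.\<close>

definition mu :: "'a set \<Rightarrow> real" where
  "mu B = infsum C (above B)"

text \<open>For a singleton ball \<open>B\<close> all points are isolated by homogeneity, so there are only finitely
  many balls between \<open>B\<close> and any larger ball; hence condition (ii) also covers the strict sum.\<close>

lemma C_summable_above:
  assumes B: "B \<in> balls"
  shows "C summable_on above B"
proof (cases "\<exists>b. B = {b}")
  case False
  then have "C summable_on {T \<in> balls. B \<subseteq> T}"
    by (rule C_summable[OF B])
  then show ?thesis
    by (rule summable_on_subset_banach) (auto simp: above_def)
next
  case True
  then obtain b where b: "B = {b}" by blast
  show ?thesis
  proof (cases "above B = {}")
    case True
    then show ?thesis by simp
  next
    case False
    then obtain T where T: "T \<in> balls" "B \<subset> T" by (auto simp: above_def)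
    obtain r where r: "0 < r" "B = ball b r" using balls_centre[OF B] b by blast
    have single: "ball y r = {y}" for y :: 'a
    proof -
      obtain g where g: "g \<in> isometries" "g b = y" by (rule isometry_exists)
      have "ball b r = {b}" using r b by simp
      then show ?thesis using isometry_ball[OF g(1), of b r] g(2) by simp
    qed
    have "finite T"
    proof -
      have "\<exists>D\<subseteq>T. finite D \<and> T \<subseteq> (\<Union>y\<in>D. ball y r)"
        by (rule compactE_image[OF balls_compact[OF T(1)], of T "\<lambda>y. ball y r"]) (use r in auto)
      then show ?thesis using single by (auto intro: finite_subset)
    qed
    have "T \<noteq> {c}" for c using T(2) b by auto
    then have "C summable_on {S \<in> balls. T \<subseteq> S}"
      using C_summable[OF T(1)] by blast
    moreover have "finite (Pow T)" using \<open>finite T\<close> by simp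
    ultimately have "C summable_on ({S \<in> balls. T \<subseteq> S} \<union> (Pow T - {S \<in> balls. T \<subseteq> S}))"
      by (intro summable_on_Un_disjoint[OF _ summable_on_finite]) auto
    then show ?thesis
    proof (rule summable_on_subset_banach)
      show "above B \<subseteq> {S \<in> balls. T \<subseteq> S} \<union> (Pow T - {S \<in> balls. T \<subseteq> S})"
        using balls_nested[OF _ T(1)] T(2) b by (auto simp: above_def)
    qed
  qed
qed

lemma mu_nonneg: "0 \<le> mu B"
  unfolding mu_def by (rule infsum_nonneg) (auto simp: above_def dest: C_pos intro: less_imp_le)

lemma sum_above_le_mu:
  assumes "B \<in> balls" "finite F" "F \<subseteq> above B"
  shows "sum C F \<le> mu B"
  unfolding mu_def using assms C_pos
  by (intro finite_sum_le_infsum C_summable_above) (auto simp: above_def intro: less_imp_le)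

text \<open>An isometry taking \<open>x\<close> to \<open>y\<close> maps the balls above
  \<open>ball x r\<close> bijectively to those above \<open>ball y r\<close> and preserves
  diameters, hence \<open>C\<close>. This makes the later bound for \<open>L\<close> uniform in the
  point.\<close>

lemma mu_ball_eq: "mu (ball x r) = mu (ball y r)"
proof -
  obtain g where g: "g \<in> isometries" "g x = y" by (rule isometry_exists)
  have bij: "bij g" using g by (simp add: isometries_def)
  have "bij_betw ((`) g) (above (ball x r)) (above (ball y r))"
  proof (rule bij_betw_byWitness[where f' = "(`) (inv g)"])
    show "\<forall>T\<in>above (ball x r). inv g ` g ` T = T"
      using bij by (simp add: bij_is_inj image_inv_f_f)
    show "\<forall>T\<in>above (ball y r). g ` inv g ` T = T"
      using bij by (simp add: bij_is_surj image_f_inv_f)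
    have *: "h ` T \<in> above (ball (h z) r)" if "h \<in> isometries" "T \<in> above (ball z r)" for h z T
    proof -
      have "inj h" using that by (simp add: isometries_def bij_is_inj)
      have "h ` ball z r \<subset> h ` T"
        using that inj_image_subset_iff[OF \<open>inj h\<close>] unfolding above_def by blast
      then show ?thesis
        using that isometry_ball[OF that(1)] isometry_balls[OF that(1)] by (simp add: above_def)
    qed
    show "(`) g ` above (ball x r) \<subseteq> above (ball y r)"
      using *[OF g(1), of _ x] g(2) by auto
    have "inv g y = x" using bij g(2) by (simp add: bij_is_inj inv_f_eq)
    then show "(`) (inv g) ` above (ball y r) \<subseteq> above (ball x r)"
      using *[OF isometry_inv[OF g(1)], of _ y] by auto
  qed
  from infsum_reindex_bij_betw[OF this, of C]
  have "infsum C (above (ball y r)) = infsum (\<lambda>T. C (g ` T)) (above (ball x r))" by simp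
  also have "\<dots> = infsum C (above (ball x r))"
    using C_isometry[OF g(1)] by (intro infsum_cong) (simp add: above_def)
  finally show ?thesis by (simp add: mu_def)
qed

text \<open>A ball contains a point \<open>s\<close> of a countable dense set and so is one of the
  small balls at \<open>s\<close> or lies above one; the balls above a fixed ball are countably
  many, being the index set of a summable family of positive numbers.\<close>

lemma countable_balls: "countable (balls :: 'a set set)"
proof -
  have above: "countable (above B)" if "B \<in> balls" for B
  proof -
    have "countable {T \<in> above B. C T \<noteq> 0}"
      by (rule summable_countable_real[OF C_summable_above[OF that]])
    moreover have "{T \<in> above B. C T \<noteq> 0} = above B"
      using C_pos by (fastforce simp: above_def)
    ultimately show ?thesis by simp
  qed
  have "\<exists>S::'a set. countable S \<and> closure S = UNIV"
    using ultrametric_space unfolding ultrametric_measure_space_def by (elim conjE)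
  then obtain S :: "'a set" where S: "countable S" "closure S = UNIV"
    by blast
  let ?b = "\<lambda>s n. ball s (1 / real (Suc n))"
  have "balls \<subseteq> (\<Union>s\<in>S. \<Union>n. insert (?b s n) (above (?b s n)))"
  proof
    fix T :: "'a set" assume T: "T \<in> balls"
    have "T \<inter> S \<noteq> {}"
      using S(2) balls_open[OF T] balls_nonempty[OF T] open_Int_closure_eq_empty by blast
    then obtain s where s: "s \<in> T" "s \<in> S" by blast
    obtain r where r: "0 < r" "T = ball s r" by (rule balls_centre[OF T s(1)])
    obtain n where "1 / real (Suc n) < r"
      using nat_approx_posE[OF r(1)] by blast
    then have "?b s n \<subseteq> T" using r by (intro subsetI) simp
    then have "T \<in> insert (?b s n) (above (?b s n))" using T by (auto simp: above_def)
    then show "T \<in> (\<Union>s\<in>S. \<Union>n. insert (?b s n) (above (?b s n)))" using s(2) by blast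
  qed
  moreover have "countable (\<Union>s\<in>S. \<Union>n. insert (?b s n) (above (?b s n)))"
    using S(1) by (intro countable_UN) (auto intro!: countable_insert above)
  ultimately show ?thesis by (rule countable_subset)
qed

text \<open>Countability of \<open>balls\<close> turns an open set into a countable union of balls.
  Together with the empty set the balls are thus an intersection-stable generator, as uniqueness of
  measures requires.\<close>

lemma sigma_sets_balls: "sigma_sets UNIV (insert {} balls) = sets (borel :: 'a measure)"
proof -
  have "sigma_sets UNIV (insert {} balls) = sigma_sets UNIV {S :: 'a set. open S}"
  proof (rule sigma_sets_eqI)
    fix A :: "'a set" assume "A \<in> insert {} balls"
    then show "A \<in> sigma_sets UNIV {S. open S}"
      using balls_open by auto
  next
    fix U :: "'a set" assume "U \<in> {S. open S}"
    then have U: "open U" by simp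
    have "U = \<Union> {B \<in> balls. B \<subseteq> U}"
    proof (intro equalityI subsetI)
      fix x assume "x \<in> U"
      then obtain e where "0 < e" "ball x e \<subseteq> U" using U open_contains_ball by blast
      then show "x \<in> \<Union> {B \<in> balls. B \<subseteq> U}" by (intro UnionI[of "ball x e"]) auto
    qed auto
    also have "\<dots> \<in> sigma_sets UNIV (insert {} balls)"
      by (rule sigma_sets_UNION) (auto intro: countable_subset[OF _ countable_balls] sigma_sets.Basic)
    finally show "U \<in> sigma_sets UNIV (insert {} balls)" .
  qed
  then show ?thesis by (simp add: borel_def)
qed

definition origin :: 'a where
  "origin = undefined"

text \<open>The radii \<open>n + 1\<close> start at 1, so a ball of radius at most 1 lies inside
  \<open>B0 n\<close> or misses it.\<close>

definition B0 :: "nat \<Rightarrow> 'a set" where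
  "B0 n = ball origin (real (Suc n))"

lemma B0_balls [simp]: "B0 n \<in> balls"
  by (simp add: B0_def)

lemma B0_mono: "k \<le> n \<Longrightarrow> B0 k \<subseteq> B0 n"
  by (auto simp: B0_def)

lemma B0_UN: "(\<Union>n. B0 n) = UNIV"
proof -
  have "x \<in> (\<Union>n. B0 n)" for x
  proof -
    obtain n where "dist origin x < real n" using reals_Archimedean2 by blast
    then show ?thesis by (auto simp: B0_def intro!: exI[of _ n])
  qed
  then show ?thesis by blast
qed

lemma sigma_finite: "sigma_finite_measure m"
proof
  show "\<exists>A. countable A \<and> A \<subseteq> sets m \<and> \<Union> A = space m \<and> (\<forall>a\<in>A. emeasure m a \<noteq> \<infinity>)"
    using B0_UN balls_emeasure[OF B0_balls] balls_sets[OF B0_balls]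
    by (intro exI[of _ "range B0"]) (auto simp: less_top)
qed

lemma bounded_subset_B0:
  assumes "bounded S"
  obtains n where "S \<subseteq> B0 n"
proof -
  obtain e where e: "\<And>y. y \<in> S \<Longrightarrow> dist origin y \<le> e" using assms bounded_any_center[of S origin] by blast
  obtain n where "e < real n" using reals_Archimedean2 by blast
  then show ?thesis using e by (intro that[of n]) (fastforce simp: B0_def)
qed

lemma balls_subset_B0:
  assumes "B \<in> balls"
  obtains n where "B \<subseteq> B0 n"
  by (rule bounded_subset_B0[OF compact_imp_bounded[OF balls_compact[OF assms]]])

lemma indicator_l2 [simp]:
  assumes "B \<in> balls"
  shows "indicat_real B \<in> l2_space m"
proof -
  have "integrable m (indicat_real B)"
    using balls_sets[OF assms] balls_emeasure[OF assms] by (rule integrable_real_indicator)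
  moreover have "(\<lambda>x. (indicat_real B x)\<^sup>2) = indicat_real B"
    by (auto simp: indicator_def)
  ultimately show ?thesis by (simp add: l2_space_def)
qed

lemma restrict_l2:
  assumes "u \<in> l2_space m" "A \<in> sets m"
  shows "(\<lambda>x. indicator A x * u x) \<in> l2_space m"
proof -
  have "integrable m (\<lambda>x. indicator A x * (u x)\<^sup>2)"
    using integrable_mult_indicator[OF assms(2) l2_spaceD(2)[OF assms(1)]] by simp
  moreover have "(\<lambda>x. indicator A x * (u x)\<^sup>2) = (\<lambda>x. (indicator A x * u x)\<^sup>2)"
    by (auto simp: indicator_def)
  ultimately show ?thesis
    using assms l2_spaceD(1)[OF assms(1)] by (simp add: l2_space_def)
qed

sublocale L: semi_hilbert "l2_space m" "l2_inner m"
  rewrites "semi_inner.nrm (l2_inner m) = l2_norm m"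
  by (rule l2_semi_hilbert l2_nrm_eq)+

text \<open>\<open>ennreal\<close> sends negative numbers to 0, so the two densities compared are
  the positive and the negative part of \<open>h\<close>. The measures agree and are finite on
  balls, hence agree everywhere, which makes the two parts equal almost everywhere and so
  zero.\<close>

lemma orth_balls_null:
  assumes h: "h \<in> l2_space m" and orth: "\<And>B. B \<in> balls \<Longrightarrow> l2_inner m h (indicator B) = 0"
  shows "l2_norm m h = 0"
proof -
  interpret sigma_finite_measure m by (rule sigma_finite)
  have [measurable]: "h \<in> borel_measurable m" using h by (rule l2_spaceD)
  let ?M = "\<lambda>f. density m (\<lambda>x. ennreal (f x))"
  have eq: "emeasure (?M h) B = emeasure (?M (\<lambda>x. - h x)) B \<and> emeasure (?M h) B \<noteq> \<infinity>" if B: "B \<in> balls" for B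
  proof -
    note [measurable] = balls_sets[OF B]
    have int: "integrable m (\<lambda>x. h x * indicator B x)"
      by (rule l2_integrable_mult[OF h indicator_l2[OF B]])
    then have int': "integrable m (\<lambda>x. max 0 (h x) * indicator B x)" "integrable m (\<lambda>x. max 0 (- h x) * indicator B x)"
      by (rule Bochner_Integration.integrable_bound; auto simp: indicator_def)+
    have "(LINT x|m. max 0 (h x) * indicator B x) - (LINT x|m. max 0 (- h x) * indicator B x)
        = (LINT x|m. h x * indicator B x)"
      by (subst Bochner_Integration.integral_diff[symmetric, OF int'])
        (auto intro!: Bochner_Integration.integral_cong simp: indicator_def max_def)
    also have "\<dots> = 0"
      using orth[OF B] by (simp add: l2_inner_def)
    finally have I: "(LINT x|m. max 0 (h x) * indicator B x) = (LINT x|m. max 0 (- h x) * indicator B x)"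
      by simp
    have em: "emeasure (?M f) B = ennreal (LINT x|m. max 0 (f x) * indicator B x)"
      if "f \<in> borel_measurable m" "integrable m (\<lambda>x. max 0 (f x) * indicator B x)" for f :: "'a \<Rightarrow> real"
    proof -
      have "emeasure (?M f) B = (\<integral>\<^sup>+x. ennreal (f x) * indicator B x \<partial>m)"
        using that(1) by (intro emeasure_density) auto
      also have "\<dots> = (\<integral>\<^sup>+x. ennreal (max 0 (f x) * indicator B x) \<partial>m)"
        by (intro nn_integral_cong) (auto simp: indicator_def ennreal_neg max_def)
      also have "\<dots> = ennreal (LINT x|m. max 0 (f x) * indicator B x)"
        by (rule nn_integral_eq_integral[OF that(2)]) auto
      finally show ?thesis .
    qed
    show ?thesis
      using em[OF _ int'(1)] em[OF _ int'(2)] I by simp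
  qed
  define E :: "'a set set" where "E = insert {} balls"
  have "?M h = ?M (\<lambda>x. - h x)"
  proof (rule measure_eqI_generator_eq[where E = E and A = B0 and \<Omega> = UNIV])
    show "Int_stable (E)"
    proof (rule Int_stableI)
      fix A B :: "'a set" assume "A \<in> E" "B \<in> E"
      then show "A \<inter> B \<in> E"
        using balls_nested[of A B] by (cases "A \<inter> B = {}") (auto simp: E_def Int_absorb1 Int_absorb2)
    qed
    show "emeasure (?M h) X = emeasure (?M (\<lambda>x. - h x)) X" if "X \<in> E" for X
      using that eq by (auto simp: E_def)
    show "sets (?M h) = sigma_sets UNIV (E)" "sets (?M (\<lambda>x. - h x)) = sigma_sets UNIV (E)"
      by (simp_all add: E_def sigma_sets_balls sets_eq)
  qed (use B0_UN eq[OF B0_balls, THEN conjunct2] in \<open>auto simp: E_def\<close>)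
  then have "AE x in m. ennreal (h x) = ennreal (- h x)"
    by (subst (asm) density_unique_iff) auto
  then have "AE x in m. h x = 0"
  proof (rule AE_mp, intro AE_I2 impI)
    fix x assume "ennreal (h x) = ennreal (- h x)"
    then show "h x = 0"
      by (cases "0 \<le> h x") (auto simp: ennreal_neg ennreal_eq_0_iff)
  qed
  then show ?thesis using l2_norm_eq_0_iff[OF h] by simp
qed

section \<open>Test functions\<close>

text \<open>Locally constant functions with compact support are constant at some uniform scale.\<close>

definition test_scale :: "('a \<Rightarrow> real) \<Rightarrow> real \<Rightarrow> nat \<Rightarrow> bool" where
  "test_scale \<phi> r n \<longleftrightarrow> 0 < r \<and> (\<forall>x y. dist x y < r \<longrightarrow> \<phi> x = \<phi> y) \<and> (\<forall>x. x \<notin> B0 n \<longrightarrow> \<phi> x = 0)"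

lemma test_scaleI:
  "0 < r \<Longrightarrow> (\<And>x y. dist x y < r \<Longrightarrow> \<phi> x = \<phi> y) \<Longrightarrow> (\<And>x. x \<notin> B0 n \<Longrightarrow> \<phi> x = 0) \<Longrightarrow> test_scale \<phi> r n"
  unfolding test_scale_def by (intro conjI allI impI)

lemma test_scaleD:
  assumes "test_scale \<phi> r n"
  shows "0 < r" "dist x y < r \<Longrightarrow> \<phi> x = \<phi> y" "x \<notin> B0 n \<Longrightarrow> \<phi> x = 0"
  by (rule assms[unfolded test_scale_def, THEN conjunct1],
      rule assms[unfolded test_scale_def, THEN conjunct2, THEN conjunct1, rule_format], assumption,
      rule assms[unfolded test_scale_def, THEN conjunct2, THEN conjunct2, rule_format], assumption)

text \<open>A finite cover of the compact support by balls of constancy has a smallest radius, and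
  the strong triangle inequality keeps a nearby \<open>y\<close> in the covering ball of
  \<open>x\<close> without halving radii; two points outside the support both have value 0.\<close>

lemma test_functions_iff: "\<phi> \<in> test_functions \<longleftrightarrow> (\<exists>r n. test_scale \<phi> r n)"
proof
  assume "\<phi> \<in> test_functions"
  then have loc: "\<And>x. \<exists>U. open U \<and> x \<in> U \<and> \<phi> constant_on U" and K: "compact (closure {x. \<phi> x \<noteq> 0})"
    by (auto simp: test_functions_def compactly_supported_def)
  let ?K = "closure {x. \<phi> x \<noteq> 0}"
  have ex: "\<exists>e. 0 < e \<and> (\<forall>y\<in>ball x e. \<phi> y = \<phi> x)" for x
  proof -
    obtain U where U: "open U" "x \<in> U" "\<phi> constant_on U" using loc by blast
    then obtain e where e: "0 < e" "ball x e \<subseteq> U" using open_contains_ball by blast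
    obtain c where c: "\<And>z. z \<in> U \<Longrightarrow> \<phi> z = c" using U(3) unfolding constant_on_def by blast
    have eqx: "\<phi> y = \<phi> x" if "y \<in> ball x e" for y
    proof -
      have "y \<in> U" using e(2) that by auto
      then show ?thesis using c[OF U(2)] c[of y] by simp
    qed
    show ?thesis by (intro exI[of _ e] conjI ballI e(1) eqx)
  qed
  define e where "e x = (SOME e. 0 < e \<and> (\<forall>y\<in>ball x e. \<phi> y = \<phi> x))" for x
  have ee: "0 < e x \<and> (\<forall>y\<in>ball x (e x). \<phi> y = \<phi> x)" for x
    unfolding e_def by (rule someI_ex[OF ex])
  have e: "0 < e x" "y \<in> ball x (e x) \<Longrightarrow> \<phi> y = \<phi> x" for x y
    by (rule ee[THEN conjunct1], rule ee[THEN conjunct2, THEN bspec])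
  have "\<exists>D\<subseteq>?K. finite D \<and> ?K \<subseteq> (\<Union>x\<in>D. ball x (e x))"
  proof (rule compactE_image[OF K, of ?K "\<lambda>x. ball x (e x)"])
    show "?K \<subseteq> (\<Union>x\<in>?K. ball x (e x))"
    proof
      fix x assume "x \<in> ?K"
      then show "x \<in> (\<Union>x\<in>?K. ball x (e x))" by (rule UN_I) (simp add: e(1))
    qed
    show "\<exists>D\<subseteq>?K. finite D \<and> ?K \<subseteq> (\<Union>x\<in>D. ball x (e x))"
      if "D \<subseteq> ?K" "finite D" "?K \<subseteq> (\<Union>x\<in>D. ball x (e x))" for D
      using that by (intro exI conjI)
  qed (rule open_ball)
  then obtain D where D: "D \<subseteq> ?K" "finite D" "?K \<subseteq> (\<Union>x\<in>D. ball x (e x))"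
    by (elim exE conjE)
  \<comment> \<open>The 1 keeps the minimum defined when the support, and with it \<open>D\<close>,
    is empty.\<close>
  define r where "r = Min (insert 1 (e ` D))"
  have r: "0 < r" "\<And>x. x \<in> D \<Longrightarrow> r \<le> e x"
    using D(2) e(1) by (auto simp: r_def)
  have *: "\<phi> y = \<phi> x" if xK: "x \<in> ?K" and d: "dist x y < r" for x y
  proof -
    obtain z where z: "z \<in> D" "x \<in> ball z (e z)" using D(3) xK by blast
    then have "dist z y < e z"
      using dist_less_trans[of z x "e z" y] d r(2)[OF z(1)] by simp
    then show ?thesis using e(2)[of y z] e(2)[OF z(2)] by simp
  qed
  have eq: "\<phi> x = \<phi> y" if "dist x y < r" for x y
  proof (cases "x \<in> ?K \<or> y \<in> ?K")
    case True
    then show ?thesis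
    proof
      assume "x \<in> ?K"
      from *[OF this that] show ?thesis by (rule sym)
    next
      assume "y \<in> ?K"
      from *[OF this] that show ?thesis by (simp add: dist_commute)
    qed
  next
    case False
    then have "\<phi> x = 0" "\<phi> y = 0" using closure_subset[of "{x. \<phi> x \<noteq> 0}"] by auto
    then show ?thesis by simp
  qed
  obtain n where n: "?K \<subseteq> B0 n"
    by (rule bounded_subset_B0[OF compact_imp_bounded[OF K]])
  have zero: "\<phi> x = 0" if "x \<notin> B0 n" for x
    using n that closure_subset[of "{x. \<phi> x \<noteq> 0}"] by auto
  have "test_scale \<phi> r n" by (rule test_scaleI[OF r(1) eq zero])
  then show "\<exists>r n. test_scale \<phi> r n" by blast
next
  assume "\<exists>r n. test_scale \<phi> r n"
  then obtain r n where "test_scale \<phi> r n" by blast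
  note r = test_scaleD(1,2)[OF this] and n = test_scaleD(3)[OF this]
  have "\<exists>U. open U \<and> x \<in> U \<and> \<phi> constant_on U" for x
  proof (intro exI conjI)
    have "\<phi> y = \<phi> x" if "y \<in> ball x r" for y
      using r(2)[of x y] that by simp
    then show "\<phi> constant_on ball x r"
      unfolding constant_on_def by (intro exI[of _ "\<phi> x"] ballI)
  qed (use r(1) in auto)
  moreover have "closure {x. \<phi> x \<noteq> 0} \<subseteq> B0 n"
  proof (rule closure_minimal)
    show "{x. \<phi> x \<noteq> 0} \<subseteq> B0 n" using n by blast
    show "closed (B0 n)" unfolding B0_def by (rule ball_closed)
  qed
  then have "compact (closure {x. \<phi> x \<noteq> 0})"
    using compact_Int_closed[OF balls_compact[OF B0_balls, of n] closed_closure[of "{x. \<phi> x \<noteq> 0}"]]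
    by (simp add: Int_absorb1)
  ultimately show "\<phi> \<in> test_functions"
    by (simp add: test_functions_def compactly_supported_def)
qed

text \<open>The subspaces on whose bounded members \<open>L\<close> acts with norm at most
  \<open>mu0 r\<close>, when \<open>r\<close> is positive.\<close>

definition const_scale :: "real \<Rightarrow> ('a \<Rightarrow> real) set" where
  "const_scale r = {u \<in> l2_space m. \<forall>x y. dist x y < r \<longrightarrow> u x = u y}"

lemma const_scaleD:
  assumes "u \<in> const_scale r"
  shows "u \<in> l2_space m" "dist x y < r \<Longrightarrow> u x = u y"
  by (rule assms[unfolded const_scale_def mem_Collect_eq, THEN conjunct1],
      rule assms[unfolded const_scale_def mem_Collect_eq, THEN conjunct2, rule_format], assumption)

lemma const_scaleI:
  "u \<in> l2_space m \<Longrightarrow> (\<And>x y. dist x y < r \<Longrightarrow> u x = u y) \<Longrightarrow> u \<in> const_scale r"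
  unfolding const_scale_def by (intro CollectI conjI allI impI)

lemma const_scale_subspace: "subspace (const_scale r)"
  unfolding subspace_def
proof (intro conjI ballI allI)
  show "0 \<in> const_scale r" by (simp add: const_scale_def)
  fix u assume u: "u \<in> const_scale r"
  show "c *\<^sub>R u \<in> const_scale r" for c
    unfolding const_scale_def
  proof (intro CollectI conjI allI impI)
    show "(c *\<^sub>R u) x = (c *\<^sub>R u) y" if "dist x y < r" for x y
      using const_scaleD(2)[OF u that] by simp
  qed (use const_scaleD(1)[OF u] in simp)
  fix v assume v: "v \<in> const_scale r"
  show "u + v \<in> const_scale r"
    unfolding const_scale_def
  proof (intro CollectI conjI allI impI)
    show "(u + v) x = (u + v) y" if "dist x y < r" for x y
      using const_scaleD(2)[OF u that] const_scaleD(2)[OF v that] by simp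
  qed (use const_scaleD(1)[OF u] const_scaleD(1)[OF v] in simp)
qed

lemma locally_constant_continuous:
  assumes "0 < r" "\<And>x y. dist x y < r \<Longrightarrow> \<phi> x = \<phi> (y::'a)"
  shows "continuous_on UNIV (\<phi> :: 'a \<Rightarrow> real)"
  unfolding continuous_on_iff
proof (intro ballI allI impI exI conjI)
  fix x y :: 'a and e :: real
  assume "0 < e" "dist y x < r"
  then show "dist (\<phi> y) (\<phi> x) < e" using assms(2)[of y x] by simp
qed (rule assms(1))

lemma locally_constant_measurable:
  assumes "0 < r" "\<And>x y. dist x y < r \<Longrightarrow> \<phi> x = \<phi> (y::'a)"
  shows "(\<phi> :: 'a \<Rightarrow> real) \<in> borel_measurable m"
  unfolding measurable_eq by (rule borel_measurable_continuous_onI[OF locally_constant_continuous[OF assms]])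

lemma bounded_support_l2:
  assumes "u \<in> borel_measurable m" "\<And>x. \<bar>u x\<bar> \<le> M" "\<And>x. x \<notin> B0 n \<Longrightarrow> u x = 0"
  shows "u \<in> l2_space m"
proof -
  have "integrable m (\<lambda>x. M\<^sup>2 * indicator (B0 n) x)"
    using balls_sets[OF B0_balls] balls_emeasure[OF B0_balls] by auto
  then have "integrable m (\<lambda>x. (u x)\<^sup>2)"
  proof (rule Bochner_Integration.integrable_bound)
    have "(u x)\<^sup>2 \<le> M\<^sup>2 * indicator (B0 n) x" for x
      using assms(2)[of x] assms(3)[of x] abs_le_square_iff[of "u x" M] by (cases "x \<in> B0 n") auto
    then show "AE x in m. norm ((u x)\<^sup>2) \<le> norm (M\<^sup>2 * indicator (B0 n) x)" by simp
  qed (use assms(1) in simp)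
  then show ?thesis using assms(1) by (simp add: l2_space_def)
qed

lemma test_functionsE:
  assumes "\<phi> \<in> test_functions"
  obtains r n M where "0 < r" "\<phi> \<in> const_scale r" "\<And>x. x \<notin> B0 n \<Longrightarrow> \<phi> x = 0" "\<And>x. \<bar>\<phi> x\<bar> \<le> M"
proof -
  obtain r n where "test_scale \<phi> r n"
    using assms unfolding test_functions_iff by blast
  note r = test_scaleD(1,2)[OF this] and n = test_scaleD(3)[OF this]
  have "compact (\<phi> ` B0 n)"
    by (rule compact_continuous_image[OF continuous_on_subset[OF locally_constant_continuous[OF r] subset_UNIV]
          balls_compact[OF B0_balls]])
  from compact_imp_bounded[OF this] obtain M where "\<forall>y\<in>\<phi> ` B0 n. norm y \<le> M"
    unfolding bounded_iff by blast
  then have M: "\<And>x. x \<in> B0 n \<Longrightarrow> \<bar>\<phi> x\<bar> \<le> M" by simp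
  have M': "\<bar>\<phi> x\<bar> \<le> max 0 M" for x
    using M[of x] n[of x] by (cases "x \<in> B0 n") auto
  have "\<phi> \<in> l2_space m"
    by (rule bounded_support_l2[OF locally_constant_measurable[OF r] M' n])
  then have "\<phi> \<in> const_scale r" by (rule const_scaleI[OF _ r(2)])
  then show ?thesis by (rule that[OF r(1) _ n M'])
qed

lemma test_functions_l2:
  assumes "\<phi> \<in> test_functions"
  shows "\<phi> \<in> l2_space m"
proof (rule test_functionsE[OF assms])
  show "\<phi> \<in> l2_space m" if "\<phi> \<in> const_scale r" for r
    by (rule const_scaleD(1)[OF that])
qed

lemma test_functionsI:
  assumes "0 < r" "\<phi> \<in> const_scale r" "\<And>x. x \<notin> B0 n \<Longrightarrow> \<phi> x = 0"
  shows "\<phi> \<in> test_functions"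
proof -
  have "test_scale \<phi> r n"
    by (rule test_scaleI, rule assms(1), erule const_scaleD(2)[OF assms(2)], erule assms(3))
  then show ?thesis unfolding test_functions_iff by blast
qed

lemma test_functions_subspace: "subspace (test_functions :: ('a \<Rightarrow> real) set)"
  unfolding subspace_def
proof (intro conjI ballI allI)
  have "test_scale 0 1 0" by (rule test_scaleI) simp_all
  then show "0 \<in> (test_functions :: ('a \<Rightarrow> real) set)"
    unfolding test_functions_iff by blast
  fix u :: "'a \<Rightarrow> real" assume "u \<in> test_functions"
  then obtain r n where u: "test_scale u r n" unfolding test_functions_iff by blast
  note r = test_scaleD[OF u]
  show "c *\<^sub>R u \<in> test_functions" for c
  proof -
    have "test_scale (c *\<^sub>R u) r n"
    proof (rule test_scaleI[OF r(1)])
      show "(c *\<^sub>R u) x = (c *\<^sub>R u) y" if "dist x y < r" for x y using r(2)[OF that] by simp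
      show "(c *\<^sub>R u) x = 0" if "x \<notin> B0 n" for x using r(3)[OF that] by simp
    qed
    then show ?thesis unfolding test_functions_iff by blast
  qed
  fix v :: "'a \<Rightarrow> real" assume "v \<in> test_functions"
  then obtain s k where v: "test_scale v s k" unfolding test_functions_iff by blast
  note s = test_scaleD[OF v]
  have "test_scale (u + v) (min r s) (max n k)"
  proof (rule test_scaleI)
    show "0 < min r s" using r(1) s(1) by simp
    show "(u + v) x = (u + v) y" if "dist x y < min r s" for x y using r(2)[of x y] s(2)[of x y] that by simp
    show "(u + v) x = 0" if "x \<notin> B0 (max n k)" for x
    proof -
      have "x \<notin> B0 n" "x \<notin> B0 k"
        using that B0_mono[of n "max n k"] B0_mono[of k "max n k"] by auto
      then show ?thesis using r(3)[of x] s(3)[of x] by simp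
    qed
  qed
  then show "u + v \<in> test_functions" unfolding test_functions_iff by blast
qed

lemma indicator_ball_const_scale:
  assumes "0 < s" "r \<le> s"
  shows "indicat_real (ball x s) \<in> const_scale r"
proof -
  have "indicat_real (ball x s) y = indicat_real (ball x s) z" if "dist y z < r" for y z
  proof -
    have "0 < r" using that zero_le_dist[of y z] by linarith
    then have "y \<in> ball y r" "z \<in> ball y r" using that by auto
    then have "y \<in> ball x s \<longleftrightarrow> z \<in> ball x s"
      using ball_subset_or_disjoint[OF assms(2), of y x] by blast
    then show ?thesis by (simp only: indicator_def)
  qed
  moreover have "indicat_real (ball x s) \<in> l2_space m" using assms by simp
  ultimately show ?thesis by (intro const_scaleI)
qed

lemma indicator_balls_test:
  assumes "(B :: 'a set) \<in> balls"
  shows "indicat_real B \<in> test_functions"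
proof -
  obtain x s where B: "0 < s" "B = ball x s" using assms by (auto simp: balls_def)
  obtain n where "B \<subseteq> B0 n" by (rule balls_subset_B0[OF assms])
  then show ?thesis
    using B indicator_ball_const_scale[OF B(1) order_refl, of x]
    by (intro test_functionsI[of s _ n]) (auto simp: indicator_def)
qed

lemma test_functions_dense: "l2_dense m test_functions"
proof (rule l2_denseI[OF test_functions_subspace])
  show "test_functions \<subseteq> l2_space m" using test_functions_l2 by blast
  show "l2_norm m h = 0" if "h \<in> l2_space m" "\<And>u. u \<in> test_functions \<Longrightarrow> l2_inner m h u = 0" for h
    using that indicator_balls_test by (intro orth_balls_null) auto
qed

text \<open>A continuous function with compact support is uniformly approximated by sampling it once in
  each ball of a small radius.\<close>

lemma test_functions_uniformly_dense:
  assumes u: "(u :: 'a \<Rightarrow> real) \<in> continuous_compact" and e: "0 < e"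
  shows "\<exists>w\<in>test_functions. \<forall>x::'a. \<bar>u x - w x\<bar> < e"
proof -
  have cont: "continuous_on UNIV u" and K: "compact (closure {x. u x \<noteq> 0})"
    using u by (auto simp: continuous_compact_def compactly_supported_def)
  obtain n where n: "closure {x. u x \<noteq> 0} \<subseteq> B0 n"
    by (rule bounded_subset_B0[OF compact_imp_bounded[OF K]])
  have zero: "u x = 0" if "x \<notin> B0 n" for x
    using n that closure_subset[of "{x. u x \<noteq> 0}"] by auto
  have "uniformly_continuous_on (B0 n) u"
    using cont balls_compact[OF B0_balls] by (intro compact_uniformly_continuous) (auto intro: continuous_on_subset)
  then obtain d where d: "0 < d" "\<And>x y. x \<in> B0 n \<Longrightarrow> y \<in> B0 n \<Longrightarrow> dist y x < d \<Longrightarrow> dist (u y) (u x) < e"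
    using e unfolding uniformly_continuous_on_def by meson
  \<comment> \<open>The cap 1 is the smallest radius of \<open>B0\<close>: each sampling ball lies
    in \<open>B0 n\<close> or misses it, which keeps the support of the sampled function in
    \<open>B0 n\<close>.\<close>
  define r where "r = min d 1"
  have r: "0 < r" "r \<le> d" "r \<le> 1" using d(1) by (auto simp: r_def)
  \<comment> \<open>The choice depends only on the set \<open>ball x r\<close>, so all points of one
    ball receive the same sample point.\<close>
  define c :: "'a \<Rightarrow> 'a" where "c x = (SOME y. y \<in> ball x r)" for x
  have c: "c x \<in> ball x r" for x
    unfolding c_def by (rule someI[of _ x]) (use r in simp)
  have rn: "ball x r \<subseteq> B0 n \<or> ball x r \<inter> B0 n = {}" for x
    unfolding B0_def by (rule ball_subset_or_disjoint) (use r in simp)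
  have cn: "c x \<in> B0 n \<longleftrightarrow> x \<in> B0 n" for x
  proof -
    have "x \<in> ball x r" using r by simp
    then show ?thesis using rn[of x] c[of x] by blast
  qed
  define w where "w x = u (c x)" for x
  have "test_scale w r n"
  proof (rule test_scaleI)
    show "0 < r" by (rule r)
    show "w x = w y" if "dist x y < r" for x y
      using ball_eq[of y x r] that by (simp add: w_def c_def)
    show "w x = 0" if "x \<notin> B0 n" for x
      using that cn[of x] zero[of "c x"] by (simp add: w_def)
  qed
  then have "w \<in> test_functions" unfolding test_functions_iff by blast
  moreover have "\<bar>u x - w x\<bar> < e" for x
  proof (cases "x \<in> B0 n")
    case True
    then have "c x \<in> B0 n" by (simp add: cn)
    then show ?thesis
      using d(2)[of "c x" x] True c[of x] r by (simp add: w_def dist_real_def)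
  next
    case False
    then have "c x \<notin> B0 n" by (simp add: cn)
    then show ?thesis using False zero e by (simp add: w_def)
  qed
  ultimately show ?thesis by blast
qed

end

section \<open>The form of the hierarchical Laplacian\<close>

lemma l2_norm_mono:
  assumes "u \<in> l2_space m" "v \<in> l2_space m" "\<And>x. \<bar>u x\<bar> \<le> \<bar>v x\<bar>"
  shows "l2_norm m u \<le> l2_norm m v"
proof -
  have "(LINT x|m. (u x)\<^sup>2) \<le> (LINT x|m. (v x)\<^sup>2)"
    using assms abs_le_square_iff by (intro integral_mono l2_spaceD) auto
  then show ?thesis by (simp add: l2_norm_def l2_inner_def power2_eq_square)
qed

lemma l2_space_AE:
  assumes "f \<in> l2_space m" "g \<in> borel_measurable m" "AE x in m. f x = g x"
  shows "g \<in> l2_space m"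
proof -
  note [measurable] = assms(2) l2_spaceD(1)[OF assms(1)]
  have "integrable m (\<lambda>x. (f x)\<^sup>2) \<longleftrightarrow> integrable m (\<lambda>x. (g x)\<^sup>2)"
    using assms(3) by (intro integrable_cong_AE) auto
  then show ?thesis using assms l2_spaceD(2)[OF assms(1)] by (simp add: l2_space_def)
qed

lemma l2_inner_sum_left:
  assumes "finite F" "\<And>i. i \<in> F \<Longrightarrow> f i \<in> l2_space m" "v \<in> l2_space m"
  shows "(\<lambda>x. \<Sum>i\<in>F. c i * f i x) \<in> l2_space m"
    "l2_inner m (\<lambda>x. \<Sum>i\<in>F. c i * f i x) v = (\<Sum>i\<in>F. c i * l2_inner m (f i) v)"
proof -
  show "(\<lambda>x. \<Sum>i\<in>F. c i * f i x) \<in> l2_space m"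
    using assms(1,2)
  proof (induction F rule: finite_induct)
    case empty
    then show ?case by (simp add: l2_space_def)
  next
    case (insert i F)
    have "(\<lambda>x. c i * f i x + 1 * (\<Sum>i\<in>F. c i * f i x)) \<in> l2_space m"
      by (rule l2_space_combine) (use insert in auto)
    then show ?case using insert by simp
  qed
  have "l2_inner m (\<lambda>x. \<Sum>i\<in>F. c i * f i x) v = (LINT x|m. (\<Sum>i\<in>F. c i * (f i x * v x)))"
    by (simp add: l2_inner_def sum_distrib_right mult.assoc)
  also have "\<dots> = (\<Sum>i\<in>F. LINT x|m. c i * (f i x * v x))"
    using assms l2_integrable_mult by (intro Bochner_Integration.integral_sum integrable_mult_right) auto
  finally show "l2_inner m (\<lambda>x. \<Sum>i\<in>F. c i * f i x) v = (\<Sum>i\<in>F. c i * l2_inner m (f i) v)"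
    by (simp add: l2_inner_def)
qed

section \<open>Means and deviations on a ball\<close>

context hierarchical_space
begin

definition avg :: "'a set \<Rightarrow> ('a \<Rightarrow> real) \<Rightarrow> real" where
  "avg B u = l2_inner m (indicator B) u / measure m B"

text \<open>On \<open>l2_space\<close> this is the orthogonal projection onto the functions that
  vanish outside the ball \<open>B\<close> and have mean zero on it.\<close>

definition dev :: "'a set \<Rightarrow> ('a \<Rightarrow> real) \<Rightarrow> 'a \<Rightarrow> real" where
  "dev B u = (\<lambda>x. indicator B x * (u x - avg B u))"

definition restrict_to :: "'a set \<Rightarrow> ('a \<Rightarrow> real) \<Rightarrow> 'a \<Rightarrow> real" where
  "restrict_to B u = (\<lambda>x. indicator B x * u x)"

lemma restrict_to_l2 [simp]: "u \<in> l2_space m \<Longrightarrow> B \<in> balls \<Longrightarrow> restrict_to B u \<in> l2_space m"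
  unfolding restrict_to_def by (rule restrict_l2[OF _ balls_sets])

lemma restrict_to_norm_le:
  assumes "u \<in> l2_space m" "B \<in> balls"
  shows "l2_norm m (restrict_to B u) \<le> l2_norm m u"
  using assms by (intro l2_norm_mono restrict_to_l2) (auto simp: restrict_to_def indicator_def)

lemma avg_eq_integral: "avg B u = 1 / measure m B * (LINT y:B|m. u y)"
  by (simp add: avg_def l2_inner_def set_lebesgue_integral_def)

lemma avg_linear:
  assumes "B \<in> balls" "u \<in> l2_space m" "v \<in> l2_space m"
  shows "avg B (u + v) = avg B u + avg B v" "avg B (u - v) = avg B u - avg B v"
    "avg B (c *\<^sub>R u) = c * avg B u"
  using assms by (simp_all add: avg_def L.ip_add_right L.ip_diff_right L.ip_scale_right add_divide_distrib diff_divide_distrib)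

lemma avg_const:
  assumes B: "B \<in> balls" and c: "\<And>y. y \<in> B \<Longrightarrow> u y = c"
  shows "avg B u = c"
proof -
  have "l2_inner m (indicator B) u = (LINT x|m. c * indicator B x)"
    unfolding l2_inner_def using c by (intro Bochner_Integration.integral_cong) (auto simp: indicator_def)
  also have "\<dots> = c * measure m B"
    using balls_sets[OF B] balls_emeasure[OF B] by simp
  finally show ?thesis using balls_measure_pos[OF B] by (simp add: avg_def)
qed

lemma dev_eq: "dev B u = restrict_to B u - avg B u *\<^sub>R indicator B"
  by (rule ext) (simp add: dev_def restrict_to_def algebra_simps)

lemma dev_l2 [simp]: "B \<in> balls \<Longrightarrow> u \<in> l2_space m \<Longrightarrow> dev B u \<in> l2_space m"
  unfolding dev_eq by (intro L.mem restrict_to_l2 indicator_l2)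

lemma dev_linear:
  assumes "B \<in> balls" "u \<in> l2_space m" "v \<in> l2_space m"
  shows "dev B (u + v) = dev B u + dev B v" "dev B (u - v) = dev B u - dev B v"
    "dev B (c *\<^sub>R u) = c *\<^sub>R dev B u"
  by (rule ext, simp add: dev_def avg_linear[OF assms] algebra_simps)+

lemma indicator_ip:
  assumes "B \<in> balls"
  shows "l2_inner m (indicator B) (indicator B) = measure m B"
  using avg_const[OF assms, of "indicator B" 1] balls_measure_pos[OF assms] by (simp add: avg_def field_simps)

lemma dev_orth_indicator:
  assumes B: "B \<in> balls" and u: "u \<in> l2_space m"
  shows "l2_inner m (dev B u) (indicator B) = 0"
proof -
  have "l2_inner m (restrict_to B u) (indicator B) = l2_inner m (indicator B) u"
    unfolding l2_inner_def restrict_to_def by (intro Bochner_Integration.integral_cong) (auto simp: indicator_def)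
  also have "\<dots> = avg B u * measure m B"
    using balls_measure_pos[OF B] by (simp add: avg_def)
  finally show ?thesis
    unfolding dev_eq using B u by (simp add: L.ip_diff_left L.ip_scale_left indicator_ip)
qed

text \<open>\<open>dev B u\<close> vanishes outside \<open>B\<close> and is orthogonal to
  \<open>indicator B\<close>, so it sees only the part of \<open>v\<close> that \<open>dev B\<close>
  keeps.\<close>

lemma dev_ip:
  assumes B: "B \<in> balls" and u: "u \<in> l2_space m" and v: "v \<in> l2_space m"
  shows "l2_inner m (dev B u) (dev B v) = l2_inner m (dev B u) v"
proof -
  have "l2_inner m (dev B u) v = l2_inner m (dev B u) (restrict_to B v)"
    unfolding l2_inner_def restrict_to_def dev_def
    by (intro Bochner_Integration.integral_cong) (auto simp: indicator_def)
  then show ?thesis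
    unfolding dev_eq[of B v] using B u v dev_orth_indicator[OF B u]
    by (simp add: L.ip_diff_right L.ip_scale_right)
qed

text \<open>Pythagoras: on \<open>B\<close>, \<open>u - c\<close> is \<open>dev B u\<close> plus the
  orthogonal function \<open>(avg B u - c) *\<^sub>R indicator B\<close>.\<close>

lemma dev_norm_le_const:
  assumes B: "B \<in> balls" and u: "u \<in> l2_space m"
  shows "l2_norm m (dev B u) \<le> l2_norm m (restrict_to B u - c *\<^sub>R indicator B)"
proof -
  let ?i = "indicat_real B"
  define d where "d = avg B u - c"
  have eq: "restrict_to B u - c *\<^sub>R ?i = dev B u + d *\<^sub>R ?i"
    by (rule ext) (simp add: dev_eq d_def algebra_simps)
  have "(l2_norm m (dev B u + d *\<^sub>R ?i))\<^sup>2 = (l2_norm m (dev B u))\<^sup>2 + d * (d * measure m B)"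
    using B u dev_orth_indicator[OF B u] L.ip_commute[of "dev B u" ?i]
    by (simp add: L.nrm_sq L.ip_simps indicator_ip)
  moreover have "0 \<le> d * (d * measure m B)"
    by (simp flip: mult.assoc)
  ultimately have "(l2_norm m (dev B u))\<^sup>2 \<le> (l2_norm m (dev B u + d *\<^sub>R ?i))\<^sup>2"
    by linarith
  then show ?thesis
    unfolding eq by (rule power2_le_imp_le) (use B u in simp)
qed

lemma dev_norm_le:
  assumes "B \<in> balls" "u \<in> l2_space m"
  shows "l2_norm m (dev B u) \<le> l2_norm m u"
  using dev_norm_le_const[OF assms, of 0] restrict_to_norm_le[OF assms(2,1)] by simp

section \<open>Energy as a sum over balls\<close>

definition eB :: "'a set \<Rightarrow> ('a \<Rightarrow> real) \<Rightarrow> ('a \<Rightarrow> real) \<Rightarrow> real" where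
  "eB B u v = C B * l2_inner m (dev B u) (dev B v)"

definition EL :: "('a \<Rightarrow> real) \<Rightarrow> ('a \<Rightarrow> real) \<Rightarrow> real" where
  "EL u v = (\<Sum>\<^sub>\<infinity>B\<in>balls. eB B u v)"

definition DL :: "('a \<Rightarrow> real) set" where
  "DL = {u \<in> l2_space m. (\<lambda>B. eB B u u) summable_on balls}"

lemma DLD: "u \<in> DL \<Longrightarrow> u \<in> l2_space m" "u \<in> DL \<Longrightarrow> (\<lambda>B. eB B u u) summable_on balls"
  by (auto simp: DL_def)

lemma eB_norm: "B \<in> balls \<Longrightarrow> u \<in> l2_space m \<Longrightarrow> eB B u u = C B * (l2_norm m (dev B u))\<^sup>2"
  by (simp add: eB_def L.nrm_sq)

lemma eB_nonneg: "B \<in> balls \<Longrightarrow> u \<in> l2_space m \<Longrightarrow> 0 \<le> eB B u u"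
  using C_pos by (simp add: eB_norm less_imp_le)

lemma eB_commute: "B \<in> balls \<Longrightarrow> u \<in> l2_space m \<Longrightarrow> v \<in> l2_space m \<Longrightarrow> eB B u v = eB B v u"
  by (simp add: eB_def L.ip_commute[of "dev B u" "dev B v"])

lemma eB_linear:
  assumes "B \<in> balls" "u \<in> l2_space m" "v \<in> l2_space m" "w \<in> l2_space m"
  shows "eB B (u + v) w = eB B u w + eB B v w" "eB B (u - v) w = eB B u w - eB B v w"
    "eB B (c *\<^sub>R u) w = c * eB B u w"
  using assms by (simp_all add: eB_def dev_linear L.ip_simps algebra_simps)

lemma eB_para:
  assumes "B \<in> balls" "u \<in> l2_space m" "v \<in> l2_space m"
  shows "eB B (u + v) (u + v) + eB B (u - v) (u - v) = 2 * eB B u u + 2 * eB B v v"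
  using assms eB_commute[of B u "u + v"] eB_commute[of B v "u + v"] eB_commute[of B u "u - v"]
    eB_commute[of B v "u - v"] eB_commute[of B u v]
  by (simp add: eB_linear)

lemma eB_AE:
  assumes "B \<in> balls" "u \<in> l2_space m" "u' \<in> l2_space m" "w \<in> l2_space m" "AE x in m. u x = u' x"
  shows "eB B u' w = eB B u w"
proof -
  have "l2_norm m (u' - u) = 0"
    using l2_norm_diff_eq_0_iff[OF assms(2,3)] L.nrm_minus_commute[OF assms(2,3)] assms(5) by simp
  then have "l2_norm m (dev B u' - dev B u) = 0"
    using dev_norm_le[OF assms(1), of "u' - u"] assms
    by (intro L.nrm_eq_0_if_le) (simp_all add: dev_linear)
  then have "l2_inner m (dev B u' - dev B u) (dev B w) = 0"
    using assms by (intro L.ip_eq_0_if_nrm_eq_0) auto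
  then show ?thesis using assms by (simp add: eB_def L.ip_diff_left)
qed

lemma eB_cross_le:
  assumes "B \<in> balls" "u \<in> l2_space m" "v \<in> l2_space m"
  shows "\<bar>eB B u v\<bar> \<le> eB B u u + eB B v v"
proof -
  have "0 \<le> eB B (u + v) (u + v)" "0 \<le> eB B (u - v) (u - v)"
    using assms by (auto intro: eB_nonneg)
  moreover have "eB B (u + v) (u + v) = eB B u u + 2 * eB B u v + eB B v v"
    "eB B (u - v) (u - v) = eB B u u - 2 * eB B u v + eB B v v"
    using assms eB_commute[of B u "u + v"] eB_commute[of B v "u + v"] eB_commute[of B u "u - v"]
      eB_commute[of B v "u - v"] eB_commute[of B u v]
    by (simp_all add: eB_linear)
  moreover have "0 \<le> eB B u u" "0 \<le> eB B v v" using assms by (auto intro: eB_nonneg)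
  ultimately show ?thesis by linarith
qed

lemma eB_summable:
  assumes "u \<in> DL" "v \<in> DL"
  shows "(\<lambda>B. eB B u v) summable_on balls"
proof -
  have "(\<lambda>B. norm (eB B u v)) summable_on balls"
  proof (rule summable_on_comparison_test)
    show "(\<lambda>B. eB B u u + eB B v v) summable_on balls"
      using DLD(2) assms by (intro summable_on_add)
  qed (use eB_cross_le DLD(1) assms in auto)
  then show ?thesis by (rule abs_summable_summable)
qed

text \<open>The terms are nonnegative, so a common bound for all finite partial sums gives both
  summability and the bound of the sum. Energy estimates are therefore proved on finite sets of
  balls.\<close>

lemma DL_I:
  assumes "u \<in> l2_space m" "\<And>F. finite F \<Longrightarrow> F \<subseteq> balls \<Longrightarrow> (\<Sum>B\<in>F. eB B u u) \<le> M"
  shows "u \<in> DL" "EL u u \<le> M"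
proof -
  have s: "(\<lambda>B. eB B u u) summable_on balls"
    using assms eB_nonneg by (intro nonneg_bdd_above_summable_on bdd_aboveI[of _ M]) auto
  then show "u \<in> DL" using assms(1) by (simp add: DL_def)
  show "EL u u \<le> M"
    unfolding EL_def by (rule infsum_le_finite_sums[OF s assms(2)])
qed

lemma sum_eB_le_EL:
  assumes "u \<in> DL" "finite F" "F \<subseteq> balls"
  shows "(\<Sum>B\<in>F. eB B u u) \<le> EL u u"
  unfolding EL_def using assms DLD eB_nonneg
  by (intro finite_sum_le_infsum) auto

lemma EL_nonneg: "u \<in> DL \<Longrightarrow> 0 \<le> EL u u"
  unfolding EL_def using eB_nonneg DLD(1) by (intro infsum_nonneg) auto

lemma DL_subspace: "subspace DL"
  unfolding subspace_def
proof (intro conjI ballI allI)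
  show "0 \<in> DL"
  proof (rule DL_I(1)[of _ 0])
    have "eB B 0 0 = 0" if "B \<in> balls" for B
      using eB_linear(3)[OF that, of 0 0 0 0] by simp
    then show "(\<Sum>B\<in>F. eB B 0 0) \<le> 0" if "F \<subseteq> balls" for F
      using that by (intro sum_nonpos) auto
  qed simp
  fix u assume u: "u \<in> DL"
  show "c *\<^sub>R u \<in> DL" for c
  proof (rule DL_I(1)[of _ "c\<^sup>2 * EL u u"])
    fix F :: "'a set set" assume F: "finite F" "F \<subseteq> balls"
    have "eB B (c *\<^sub>R u) (c *\<^sub>R u) = c\<^sup>2 * eB B u u" if "B \<in> F" for B
      using that F DLD(1)[OF u] eB_commute[of B u "c *\<^sub>R u"] by (auto simp: eB_linear power2_eq_square subset_iff)
    then have "(\<Sum>B\<in>F. eB B (c *\<^sub>R u) (c *\<^sub>R u)) = c\<^sup>2 * (\<Sum>B\<in>F. eB B u u)"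
      by (simp add: sum_distrib_left)
    also have "\<dots> \<le> c\<^sup>2 * EL u u"
      by (intro mult_left_mono sum_eB_le_EL u F) simp
    finally show "(\<Sum>B\<in>F. eB B (c *\<^sub>R u) (c *\<^sub>R u)) \<le> c\<^sup>2 * EL u u" .
  qed (use DLD(1)[OF u] in simp)
  fix v assume v: "v \<in> DL"
  show "u + v \<in> DL"
  proof (rule DL_I(1)[of _ "2 * EL u u + 2 * EL v v"])
    fix F :: "'a set set" assume F: "finite F" "F \<subseteq> balls"
    have "eB B (u + v) (u + v) \<le> 2 * eB B u u + 2 * eB B v v" if "B \<in> F" for B
      using that F eB_para[of B u v] eB_nonneg[of B "u - v"] DLD(1)[OF u] DLD(1)[OF v] by (auto simp: subset_iff)
    then have "(\<Sum>B\<in>F. eB B (u + v) (u + v)) \<le> (\<Sum>B\<in>F. 2 * eB B u u + 2 * eB B v v)"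
      by (rule sum_mono)
    also have "\<dots> = 2 * (\<Sum>B\<in>F. eB B u u) + 2 * (\<Sum>B\<in>F. eB B v v)"
      by (simp add: sum.distrib sum_distrib_left)
    also have "\<dots> \<le> 2 * EL u u + 2 * EL v v"
      by (intro add_mono mult_left_mono sum_eB_le_EL u v F) auto
    finally show "(\<Sum>B\<in>F. eB B (u + v) (u + v)) \<le> 2 * EL u u + 2 * EL v v" .
  qed (use DLD(1)[OF u] DLD(1)[OF v] in simp)
qed

lemma eB_tendsto:
  assumes "B \<in> balls" "\<And>n. u n \<in> l2_space m" "w \<in> l2_space m" "(\<lambda>n. l2_norm m (u n - w)) \<longlonglongrightarrow> 0"
  shows "(\<lambda>n. eB B (u n) (u n)) \<longlonglongrightarrow> eB B w w"
proof -
  have "(\<lambda>n. l2_norm m (dev B (u n) - dev B w)) \<longlonglongrightarrow> 0"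
  proof (rule Lim_null_comparison[OF _ assms(4)], intro always_eventually allI)
    fix n
    have "l2_norm m (dev B (u n - w)) \<le> l2_norm m (u n - w)"
      by (rule dev_norm_le[OF assms(1)]) (use assms in simp)
    then show "norm (l2_norm m (dev B (u n) - dev B w)) \<le> l2_norm m (u n - w)"
      using assms(1-3) by (simp add: dev_linear)
  qed
  then show ?thesis
    unfolding eB_def using assms by (intro tendsto_mult_left L.tendsto_ip) auto
qed

text \<open>Each finite partial sum of the energy is continuous in \<open>L2\<close>, so it inherits
  the bound \<open>M\<close> in the limit.\<close>

lemma EL_lsc:
  assumes "\<And>n. u n \<in> DL" "w \<in> l2_space m" "(\<lambda>n. l2_norm m (u n - w)) \<longlonglongrightarrow> 0" "\<And>n. EL (u n) (u n) \<le> M"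
  shows "w \<in> DL" "EL w w \<le> M"
proof -
  have "(\<Sum>B\<in>F. eB B w w) \<le> M" if F: "finite F" "F \<subseteq> balls" for F
  proof (rule tendsto_upperbound)
    show "(\<lambda>n. \<Sum>B\<in>F. eB B (u n) (u n)) \<longlonglongrightarrow> (\<Sum>B\<in>F. eB B w w)"
      using F DLD(1)[OF assms(1)] assms(2,3) by (intro tendsto_sum eB_tendsto) auto
    show "\<forall>\<^sub>F n in sequentially. (\<Sum>B\<in>F. eB B (u n) (u n)) \<le> M"
      using order_trans[OF sum_eB_le_EL[OF assms(1) F] assms(4)] by simp
  qed simp
  then show "w \<in> DL" "EL w w \<le> M"
    using DL_I[OF assms(2)] by blast+
qed

lemma EL_linear:
  assumes "u \<in> DL" "v \<in> DL" "w \<in> DL"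
  shows "EL (u + v) w = EL u w + EL v w" "EL (c *\<^sub>R u) w = c * EL u w"
proof -
  have "EL (u + v) w = (\<Sum>\<^sub>\<infinity>B\<in>balls. eB B u w + eB B v w)"
    unfolding EL_def using DLD(1) assms by (intro infsum_cong eB_linear) auto
  also have "\<dots> = EL u w + EL v w"
    unfolding EL_def by (intro infsum_add eB_summable assms)
  finally show "EL (u + v) w = EL u w + EL v w" .
  have "EL (c *\<^sub>R u) w = (\<Sum>\<^sub>\<infinity>B\<in>balls. c * eB B u w)"
    unfolding EL_def using DLD(1) assms by (intro infsum_cong eB_linear) auto
  then show "EL (c *\<^sub>R u) w = c * EL u w"
    unfolding EL_def by (simp add: infsum_cmult_right')
qed

lemma EL_commute: "u \<in> DL \<Longrightarrow> v \<in> DL \<Longrightarrow> EL u v = EL v u"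
  unfolding EL_def using DLD(1) by (intro infsum_cong eB_commute) auto

lemma EL_symmetric: "symmetric_form m DL EL"
  unfolding symmetric_form_def combine_fun_eq
proof (intro conjI ballI impI allI)
  show "DL \<noteq> {}" using subspace_0[OF DL_subspace] by blast
  show "DL \<subseteq> l2_space m" using DLD(1) by blast
next
  fix u u' assume u: "u \<in> DL" "u' \<in> l2_space m" "AE x in m. u x = u' x"
  have eq: "eB B u' w = eB B u w" if "B \<in> balls" "w \<in> l2_space m" for B w
    using eB_AE[OF that(1) DLD(1)[OF u(1)] u(2) that(2) u(3)] .
  have "(\<lambda>B. eB B u' u') summable_on balls \<longleftrightarrow> (\<lambda>B. eB B u u) summable_on balls"
  proof (rule summable_on_cong)
    fix B :: "'a set" assume B: "B \<in> balls"
    have "eB B u' u' = eB B u u'" by (rule eq[OF B u(2)])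
    also have "\<dots> = eB B u' u" by (rule eB_commute[OF B DLD(1)[OF u(1)] u(2)])
    also have "\<dots> = eB B u u" by (rule eq[OF B DLD(1)[OF u(1)]])
    finally show "eB B u' u' = eB B u u" .
  qed
  then show "u' \<in> DL" using u DLD(2)[OF u(1)] by (simp add: DL_def)
  fix w assume "w \<in> DL"
  then show "EL u' w = EL u w"
    unfolding EL_def using eq DLD(1) by (intro infsum_cong) auto
next
  fix u v :: "'a \<Rightarrow> real" and a b :: real
  assume uv: "u \<in> DL" "v \<in> DL"
  have m: "a *\<^sub>R u \<in> DL" "b *\<^sub>R v \<in> DL" using uv DL_subspace by (auto intro: subspace_scale)
  then show "a *\<^sub>R u + b *\<^sub>R v \<in> DL" using DL_subspace by (intro subspace_add)
  fix w assume w: "w \<in> DL"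
  show "EL (a *\<^sub>R u + b *\<^sub>R v) w = a * EL u w + b * EL v w"
    using m uv w by (simp add: EL_linear)
qed (rule EL_commute)

text \<open>The limit \<open>w\<close> is taken in \<open>L2\<close>, where the sequence is Cauchy
  as well; lower semicontinuity, applied to \<open>u j - u (n + N)\<close> as \<open>n\<close>
  grows, then bounds the energy of \<open>u j - w\<close>.\<close>

lemma EL_closed: "closed_form m DL EL"
  unfolding closed_form_iff
proof (intro allI impI, elim conjE)
  fix u :: "nat \<Rightarrow> 'a \<Rightarrow> real"
  assume "\<forall>n. u n \<in> DL" and cauchy: "\<forall>e>0. \<exists>N. \<forall>j\<ge>N. \<forall>k\<ge>N. form_norm m EL (u j - u k) < e"
  then have u: "u n \<in> DL" for n by blast
  have d: "u j - u k \<in> DL" for j k using u DL_subspace by (intro subspace_diff)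
  have fn: "form_norm m EL x = sqrt (EL x x + (l2_norm m x)\<^sup>2)" if "x \<in> DL" for x
    using that by (simp add: form_norm_def L.nrm_sq DLD(1))
  have le: "l2_norm m (u j - u k) \<le> form_norm m EL (u j - u k)" for j k
    unfolding fn[OF d] using EL_nonneg[OF d] by (intro real_le_rsqrt) simp
  have le2: "EL (u j - u k) (u j - u k) \<le> e\<^sup>2" if "form_norm m EL (u j - u k) < e" for j k e
  proof -
    have "sqrt (EL (u j - u k) (u j - u k)) \<le> form_norm m EL (u j - u k)"
      unfolding fn[OF d] by simp
    then have "sqrt (EL (u j - u k) (u j - u k)) \<le> e" using that by simp
    then show ?thesis using real_sqrt_le_iff EL_nonneg[OF d] by (simp add: real_sqrt_le_iff sqrt_le_D)
  qed
  have "L.cauchy_seq u"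
    unfolding L.cauchy_seq_def using cauchy le[THEN order.strict_trans1] by meson
  then obtain w where w: "w \<in> l2_space m" "(\<lambda>n. l2_norm m (u n - w)) \<longlonglongrightarrow> 0"
    using L.complete[of u] DLD(1)[OF u] by blast
  have key: "u j - w \<in> DL \<and> EL (u j - w) (u j - w) \<le> e\<^sup>2"
    if N: "\<forall>k\<ge>N. form_norm m EL (u j - u k) < e" for j N e
  proof -
    have lim: "(\<lambda>n. l2_norm m ((u j - u (n + N)) - (u j - w))) \<longlonglongrightarrow> 0"
    proof -
      have "l2_norm m ((u j - u (n + N)) - (u j - w)) = l2_norm m (u (n + N) - w)" for n
        using L.nrm_minus_commute[of "u (n + N)" w] DLD(1)[OF u] w(1) by (simp add: algebra_simps)
      then show ?thesis using LIMSEQ_ignore_initial_segment[OF w(2), of N] by simp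
    qed
    have b: "EL (u j - u (n + N)) (u j - u (n + N)) \<le> e\<^sup>2" for n
      using N by (intro le2) simp
    show ?thesis
      using EL_lsc[OF d _ lim b] DLD(1)[OF u] w(1) by simp
  qed
  have wD: "w \<in> DL"
  proof -
    obtain N where N: "\<forall>j\<ge>N. \<forall>k\<ge>N. form_norm m EL (u j - u k) < 1" using cauchy zero_less_one by blast
    then have "u N - w \<in> DL" using key[of N N 1] by blast
    then have "u N - (u N - w) \<in> DL" by (rule subspace_diff[OF DL_subspace u])
    then show ?thesis by simp
  qed
  have "(\<lambda>n. EL (u n - w) (u n - w)) \<longlonglongrightarrow> 0"
  proof (rule LIMSEQ_I)
    fix e :: real assume e: "0 < e"
    define e' where "e' = sqrt (e / 2)"
    have e': "0 < e'" "e'\<^sup>2 < e" using e by (auto simp: e'_def)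
    obtain N where N: "\<forall>j\<ge>N. \<forall>k\<ge>N. form_norm m EL (u j - u k) < e'" using cauchy e'(1) by blast
    have "norm (EL (u n - w) (u n - w) - 0) < e" if "n \<ge> N" for n
      using key[of N n e'] N that e' EL_nonneg[of "u n - w"] by auto
    then show "\<exists>no. \<forall>n\<ge>no. norm (EL (u n - w) (u n - w) - 0) < e" by blast
  qed
  then have "(\<lambda>n. sqrt (EL (u n - w) (u n - w) + (l2_norm m (u n - w))\<^sup>2)) \<longlonglongrightarrow> sqrt (0 + 0\<^sup>2)"
    by (intro tendsto_intros w)
  moreover have "u n - w \<in> DL" for n using u wD DL_subspace by (intro subspace_diff)
  ultimately have "(\<lambda>n. form_norm m EL (u n - w)) \<longlonglongrightarrow> 0" by (simp add: fn)
  then show "\<exists>w\<in>DL. (\<lambda>n. form_norm m EL (u n - w)) \<longlonglongrightarrow> 0" using wD by blast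
qed

text \<open>In the form domain, \<open>L\<^sup>2\<close>-convergence without asymptotic increase of energy is already
  convergence in energy, by the parallelogram law and lower semicontinuity.\<close>

lemma EL_tendsto_0:
  assumes u: "\<And>n. u n \<in> DL" and w: "w \<in> DL" and lim: "(\<lambda>n. l2_norm m (u n - w)) \<longlonglongrightarrow> 0"
    and le: "\<And>e. 0 < e \<Longrightarrow> \<forall>\<^sub>F n in sequentially. EL (u n) (u n) \<le> EL w w + e"
  shows "(\<lambda>n. EL (u n - w) (u n - w)) \<longlonglongrightarrow> 0"
proof (rule tendstoI)
  fix e :: real assume e: "0 < e"
  have l: "u n \<in> l2_space m" "w \<in> l2_space m" for n using DLD(1) u w by auto
  have mem: "u n - w \<in> DL" "u n + w \<in> DL" for n
    using u w DL_subspace by (auto intro: subspace_diff subspace_add)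
  \<comment> \<open>Missing \<open>e / 8\<close> of the energy of \<open>w\<close> costs
    \<open>e / 2\<close> after doubling \<open>w\<close>; with \<open>2 * (e / 8)\<close> from the
    assumption on \<open>u n\<close>, the parallelogram law leaves less than
    \<open>3 e / 4\<close>.\<close>
  obtain F where F: "finite F" "F \<subseteq> balls" "EL w w - e / 8 < (\<Sum>B\<in>F. eB B w w)"
  proof -
    have "((\<lambda>B. eB B w w) has_sum EL w w) balls"
      unfolding EL_def by (rule has_sum_infsum[OF DLD(2)[OF w]])
    from has_sum_finite_approximation[OF this, of "e / 16"] e
    obtain F where "finite F" "F \<subseteq> balls" "dist (\<Sum>B\<in>F. eB B w w) (EL w w) \<le> e / 16" by auto
    then show ?thesis using e that[of F] by (simp add: dist_real_def abs_if split: if_splits)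
  qed
  define w2 where "w2 = 2 *\<^sub>R w"
  have w2: "w2 \<in> l2_space m" using l(2) by (simp add: w2_def)
  have deq: "(u n + w) - w2 = u n - w" for n
    by (rule ext) (simp add: w2_def)
  have lim2: "(\<lambda>n. l2_norm m ((u n + w) - w2)) \<longlonglongrightarrow> 0"
    unfolding deq by (rule lim)
  have "(\<lambda>n. \<Sum>B\<in>F. eB B (u n + w) (u n + w)) \<longlonglongrightarrow> (\<Sum>B\<in>F. eB B w2 w2)"
    using F(2) l w2 lim2 by (intro tendsto_sum eB_tendsto) auto
  moreover have "(\<Sum>B\<in>F. eB B w2 w2) = 4 * (\<Sum>B\<in>F. eB B w w)"
  proof -
    have "eB B w2 w2 = 4 * eB B w w" if "B \<in> F" for B
    proof -
      have B: "B \<in> balls" using that F(2) by blast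
      have "eB B w2 w2 = 2 * eB B w w2"
        using eB_linear(3)[OF B l(2) l(2) w2, of 2] by (simp add: w2_def)
      also have "eB B w w2 = 2 * eB B w w"
        using eB_commute[OF B l(2) w2] eB_linear(3)[OF B l(2) l(2) l(2), of 2] by (simp add: w2_def)
      finally show ?thesis by simp
    qed
    then show ?thesis by (simp add: sum_distrib_left)
  qed
  ultimately have "\<forall>\<^sub>F n in sequentially. 4 * EL w w - e / 2 < (\<Sum>B\<in>F. eB B (u n + w) (u n + w))"
    using F(3) by (intro order_tendstoD(1)) auto
  then have "\<forall>\<^sub>F n in sequentially. 4 * EL w w - e / 2 < (\<Sum>B\<in>F. eB B (u n + w) (u n + w))
      \<and> EL (u n) (u n) \<le> EL w w + e / 8"
    using le[of "e / 8"] e by (intro eventually_conj) auto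
  then show "\<forall>\<^sub>F n in sequentially. dist (EL (u n - w) (u n - w)) 0 < e"
  proof (rule eventually_mono)
    fix n assume *: "4 * EL w w - e / 2 < (\<Sum>B\<in>F. eB B (u n + w) (u n + w)) \<and> EL (u n) (u n) \<le> EL w w + e / 8"
    have "EL (u n + w) (u n + w) + EL (u n - w) (u n - w) = 2 * EL (u n) (u n) + 2 * EL w w"
    proof -
      have "EL (u n + w) (u n + w) + EL (u n - w) (u n - w)
          = (\<Sum>\<^sub>\<infinity>B\<in>balls. eB B (u n + w) (u n + w) + eB B (u n - w) (u n - w))"
        unfolding EL_def by (intro infsum_add[symmetric] DLD(2) mem)
      also have "\<dots> = (\<Sum>\<^sub>\<infinity>B\<in>balls. 2 * eB B (u n) (u n) + 2 * eB B w w)"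
        using l by (intro infsum_cong eB_para) auto
      also have "\<dots> = 2 * EL (u n) (u n) + 2 * EL w w"
        unfolding EL_def infsum_cmult_right'[symmetric]
        by (intro infsum_add summable_on_cmult_right DLD(2) u w)
      finally show ?thesis .
    qed
    moreover have "(\<Sum>B\<in>F. eB B (u n + w) (u n + w)) \<le> EL (u n + w) (u n + w)"
      by (rule sum_eB_le_EL[OF mem(2) F(1,2)])
    ultimately have "EL (u n - w) (u n - w) < e" using * e by linarith
    then show "dist (EL (u n - w) (u n - w)) 0 < e" using EL_nonneg[OF mem(1)] by simp
  qed
qed

text \<open>Normal contractions decrease each summand because the mean is the best constant
  approximation in \<open>L\<^sup>2(B)\<close>.\<close>

lemma normal_contraction:
  assumes u: "u \<in> l2_space m" and p: "p \<in> borel_measurable borel" "p 0 = 0" "\<And>a b. \<bar>p a - p b\<bar> \<le> \<bar>a - b\<bar>"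
  shows "(\<lambda>x. p (u x)) \<in> l2_space m"
    "B \<in> balls \<Longrightarrow> eB B (\<lambda>x. p (u x)) (\<lambda>x. p (u x)) \<le> eB B u u"
    "u \<in> DL \<Longrightarrow> (\<lambda>x. p (u x)) \<in> DL" "u \<in> DL \<Longrightarrow> EL (\<lambda>x. p (u x)) (\<lambda>x. p (u x)) \<le> EL u u"
proof -
  let ?v = "\<lambda>x. p (u x)"
  have meas: "?v \<in> borel_measurable m"
    by (rule measurable_compose[OF l2_spaceD(1)[OF u] p(1)])
  have le: "\<bar>p a\<bar> \<le> \<bar>a\<bar>" for a using p(3)[of a 0] p(2) by simp
  have "integrable m (\<lambda>x. (?v x)\<^sup>2)"
    using meas le l2_spaceD(2)[OF u]
    by (intro Bochner_Integration.integrable_bound[OF l2_spaceD(2)[OF u]]) (auto simp: abs_le_square_iff)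
  then show v: "?v \<in> l2_space m" using meas by (simp add: l2_space_def)
  show eB: "eB B ?v ?v \<le> eB B u u" if B: "B \<in> balls" for B
  proof -
    have "l2_norm m (dev B ?v) \<le> l2_norm m (restrict_to B ?v - p (avg B u) *\<^sub>R indicator B)"
      by (rule dev_norm_le_const[OF B v])
    also have "\<dots> \<le> l2_norm m (dev B u)"
    proof (rule l2_norm_mono)
      show "restrict_to B ?v - p (avg B u) *\<^sub>R indicator B \<in> l2_space m"
        using B v by (intro L.mem restrict_to_l2 indicator_l2)
      show "dev B u \<in> l2_space m" using B u by simp
      show "\<bar>(restrict_to B ?v - p (avg B u) *\<^sub>R indicator B) x\<bar> \<le> \<bar>dev B u x\<bar>" for x
        using p(3)[of "u x" "avg B u"] by (cases "x \<in> B") (simp_all add: restrict_to_def dev_def)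
    qed
    finally show ?thesis
      using B u v C_pos[OF B] by (simp add: eB_norm mult_left_mono power_mono)
  qed
  have key: "(\<Sum>B\<in>F. eB B ?v ?v) \<le> EL u u" if "u \<in> DL" "finite F" "F \<subseteq> balls" for F
  proof -
    have "(\<Sum>B\<in>F. eB B ?v ?v) \<le> (\<Sum>B\<in>F. eB B u u)" using eB that by (intro sum_mono) auto
    then show ?thesis using sum_eB_le_EL[OF that] by linarith
  qed
  show "?v \<in> DL" if "u \<in> DL"
    by (rule DL_I(1)[OF v key[OF that]])
  show "EL ?v ?v \<le> EL u u" if "u \<in> DL"
    by (rule DL_I(2)[OF v key[OF that]])
qed

end

section \<open>The hierarchical Laplacian as the operator of the form\<close>

lemma l2_dominated:
  assumes u: "\<And>n. u n \<in> l2_space m" and w: "w \<in> l2_space m" and g: "g \<in> l2_space m"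
    and le: "\<And>n x. \<bar>u n x - w x\<bar> \<le> \<bar>g x\<bar>" and lim: "AE x in m. (\<lambda>n. u n x) \<longlonglongrightarrow> w x"
  shows "(\<lambda>n. l2_norm m (u n - w)) \<longlonglongrightarrow> 0"
proof -
  note [measurable] = l2_spaceD(1)[OF u] l2_spaceD(1)[OF w] l2_spaceD(1)[OF g]
  have "(\<lambda>n. LINT x|m. (u n x - w x)\<^sup>2) \<longlonglongrightarrow> (LINT x|m. 0)"
  proof (rule integral_dominated_convergence[where w = "\<lambda>x. (g x)\<^sup>2"])
    show "AE x in m. (\<lambda>n. (u n x - w x)\<^sup>2) \<longlonglongrightarrow> 0"
    proof (rule AE_mp[OF lim], intro AE_I2 impI)
      fix x assume "(\<lambda>n. u n x) \<longlonglongrightarrow> w x"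
      then have "(\<lambda>n. (u n x - w x)\<^sup>2) \<longlonglongrightarrow> (w x - w x)\<^sup>2" by (intro tendsto_intros)
      then show "(\<lambda>n. (u n x - w x)\<^sup>2) \<longlonglongrightarrow> 0" by simp
    qed
    show "AE x in m. norm ((u n x - w x)\<^sup>2) \<le> (g x)\<^sup>2" for n
      using le by (simp add: abs_le_square_iff)
  qed (use l2_spaceD(2)[OF g] in auto)
  then have "(\<lambda>n. sqrt (LINT x|m. (u n x - w x)\<^sup>2)) \<longlonglongrightarrow> sqrt 0"
    by (intro tendsto_real_sqrt) simp
  then show ?thesis by (simp add: l2_norm_def l2_inner_def power2_eq_square)
qed

lemma l2_dense_mono: "l2_dense m S \<Longrightarrow> S \<subseteq> T \<Longrightarrow> T \<subseteq> l2_space m \<Longrightarrow> l2_dense m T"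
  unfolding l2_dense_iff by (meson subsetD)

section \<open>The Laplacian at a fixed scale\<close>

context hierarchical_space
begin

text \<open>By \<open>mu_ball_eq\<close> every centre gives the same value; it will be the norm
  bound for \<open>L\<close> at scale \<open>r\<close>.\<close>

definition mu0 :: "real \<Rightarrow> real" where
  "mu0 r = mu (ball origin r)"

lemma dev_zero_const:
  assumes "B \<in> balls" "\<And>y. y \<in> B \<Longrightarrow> u y = c"
  shows "dev B u = 0"
proof (rule ext)
  fix x show "dev B u x = 0 x"
    using avg_const[OF assms] assms(2)[of x] by (cases "x \<in> B") (simp_all add: dev_def)
qed

text \<open>A ball through \<open>x\<close> is either contained in \<open>ball x r\<close>, where
  \<open>\<phi>\<close> is constant, or strictly contains it.\<close>

lemma dev_zero_or_above:
  assumes r: "0 < r" and \<phi>: "\<phi> \<in> const_scale r" and B: "B \<in> balls" and x: "x \<in> B"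
  shows "B \<in> above (ball x r) \<or> dev B \<phi> = 0"
proof (cases "B \<subseteq> ball x r")
  case True
  have "\<phi> y = \<phi> x" if "y \<in> B" for y
    using const_scaleD(2)[OF \<phi>, of y x] that True by (auto simp: dist_commute)
  then show ?thesis using dev_zero_const[OF B, of \<phi> "\<phi> x"] by simp
next
  case False
  have "x \<in> ball x r \<inter> B" using r x by simp
  then have ne: "ball x r \<inter> B \<noteq> {}" by (rule ex_in_conv[THEN iffD1, OF exI])
  from balls_nested[OF ballsI[OF r] B ne] False have "ball x r \<subseteq> B" by (elim disjE) simp_all
  moreover have "ball x r \<noteq> B" using False by (intro notI) simp
  ultimately show ?thesis using B by (simp add: above_def psubset_eq)
qed

lemma dev_nonzero_above:
  assumes "0 < r" "\<phi> \<in> const_scale r" "B \<in> balls" "dev B \<phi> x \<noteq> 0"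
  shows "B \<in> above (ball x r)"
proof -
  have "x \<in> B" using assms(4) by (cases "x \<in> B") (simp_all add: dev_def)
  from dev_zero_or_above[OF assms(1-3) this] show ?thesis
    using assms(4) by (elim disjE) simp_all
qed

text \<open>A ball with nonzero deviation contains the whole \<open>r\<close>-ball of each of its
  points, so its indicator is itself constant at scale \<open>r\<close>.\<close>

lemma dev_local:
  assumes r: "0 < r" and \<phi>: "\<phi> \<in> const_scale r" and B: "B \<in> balls" and d: "dist x y < r"
  shows "dev B \<phi> x = dev B \<phi> y"
proof (cases "dev B \<phi> = 0")
  case False
  have *: "b \<in> B" if "a \<in> B" "dist a b < r" for a b
    using dev_zero_or_above[OF r \<phi> B that(1)] False that(2) by (auto simp: above_def)
  have "x \<in> B \<longleftrightarrow> y \<in> B" using *[of x y] *[of y x] d by (auto simp: dist_commute)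
  then show ?thesis using const_scaleD(2)[OF \<phi> d] by (simp add: dev_def indicator_def)
qed simp

text \<open>Partial sum of the series defining \<open>L \<phi>\<close>; the norm estimates are made
  on these sums, with constants that do not depend on \<open>F\<close>.\<close>

definition partial :: "'a set set \<Rightarrow> ('a \<Rightarrow> real) \<Rightarrow> 'a \<Rightarrow> real" where
  "partial F \<phi> = (\<lambda>x. \<Sum>B\<in>F. C B * dev B \<phi> x)"

lemma partial_l2:
  assumes "finite F" "F \<subseteq> balls" "\<phi> \<in> l2_space m"
  shows "partial F \<phi> \<in> l2_space m"
  unfolding partial_def using assms by (intro l2_inner_sum_left(1)[of F "\<lambda>B. dev B \<phi>" m \<phi>]) auto

lemma partial_ip:
  assumes "finite F" "F \<subseteq> balls" "\<phi> \<in> l2_space m" "v \<in> l2_space m"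
  shows "l2_inner m (partial F \<phi>) v = (\<Sum>B\<in>F. eB B \<phi> v)"
proof -
  have "l2_inner m (partial F \<phi>) v = (\<Sum>B\<in>F. C B * l2_inner m (dev B \<phi>) v)"
    unfolding partial_def using assms by (intro l2_inner_sum_left(2)) auto
  also have "\<dots> = (\<Sum>B\<in>F. eB B \<phi> v)"
    unfolding eB_def using assms by (intro sum.cong refl) (simp add: dev_ip subset_iff)
  finally show ?thesis .
qed

text \<open>Weighted Cauchy-Schwarz: at \<open>x\<close> only balls above \<open>ball x r\<close>
  contribute, and their total weight is at most \<open>mu0 r\<close> whatever \<open>x\<close>
  is.\<close>

lemma partial_sq_le:
  assumes r: "0 < r" and \<phi>: "\<phi> \<in> const_scale r" and F: "finite F" "F \<subseteq> balls"
  shows "(partial F \<phi> x)\<^sup>2 \<le> mu0 r * (\<Sum>B\<in>F. C B * (dev B \<phi> x)\<^sup>2)"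
proof -
  define G where "G = F \<inter> above (ball x r)"
  have G: "finite G" "G \<subseteq> F" "G \<subseteq> above (ball x r)" using F by (auto simp: G_def)
  have C: "0 \<le> C B" if "B \<in> F" for B using C_pos[of B] F that by (auto simp: subset_iff intro: less_imp_le)
  have zero: "dev B \<phi> x = 0" if "B \<in> F - G" for B
    using dev_nonzero_above[OF r \<phi>, of B x] F(2) that by (auto simp: G_def)
  have "partial F \<phi> x = (\<Sum>B\<in>G. C B * dev B \<phi> x)"
    unfolding partial_def using F(1) G(2) zero by (intro sum.mono_neutral_right) auto
  also have "\<dots> = (\<Sum>B\<in>G. sqrt (C B) * (sqrt (C B) * dev B \<phi> x))"
  proof (intro sum.cong refl)
    fix B assume "B \<in> G"
    then have "sqrt (C B) * sqrt (C B) = C B" using C G(2) by auto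
    then show "C B * dev B \<phi> x = sqrt (C B) * (sqrt (C B) * dev B \<phi> x)" by (simp flip: mult.assoc)
  qed
  finally have "(partial F \<phi> x)\<^sup>2 \<le> (\<Sum>B\<in>G. (sqrt (C B))\<^sup>2) * (\<Sum>B\<in>G. (sqrt (C B) * dev B \<phi> x)\<^sup>2)"
    using Cauchy_Schwarz_ineq_sum[of "\<lambda>B. sqrt (C B)" "\<lambda>B. sqrt (C B) * dev B \<phi> x" G] by simp
  also have "(\<Sum>B\<in>G. (sqrt (C B))\<^sup>2) = sum C G"
    using C G(2) by (intro sum.cong) auto
  also have "(\<Sum>B\<in>G. (sqrt (C B) * dev B \<phi> x)\<^sup>2) = (\<Sum>B\<in>G. C B * (dev B \<phi> x)\<^sup>2)"
    using C G(2) by (intro sum.cong) (auto simp: power_mult_distrib)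
  also have "\<dots> = (\<Sum>B\<in>F. C B * (dev B \<phi> x)\<^sup>2)"
    using F(1) G(2) zero by (intro sum.mono_neutral_left) auto
  also have "sum C G * (\<Sum>B\<in>F. C B * (dev B \<phi> x)\<^sup>2) \<le> mu0 r * (\<Sum>B\<in>F. C B * (dev B \<phi> x)\<^sup>2)"
  proof (intro mult_right_mono sum_nonneg)
    show "sum C G \<le> mu0 r"
      using sum_above_le_mu[OF ballsI[OF r] G(1,3)] mu_ball_eq[of x r origin] by (simp add: mu0_def)
  qed (use C in auto)
  finally show ?thesis .
qed

lemma mu0_nonneg [simp]: "0 \<le> mu0 r"
  by (simp add: mu0_def mu_nonneg)

lemma partial_norm_sq_le:
  assumes r: "0 < r" and \<phi>: "\<phi> \<in> const_scale r" and F: "finite F" "F \<subseteq> balls"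
  shows "(l2_norm m (partial F \<phi>))\<^sup>2 \<le> mu0 r * (\<Sum>B\<in>F. eB B \<phi> \<phi>)"
proof -
  note l = const_scaleD(1)[OF \<phi>]
  have p: "partial F \<phi> \<in> l2_space m" by (rule partial_l2[OF F l])
  have i: "integrable m (\<lambda>x. (dev B \<phi> x)\<^sup>2)" if "B \<in> F" for B
    using that F l by (intro l2_spaceD(2) dev_l2) auto
  have "(l2_norm m (partial F \<phi>))\<^sup>2 = (LINT x|m. (partial F \<phi> x)\<^sup>2)"
    using L.nrm_sq[OF p] by (simp add: l2_inner_def power2_eq_square)
  also have "\<dots> \<le> (LINT x|m. mu0 r * (\<Sum>B\<in>F. C B * (dev B \<phi> x)\<^sup>2))"
  proof (rule integral_mono)
    show "integrable m (\<lambda>x. (partial F \<phi> x)\<^sup>2)" by (rule l2_spaceD(2)[OF p])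
    show "integrable m (\<lambda>x. mu0 r * (\<Sum>B\<in>F. C B * (dev B \<phi> x)\<^sup>2))"
      using i by (intro integrable_mult_right Bochner_Integration.integrable_sum) auto
    show "(partial F \<phi> x)\<^sup>2 \<le> mu0 r * (\<Sum>B\<in>F. C B * (dev B \<phi> x)\<^sup>2)" for x
      by (rule partial_sq_le[OF assms])
  qed
  also have "\<dots> = mu0 r * (\<Sum>B\<in>F. C B * (LINT x|m. (dev B \<phi> x)\<^sup>2))"
    using i by (simp add: Bochner_Integration.integral_sum)
  also have "\<dots> = mu0 r * (\<Sum>B\<in>F. eB B \<phi> \<phi>)"
    by (simp add: eB_def l2_inner_def power2_eq_square)
  finally show ?thesis .
qed

text \<open>With \<open>X\<close> for the sum, \<open>X = <partial F \<phi>, \<phi>>\<close>;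
  Cauchy-Schwarz and the bound on \<open>partial F \<phi>\<close>, which itself contains
  \<open>X\<close>, give \<open>X^2 <= mu0 r * X * |\<phi>|^2\<close>, and \<open>X\<close>
  cancels.\<close>

lemma sum_eB_le_const:
  assumes r: "0 < r" and \<phi>: "\<phi> \<in> const_scale r" and F: "finite F" "F \<subseteq> balls"
  shows "(\<Sum>B\<in>F. eB B \<phi> \<phi>) \<le> mu0 r * (l2_norm m \<phi>)\<^sup>2"
proof -
  note l = const_scaleD(1)[OF \<phi>]
  define X where "X = (\<Sum>B\<in>F. eB B \<phi> \<phi>)"
  have X0: "0 \<le> X" unfolding X_def using F l by (intro sum_nonneg eB_nonneg) auto
  have p: "partial F \<phi> \<in> l2_space m" by (rule partial_l2[OF F l])
  have "X\<^sup>2 = (l2_inner m (partial F \<phi>) \<phi>)\<^sup>2"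
    using partial_ip[OF F l l] by (simp add: X_def)
  also have "\<dots> \<le> (l2_norm m (partial F \<phi>))\<^sup>2 * (l2_norm m \<phi>)\<^sup>2"
    using L.cauchy_schwarz_sq[OF p l] by (simp add: L.nrm_sq p l)
  also have "\<dots> \<le> (mu0 r * X) * (l2_norm m \<phi>)\<^sup>2"
    using partial_norm_sq_le[OF assms] by (intro mult_right_mono) (auto simp: X_def)
  finally have "X * X \<le> X * (mu0 r * (l2_norm m \<phi>)\<^sup>2)" by (simp add: power2_eq_square algebra_simps)
  then have "X \<le> mu0 r * (l2_norm m \<phi>)\<^sup>2"
    using X0 by (cases "X = 0") (auto simp: mult_le_cancel_left)
  then show ?thesis by (simp add: X_def)
qed

lemma const_scale_DL: "0 < r \<Longrightarrow> \<phi> \<in> const_scale r \<Longrightarrow> \<phi> \<in> DL"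
  using DL_I(1)[OF const_scaleD(1) sum_eB_le_const] by blast

lemma test_functions_DL:
  assumes "\<phi> \<in> test_functions"
  shows "\<phi> \<in> DL"
proof (rule test_functionsE[OF assms])
  show "\<phi> \<in> DL" if "0 < r" "\<phi> \<in> const_scale r" for r
    by (rule const_scale_DL[OF that])
qed

lemma DL_dense_closed: "dense_closed_form m DL EL"
proof
  show "symmetric_form m DL EL" by (rule EL_symmetric)
  show "l2_dense m DL"
    using test_functions_dense
  proof (rule l2_dense_mono)
    show "test_functions \<subseteq> DL" using test_functions_DL by blast
    show "DL \<subseteq> l2_space m" using DLD(1) by blast
  qed
  show "0 \<le> EL u u" if "u \<in> DL" for u by (rule EL_nonneg[OF that])
  show "closed_form m DL EL" by (rule EL_closed)
qed

text \<open>\<open>infsum\<close> converges along the filter of finite subsets, whereas the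
  \<open>L2\<close> limits are taken along sequences; one exhausting sequence serves all sums at
  once.\<close>

lemma balls_enumeration:
  "\<exists>F :: nat \<Rightarrow> 'a set set. (\<forall>n. finite (F n)) \<and> (\<forall>n. F n \<subseteq> balls) \<and> (\<forall>j k. j \<le> k \<longrightarrow> F j \<subseteq> F k) \<and>
    filterlim F (finite_subsets_at_top balls) sequentially"
proof -
  define G :: "nat \<Rightarrow> 'a set set" where "G n = from_nat_into balls ` {..<n}" for n
  have ne: "(balls :: 'a set set) \<noteq> {}" using B0_balls by blast
  have sub: "G n \<subseteq> (balls :: 'a set set)" for n
    unfolding G_def using from_nat_into[OF ne] by blast
  have fin: "finite (G n)" for n by (simp add: G_def)
  have lim: "filterlim G (finite_subsets_at_top (balls :: 'a set set)) sequentially"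
    unfolding filterlim_finite_subsets_at_top
  proof (intro allI impI)
    fix X :: "'a set set" assume X: "finite X \<and> X \<subseteq> balls"
    have "\<forall>\<^sub>F n in sequentially. \<forall>B\<in>X. B \<in> G n"
    proof (rule eventually_ball_finite)
      show "\<forall>B\<in>X. \<forall>\<^sub>F n in sequentially. B \<in> G n"
      proof
        fix B assume "B \<in> X"
        then have "B \<in> range (from_nat_into balls)"
          using X range_from_nat_into[OF ne countable_balls] by blast
        then obtain k where k: "B = from_nat_into balls k" by blast
        show "\<forall>\<^sub>F n in sequentially. B \<in> G n"
          using eventually_gt_at_top[of k] by (rule eventually_mono) (use k in \<open>simp add: G_def\<close>)
      qed
    qed (use X in simp)
    then show "\<forall>\<^sub>F n in sequentially. finite (G n) \<and>
        X \<subseteq> G n \<and> G n \<subseteq> balls"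
    proof (rule eventually_mono)
      fix n assume "\<forall>B\<in>X. B \<in> G n"
      then have "X \<subseteq> G n" by (intro subsetI) (erule bspec)
      then show "finite (G n) \<and>
        X \<subseteq> G n \<and> G n \<subseteq> balls"
        using sub[of n] fin[of n] by simp
    qed
  qed
  have mono: "G j \<subseteq> G k" if "j \<le> k" for j k
    unfolding G_def using that by (intro image_mono) simp
  show ?thesis
    using fin sub mono lim by (intro exI[of _ G] conjI allI impI)
qed

lemma avg_bound:
  assumes "B \<in> balls" "u \<in> l2_space m" "\<And>x. \<bar>u x\<bar> \<le> M"
  shows "\<bar>avg B u\<bar> \<le> M"
proof -
  have i: "integrable m (indicat_real B)"
    using balls_sets[OF assms(1)] balls_emeasure[OF assms(1)] by (rule integrable_real_indicator)
  have "\<bar>l2_inner m (indicator B) u\<bar> \<le> (LINT x|m. \<bar>indicator B x * u x\<bar>)"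
    unfolding l2_inner_def by (rule integral_abs_bound)
  also have "\<dots> \<le> (LINT x|m. M * indicator B x)"
  proof (rule integral_mono)
    show "integrable m (\<lambda>x. \<bar>indicator B x * u x\<bar>)"
      using l2_integrable_mult[OF indicator_l2[OF assms(1)] assms(2)] by simp
    show "integrable m (\<lambda>x. M * indicator B x)" using i by simp
    show "\<bar>indicator B x * u x\<bar> \<le> M * indicator B x" for x
      using assms(3)[of x] by (cases "x \<in> B") auto
  qed
  also have "\<dots> = M * measure m B" using balls_sets[OF assms(1)] by simp
  finally show ?thesis
    using balls_measure_pos[OF assms(1)] by (simp add: avg_def abs_divide pos_divide_le_eq)
qed

lemma laplacian_eq: "hier_laplacian m C \<phi> x = (\<Sum>\<^sub>\<infinity>B\<in>balls. C B * dev B \<phi> x)"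
  unfolding hier_laplacian_def
  by (rule infsum_cong_neutral) (auto simp: balls_at_def dev_def avg_eq_integral)

text \<open>Only balls above \<open>ball x r\<close> contribute, and since the mean is also bounded
  by \<open>M\<close>, their terms are at most \<open>2 * M * C B\<close>.\<close>

lemma laplacian_summable:
  assumes r: "0 < r" and \<phi>: "\<phi> \<in> const_scale r" and M: "\<And>x. \<bar>\<phi> x\<bar> \<le> M"
  shows "(\<lambda>B. C B * dev B \<phi> x) summable_on balls"
proof -
  have sub: "above (ball x r) \<subseteq> balls" by (auto simp: above_def)
  have M0: "0 \<le> M" using M[of x] by simp
  have "(\<lambda>B. norm (C B * dev B \<phi> x)) summable_on above (ball x r)"
  proof (rule summable_on_comparison_test)
    show "(\<lambda>B. C B * (2 * M)) summable_on above (ball x r)"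
      by (intro summable_on_cmult_left C_summable_above ballsI r)
    fix B assume "B \<in> above (ball x r)"
    then have B: "B \<in> balls" using sub by blast
    have "\<bar>dev B \<phi> x\<bar> \<le> 2 * M"
      using M[of x] avg_bound[OF B const_scaleD(1)[OF \<phi>] M] M0
      by (cases "x \<in> B") (auto simp: dev_def)
    then show "norm (C B * dev B \<phi> x) \<le> C B * (2 * M)"
      using C_pos[OF B] by (simp add: abs_mult mult_left_mono)
  qed simp
  then have "(\<lambda>B. C B * dev B \<phi> x) summable_on above (ball x r)"
    by (rule abs_summable_summable)
  moreover have "(\<lambda>B. C B * dev B \<phi> x) summable_on balls \<longleftrightarrow> (\<lambda>B. C B * dev B \<phi> x) summable_on above (ball x r)"
    using sub dev_nonzero_above[OF r \<phi>] by (intro summable_on_cong_neutral) auto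
  ultimately show ?thesis by simp
qed

text \<open>The partial sums along the exhausting sequence converge pointwise to
  \<open>L \<phi>\<close> and are Cauchy in \<open>L2\<close>; an almost everywhere convergent
  subsequence identifies the two limits. Norm bound and energy identity then pass to the
  limit.\<close>

lemma laplacian_props:
  assumes r: "0 < r" and \<phi>: "\<phi> \<in> const_scale r" and M: "\<And>x. \<bar>\<phi> x\<bar> \<le> M"
  shows "hier_laplacian m C \<phi> \<in> const_scale r"
    "l2_norm m (hier_laplacian m C \<phi>) \<le> mu0 r * l2_norm m \<phi>"
    "v \<in> DL \<Longrightarrow> EL \<phi> v = l2_inner m (hier_laplacian m C \<phi>) v"
proof -
  note l = const_scaleD(1)[OF \<phi>]
  have D: "\<phi> \<in> DL" by (rule const_scale_DL[OF r \<phi>])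
  let ?L = "hier_laplacian m C \<phi>"
  obtain F :: "nat \<Rightarrow> 'a set set" where F': "(\<forall>n. finite (F n)) \<and> (\<forall>n. F n \<subseteq> balls) \<and> (\<forall>j k. j \<le> k \<longrightarrow> F j \<subseteq> F k) \<and>
      filterlim F (finite_subsets_at_top balls) sequentially"
    using balls_enumeration by auto
  have F: "finite (F n)" "F n \<subseteq> balls" "j \<le> k \<Longrightarrow> F j \<subseteq> F k"
    "filterlim F (finite_subsets_at_top balls) sequentially" for n j k
    using F' by simp_all
  have conv: "(\<lambda>n. sum f (F n)) \<longlonglongrightarrow> infsum f balls" if "f summable_on balls" for f :: "'a set \<Rightarrow> real"
    using filterlim_compose[OF has_sum_infsum[OF that, unfolded has_sum_def] F(4)] .
  have loc: "?L x = ?L y" if "dist x y < r" for x y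
    unfolding laplacian_eq by (intro infsum_cong) (simp add: dev_local[OF r \<phi> _ that])
  have meas: "?L \<in> borel_measurable m" by (rule locally_constant_measurable[OF r loc])
  define s where "s n = partial (F n) \<phi>" for n
  have s: "s n \<in> l2_space m" for n unfolding s_def by (rule partial_l2[OF F(1,2) l])
  have pointwise: "(\<lambda>n. s n x) \<longlonglongrightarrow> ?L x" for x
    unfolding s_def partial_def laplacian_eq by (rule conv[OF laplacian_summable[OF assms]])
  define X where "X n = (\<Sum>B\<in>F n. eB B \<phi> \<phi>)" for n
  \<comment> \<open>The increment is itself a partial sum, over \<open>F j - F k\<close>, so its
    norm is controlled by the increment of the convergent energy sums \<open>X\<close>.\<close>
  have diff: "(l2_norm m (s j - s k))\<^sup>2 \<le> mu0 r * (X j - X k)" if "k \<le> j" for j k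
  proof -
    have fin: "finite (F j - F k)" "F j - F k \<subseteq> balls" using F(1,2) by auto
    have "s j - s k = partial (F j - F k) \<phi>"
      by (rule ext) (simp add: s_def partial_def sum_diff[OF F(1) F(3)[OF that]])
    moreover have "(\<Sum>B\<in>F j - F k. eB B \<phi> \<phi>) = X j - X k"
      by (simp add: X_def sum_diff[OF F(1) F(3)[OF that]])
    ultimately show ?thesis using partial_norm_sq_le[OF r \<phi> fin] by simp
  qed
  have "convergent X"
    unfolding X_def using conv[OF DLD(2)[OF D]] by (rule convergentI)
  then have "Cauchy X" by (rule convergent_Cauchy)
  have cau: "L.cauchy_seq s"
    unfolding L.cauchy_seq_def
  proof (intro allI impI)
    fix e :: real assume e: "0 < e"
    \<comment> \<open>The added 1 permits division whatever the value of
      \<open>mu0 r\<close>.\<close>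
    have p: "0 < mu0 r + 1" using mu0_nonneg[of r] by linarith
    then have "0 < e\<^sup>2 / (mu0 r + 1)" using e by simp
    then have "\<exists>N. \<forall>j\<ge>N. \<forall>k\<ge>N. norm (X j - X k) < e\<^sup>2 / (mu0 r + 1)"
      by (rule CauchyD[OF \<open>Cauchy X\<close>])
    then obtain N where N: "\<forall>j\<ge>N. \<forall>k\<ge>N. norm (X j - X k) < e\<^sup>2 / (mu0 r + 1)"
      by (elim exE) (rule that)
    have lt: "l2_norm m (s j - s k) < e" if jk: "k \<le> j" "N \<le> k" for j k
    proof -
      have "X j - X k \<le> norm (X j - X k)" by simp
      also have "\<dots> < e\<^sup>2 / (mu0 r + 1)" using N jk by simp
      finally have *: "X j - X k < e\<^sup>2 / (mu0 r + 1)" .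
      have "(l2_norm m (s j - s k))\<^sup>2 \<le> mu0 r * (e\<^sup>2 / (mu0 r + 1))"
        using diff[OF jk(1)] mult_left_mono[OF less_imp_le[OF *] mu0_nonneg[of r]] by linarith
      also have "\<dots> < e\<^sup>2"
        using e p by (simp add: field_simps)
      finally show ?thesis by (rule power2_less_imp_less) (use e in simp)
    qed
    have "l2_norm m (s j - s k) < e" if jk: "N \<le> j" "N \<le> k" for j k
    proof (cases "k \<le> j")
      case True
      then show ?thesis using lt jk by blast
    next
      case False
      then have "l2_norm m (s k - s j) < e" using lt jk by simp
      then show ?thesis using L.nrm_minus_commute[OF s s] by simp
    qed
    then show "\<exists>N. \<forall>j\<ge>N. \<forall>k\<ge>N. l2_norm m (s j - s k) < e" by blast
  qed
  obtain w where w: "w \<in> l2_space m" "(\<lambda>n. l2_norm m (s n - w)) \<longlonglongrightarrow> 0"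
    using L.complete[OF s cau] by (elim bexE) (rule that)
  obtain q where q: "strict_mono q" "AE x in m. (\<lambda>n. s (q n) x) \<longlonglongrightarrow> w x"
    by (rule l2_subseq_AE[OF s w])
  have ae: "AE x in m. w x = ?L x"
    using q(2)
  proof (rule AE_mp, intro AE_I2 impI)
    fix x assume "(\<lambda>n. s (q n) x) \<longlonglongrightarrow> w x"
    moreover have "(\<lambda>n. s (q n) x) \<longlonglongrightarrow> ?L x"
      using LIMSEQ_subseq_LIMSEQ[OF pointwise q(1)] by (simp add: o_def)
    ultimately show "w x = ?L x" by (rule LIMSEQ_unique)
  qed
  have Ll: "?L \<in> l2_space m" by (rule l2_space_AE[OF w(1) meas ae])
  then show "?L \<in> const_scale r" by (rule const_scaleI[OF _ loc])
  have wL: "l2_inner m w v = l2_inner m ?L v" if "v \<in> l2_space m" for v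
    using l2_AE_eq_iff[OF w(1) Ll] ae that by blast
  have lim: "(\<lambda>n. \<Sum>B\<in>F n. eB B \<phi> v) \<longlonglongrightarrow> l2_inner m ?L v" if v: "v \<in> l2_space m" for v
    using L.tendsto_ip_left[OF s w v] unfolding s_def partial_ip[OF F(1,2) l v] wL[OF v] .
  show "EL \<phi> v = l2_inner m ?L v" if v: "v \<in> DL"
    using LIMSEQ_unique[OF conv[OF eB_summable[OF D v]] lim[OF DLD(1)[OF v]]] by (simp add: EL_def)
  have "(l2_norm m (s n))\<^sup>2 \<le> (mu0 r * l2_norm m \<phi>)\<^sup>2" for n
  proof -
    have "(l2_norm m (s n))\<^sup>2 \<le> mu0 r * X n"
      unfolding s_def X_def by (rule partial_norm_sq_le[OF r \<phi> F(1,2)])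
    also have "\<dots> \<le> mu0 r * (mu0 r * (l2_norm m \<phi>)\<^sup>2)"
      unfolding X_def by (intro mult_left_mono sum_eB_le_const[OF r \<phi> F(1,2)] mu0_nonneg)
    finally show ?thesis by (simp add: power_mult_distrib power2_eq_square ac_simps)
  qed
  then have "l2_norm m (s n) \<le> mu0 r * l2_norm m \<phi>" for n
    by (rule power2_le_imp_le) (use l in simp)
  then have "l2_norm m w \<le> mu0 r * l2_norm m \<phi>"
    by (intro LIMSEQ_le_const2[OF L.tendsto_nrm[OF s w]]) blast
  moreover have "l2_norm m w = l2_norm m ?L"
    using wL[OF w(1)] wL[OF Ll] L.ip_commute[OF w(1) Ll] by (simp add: l2_norm_def)
  ultimately show "l2_norm m ?L \<le> mu0 r * l2_norm m \<phi>" by simp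
qed

lemma laplacian_test:
  assumes "\<phi> \<in> test_functions"
  shows "hier_laplacian m C \<phi> \<in> l2_space m" "v \<in> DL \<Longrightarrow> EL \<phi> v = l2_inner m (hier_laplacian m C \<phi>) v"
    "(\<lambda>B. C B * dev B \<phi> x) summable_on balls"
proof -
  obtain r n M where r: "0 < r" "\<phi> \<in> const_scale r" "\<And>x. x \<notin> B0 n \<Longrightarrow> \<phi> x = 0" "\<And>x. \<bar>\<phi> x\<bar> \<le> M"
    by (rule test_functionsE[OF assms]) (rule that)
  show "hier_laplacian m C \<phi> \<in> l2_space m"
    by (rule const_scaleD(1)[OF laplacian_props(1)[OF r(1,2,4)]])
  show "v \<in> DL \<Longrightarrow> EL \<phi> v = l2_inner m (hier_laplacian m C \<phi>) v"
    by (rule laplacian_props(3)[OF r(1,2,4)])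
  show "(\<lambda>B. C B * dev B \<phi> x) summable_on balls"
    by (rule laplacian_summable[OF r(1,2,4)])
qed

lemma laplacian_linear:
  assumes "\<phi> \<in> test_functions" "\<psi> \<in> test_functions"
  shows "hier_laplacian m C (\<phi> + \<psi>) = hier_laplacian m C \<phi> + hier_laplacian m C \<psi>"
    "hier_laplacian m C (c *\<^sub>R \<phi>) = c *\<^sub>R hier_laplacian m C \<phi>"
proof -
  note l = test_functions_l2[OF assms(1)] test_functions_l2[OF assms(2)]
  show "hier_laplacian m C (\<phi> + \<psi>) = hier_laplacian m C \<phi> + hier_laplacian m C \<psi>"
  proof (rule ext)
    fix x
    have "hier_laplacian m C (\<phi> + \<psi>) x = (\<Sum>\<^sub>\<infinity>B\<in>balls. C B * dev B \<phi> x + C B * dev B \<psi> x)"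
      unfolding laplacian_eq by (intro infsum_cong) (simp add: dev_linear[OF _ l] distrib_left)
    also have "\<dots> = hier_laplacian m C \<phi> x + hier_laplacian m C \<psi> x"
      unfolding laplacian_eq by (intro infsum_add laplacian_test(3) assms)
    finally show "hier_laplacian m C (\<phi> + \<psi>) x = (hier_laplacian m C \<phi> + hier_laplacian m C \<psi>) x" by simp
  qed
  show "hier_laplacian m C (c *\<^sub>R \<phi>) = c *\<^sub>R hier_laplacian m C \<phi>"
  proof (rule ext)
    fix x
    have "hier_laplacian m C (c *\<^sub>R \<phi>) x = (\<Sum>\<^sub>\<infinity>B\<in>balls. c * (C B * dev B \<phi> x))"
      unfolding laplacian_eq by (intro infsum_cong) (simp add: dev_linear(3)[OF _ l])
    then show "hier_laplacian m C (c *\<^sub>R \<phi>) x = (c *\<^sub>R hier_laplacian m C \<phi>) x"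
      unfolding laplacian_eq by (simp add: infsum_cmult_right')
  qed
qed

section \<open>Averaging at a fixed scale\<close>

definition average :: "real \<Rightarrow> ('a \<Rightarrow> real) \<Rightarrow> 'a \<Rightarrow> real" where
  "average r u x = avg (ball x r) u"

text \<open>\<^term>\<open>average r\<close> is the orthogonal projection onto \<^term>\<open>const_scale r\<close>: the projection exists
  abstractly, and testing it against indicators of balls identifies its values.\<close>

lemma average_props:
  assumes r: "0 < r" and u: "u \<in> l2_space m"
  shows "average r u \<in> const_scale r"
    "\<psi> \<in> const_scale r \<Longrightarrow> l2_inner m (average r u) \<psi> = l2_inner m u \<psi>"
    "l2_norm m (average r u) \<le> l2_norm m u"
proof -
  have loc: "average r u x = average r u y" if "dist x y < r" for x y
    using ball_eq[of y x r] that by (simp add: average_def)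
  have meas: "average r u \<in> borel_measurable m" by (rule locally_constant_measurable[OF r loc])
  have sub: "const_scale r \<subseteq> l2_space m" using const_scaleD(1) by blast
  have "\<exists>p q. p \<in> l2_space m \<and> (\<forall>n. q n \<in> const_scale r) \<and> (\<lambda>n. l2_norm m (q n - p)) \<longlonglongrightarrow> 0
      \<and> (\<forall>w\<in>const_scale r. l2_inner m p w = l2_inner m u w)"
  proof (rule L.riesz_subspace[OF const_scale_subspace sub, of "l2_inner m u" "l2_norm m u"], goal_cases)
    case (4 p q)
    then show ?case by (intro exI[of _ p] exI[of _ q] conjI allI ballI)
  qed (use u in \<open>auto simp: L.ip_simps intro: L.cauchy_schwarz\<close>)
  then obtain p q where p: "p \<in> l2_space m" and q: "\<And>n. q n \<in> const_scale r"
    and lim: "(\<lambda>n. l2_norm m (q n - p)) \<longlonglongrightarrow> 0"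
    and pw: "\<And>w. w \<in> const_scale r \<Longrightarrow> l2_inner m p w = l2_inner m u w" by blast
  have ql: "q n \<in> l2_space m" for n using q sub by blast
  have pointwise: "(\<lambda>n. q n x) \<longlonglongrightarrow> average r u x" for x
  proof -
    let ?B = "ball x r"
    have B: "?B \<in> balls" using r by simp
    have i: "indicat_real ?B \<in> l2_space m" "indicat_real ?B \<in> const_scale r"
      using indicator_l2[OF B] indicator_ball_const_scale[OF r order_refl] by auto
    have "avg ?B (q n) = q n x" for n
    proof (rule avg_const[OF B])
      show "q n y = q n x" if "y \<in> ?B" for y
        by (rule const_scaleD(2)[OF q]) (use that in \<open>simp add: dist_commute\<close>)
    qed
    moreover have "(\<lambda>n. avg ?B (q n)) \<longlonglongrightarrow> l2_inner m p (indicator ?B) / measure m ?B"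
    proof -
      have "(\<lambda>n. l2_inner m (q n) (indicator ?B)) \<longlonglongrightarrow> l2_inner m p (indicator ?B)"
        by (rule L.tendsto_ip_left[OF ql p lim i(1)])
      then have "(\<lambda>n. l2_inner m (indicator ?B) (q n)) \<longlonglongrightarrow> l2_inner m p (indicator ?B)"
        using L.ip_commute[OF ql i(1)] by simp
      then show ?thesis unfolding avg_def using balls_measure_pos[OF B] by (intro tendsto_divide tendsto_const) auto
    qed
    moreover have "l2_inner m p (indicator ?B) = l2_inner m (indicator ?B) u"
      using pw[OF i(2)] L.ip_commute[OF u i(1)] by simp
    ultimately show ?thesis by (simp add: average_def avg_def)
  qed
  obtain k where k: "strict_mono k" "AE x in m. (\<lambda>n. q (k n) x) \<longlonglongrightarrow> p x"
    by (rule l2_subseq_AE[OF ql p lim])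
  have ae: "AE x in m. p x = average r u x"
    using k(2)
  proof (rule AE_mp, intro AE_I2 impI)
    fix x assume "(\<lambda>n. q (k n) x) \<longlonglongrightarrow> p x"
    moreover have "(\<lambda>n. q (k n) x) \<longlonglongrightarrow> average r u x"
      using LIMSEQ_subseq_LIMSEQ[OF pointwise k(1)] by (simp add: o_def)
    ultimately show "p x = average r u x" by (rule LIMSEQ_unique)
  qed
  have l: "average r u \<in> l2_space m" by (rule l2_space_AE[OF p meas ae])
  then show c: "average r u \<in> const_scale r" by (rule const_scaleI[OF _ loc])
  show ip: "l2_inner m (average r u) \<psi> = l2_inner m u \<psi>" if "\<psi> \<in> const_scale r" for \<psi>
  proof -
    have "l2_inner m p \<psi> = l2_inner m (average r u) \<psi>"
      using l2_AE_eq_iff[OF p l] ae const_scaleD(1)[OF that] by blast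
    then show ?thesis using pw[OF that] by simp
  qed
  have "(l2_norm m (average r u))\<^sup>2 = l2_inner m u (average r u)"
    using ip[OF c] L.nrm_sq[OF l] by simp
  also have "\<dots> \<le> l2_norm m u * l2_norm m (average r u)"
    using L.cauchy_schwarz[OF u l] by simp
  finally have "l2_norm m (average r u) * l2_norm m (average r u) \<le> l2_norm m u * l2_norm m (average r u)"
    by (simp add: power2_eq_square)
  then show "l2_norm m (average r u) \<le> l2_norm m u"
    using L.nrm_ge_0[OF l] L.nrm_ge_0[OF u] by (cases "l2_norm m (average r u) = 0") (auto simp: mult_le_cancel_right)
qed

lemma restrict_const_scale:
  assumes r: "0 < r" "r \<le> real (Suc n)" and u: "u \<in> const_scale r"
  shows "restrict_to (B0 n) u \<in> const_scale r" "restrict_to (B0 n) u \<in> test_functions"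
proof -
  have i: "indicat_real (B0 n) \<in> const_scale r"
    unfolding B0_def by (rule indicator_ball_const_scale) (use r in auto)
  show c: "restrict_to (B0 n) u \<in> const_scale r"
  proof (rule const_scaleI)
    show "restrict_to (B0 n) u \<in> l2_space m" using const_scaleD(1)[OF u] by simp
    show "restrict_to (B0 n) u x = restrict_to (B0 n) u y" if "dist x y < r" for x y
      using const_scaleD(2)[OF u that] const_scaleD(2)[OF i that] by (simp add: restrict_to_def)
  qed
  show "restrict_to (B0 n) u \<in> test_functions"
    by (rule test_functionsI[OF r(1) c, of n]) (simp add: restrict_to_def)
qed

lemma restrict_B0_tendsto_pointwise: "(\<lambda>n. restrict_to (B0 n) u x) \<longlonglongrightarrow> u x"
proof (rule tendsto_eventually)
  obtain N where "x \<in> B0 N" using B0_UN by blast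
  then have "x \<in> B0 n" if "N \<le> n" for n using B0_mono[OF that] by blast
  then show "\<forall>\<^sub>F n in sequentially. restrict_to (B0 n) u x = u x"
    by (intro eventually_sequentiallyI[of N]) (simp add: restrict_to_def)
qed

lemma restrict_B0_tendsto:
  assumes "u \<in> l2_space m"
  shows "(\<lambda>n. l2_norm m (restrict_to (B0 n) u - u)) \<longlonglongrightarrow> 0"
proof (rule l2_dominated[where g = u])
  show "restrict_to (B0 n) u \<in> l2_space m" for n using assms by simp
  show "\<bar>restrict_to (B0 n) u x - u x\<bar> \<le> \<bar>u x\<bar>" for n x
    by (simp add: restrict_to_def indicator_def)
  show "AE x in m. (\<lambda>n. restrict_to (B0 n) u x) \<longlonglongrightarrow> u x"
    by (intro AE_I2 restrict_B0_tendsto_pointwise)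
qed (use assms in simp_all)

text \<open>The range of \<open>L + 1\<close> on test functions is dense: if \<open>h\<close> is orthogonal to it, test with
  \<open>1\<^sub>B P\<^sub>r h\<close> for large balls \<open>B\<close>, where \<open>L\<close> is bounded at the scale \<open>r\<close>.\<close>

lemma laplacian_range_orth:
  assumes h: "h \<in> l2_space m"
    and orth: "\<And>\<phi>. \<phi> \<in> test_functions \<Longrightarrow> l2_inner m h (\<phi> + hier_laplacian m C \<phi>) = 0"
  shows "l2_norm m h = 0"
proof (rule orth_balls_null[OF h])
  fix B :: "'a set" assume "B \<in> balls"
  then obtain z r where r: "0 < r" and B: "B = ball z r" by (auto simp: balls_def)
  define p where "p = average r h"
  have p: "p \<in> const_scale r" "p \<in> l2_space m"
    using average_props(1)[OF r h] const_scaleD(1) by (auto simp: p_def)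
  have ph: "l2_inner m p \<psi> = l2_inner m h \<psi>" if "\<psi> \<in> const_scale r" for \<psi>
    unfolding p_def by (rule average_props(2)[OF r h that])
  \<comment> \<open>The shift by \<open>N\<close> makes the radius of each cut-off ball at least
    \<open>r\<close>, so that cutting off preserves constancy at scale \<open>r\<close>.\<close>
  obtain N where "r \<le> real N" using real_arch_simple by blast
  then have N: "r \<le> real (Suc N)" by simp
  define \<phi> where "\<phi> n = restrict_to (B0 (n + N)) p" for n
  have rn: "r \<le> real (Suc (n + N))" for n using N by simp
  note \<phi> = restrict_const_scale[OF r rn p(1), folded \<phi>_def]
  have \<phi>l: "\<phi> n \<in> l2_space m" for n using \<phi>(1) const_scaleD(1) by blast
  have lim: "(\<lambda>n. l2_norm m (\<phi> n - p)) \<longlonglongrightarrow> 0"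
    unfolding \<phi>_def using LIMSEQ_ignore_initial_segment[OF restrict_B0_tendsto[OF p(2)], of N] .
  \<comment> \<open>Orthogonality gives \<open>|\<phi> n|^2 = - <p, L (\<phi> n)>\<close>. Writing
    \<open>p = \<phi> n - (\<phi> n - p)\<close> and dropping the nonnegative energy of
    \<open>\<phi> n\<close> leaves a term bounded by \<open>|\<phi> n - p|\<close> times a
    constant.\<close>
  have "(l2_norm m (\<phi> n))\<^sup>2 \<le> l2_norm m (\<phi> n - p) * (mu0 r * l2_norm m p)" for n
  proof -
    let ?L = "hier_laplacian m C (\<phi> n)"
    obtain M where M: "\<And>x. \<bar>\<phi> n x\<bar> \<le> M"
      by (rule test_functionsE[OF \<phi>(2)[of n]]) (rule that)
    note Lp = laplacian_props[OF r \<phi>(1) M]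
    have Ll: "?L \<in> l2_space m" using Lp(1) const_scaleD(1) by blast
    have "(l2_norm m (\<phi> n))\<^sup>2 = l2_inner m p (\<phi> n)"
    proof -
      have "l2_inner m (\<phi> n) (\<phi> n) = l2_inner m p (\<phi> n)"
        unfolding l2_inner_def \<phi>_def restrict_to_def
        by (intro Bochner_Integration.integral_cong) (auto simp: indicator_def)
      then show ?thesis by (simp add: L.nrm_sq[OF \<phi>l])
    qed
    also have "\<dots> = l2_inner m h (\<phi> n)" by (rule ph[OF \<phi>(1)])
    also have "\<dots> = - l2_inner m h ?L"
      using orth[OF \<phi>(2)[of n]] L.ip_add_right[OF \<phi>l Ll h] by simp
    \<comment> \<open>\<open>L (\<phi> n)\<close> is again constant at scale \<open>r\<close>, so
      \<open>h\<close> may be replaced by its average \<open>p\<close>.\<close>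
    also have "\<dots> = - l2_inner m p ?L" using ph[OF Lp(1)] by simp
    also have "\<dots> = l2_inner m (\<phi> n - p) ?L - EL (\<phi> n) (\<phi> n)"
      using Lp(3)[OF test_functions_DL[OF \<phi>(2)[of n]]] L.ip_commute[OF \<phi>l Ll] L.ip_diff_left[OF \<phi>l p(2) Ll] by simp
    also have "\<dots> \<le> l2_inner m (\<phi> n - p) ?L"
      using EL_nonneg[OF test_functions_DL[OF \<phi>(2)[of n]]] by simp
    also have "\<dots> \<le> l2_norm m (\<phi> n - p) * l2_norm m ?L"
      using L.cauchy_schwarz[of "\<phi> n - p" ?L] \<phi>l p(2) Ll by simp
    also have "\<dots> \<le> l2_norm m (\<phi> n - p) * (mu0 r * l2_norm m p)"
    proof (intro mult_left_mono)
      have "l2_norm m (\<phi> n) \<le> l2_norm m p"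
        unfolding \<phi>_def by (rule restrict_to_norm_le[OF p(2) B0_balls])
      then show "l2_norm m ?L \<le> mu0 r * l2_norm m p"
        using Lp(2) mult_left_mono[OF _ mu0_nonneg[of r]] by (meson order_trans)
    qed (use \<phi>l p(2) in simp)
    finally show ?thesis .
  qed
  moreover have "(\<lambda>n. (l2_norm m (\<phi> n))\<^sup>2) \<longlonglongrightarrow> (l2_norm m p)\<^sup>2"
    by (intro tendsto_power L.tendsto_nrm[OF \<phi>l p(2) lim])
  moreover have "(\<lambda>n. l2_norm m (\<phi> n - p) * (mu0 r * l2_norm m p)) \<longlonglongrightarrow> 0"
    using tendsto_mult_right[OF lim] by simp
  ultimately have "(l2_norm m p)\<^sup>2 \<le> 0"
    by (intro LIMSEQ_le) blast+
  then have "l2_norm m p = 0" by simp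
  moreover have i: "indicat_real B \<in> l2_space m" "indicat_real B \<in> const_scale r"
    using indicator_l2[of B] indicator_ball_const_scale[OF r order_refl, of z] r B by auto
  ultimately have "l2_inner m p (indicator B) = 0"
    using L.ip_eq_0_if_nrm_eq_0(1)[OF p(2)] by blast
  then show "l2_inner m h (indicator B) = 0" using ph[OF i(2)] by simp
qed

lemma laplacian_range_dense:
  assumes k: "k \<in> l2_space m"
  shows "\<exists>\<phi>. (\<forall>n. \<phi> n \<in> test_functions) \<and> (\<lambda>n. l2_norm m (\<phi> n + hier_laplacian m C (\<phi> n) - k)) \<longlonglongrightarrow> 0"
proof -
  let ?L = "hier_laplacian m C"
  define U where "U = (\<lambda>\<phi>. \<phi> + ?L \<phi>) ` test_functions"
  have sub: "subspace U"
    unfolding subspace_def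
  proof (intro conjI ballI allI)
    have z: "(0 :: 'a \<Rightarrow> real) \<in> test_functions" by (rule subspace_0[OF test_functions_subspace])
    have "?L 0 = 0" using laplacian_linear(2)[OF z z, of 0] by simp
    then show "0 \<in> U" unfolding U_def using z by (intro image_eqI[of _ _ 0]) auto
    fix x assume "x \<in> U"
    then obtain \<phi> where \<phi>: "\<phi> \<in> test_functions" "x = \<phi> + ?L \<phi>" by (auto simp: U_def)
    show "c *\<^sub>R x \<in> U" for c
      unfolding U_def using subspace_scale[OF test_functions_subspace \<phi>(1)]
      by (intro image_eqI[of _ _ "c *\<^sub>R \<phi>"]) (simp_all add: \<phi>(2) laplacian_linear(2)[OF \<phi>(1) \<phi>(1)] scaleR_add_right)
    fix y assume "y \<in> U"
    then obtain \<psi> where \<psi>: "\<psi> \<in> test_functions" "y = \<psi> + ?L \<psi>" by (auto simp: U_def)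
    show "x + y \<in> U"
      unfolding U_def using subspace_add[OF test_functions_subspace \<phi>(1) \<psi>(1)]
      by (intro image_eqI[of _ _ "\<phi> + \<psi>"]) (simp_all add: \<phi>(2) \<psi>(2) laplacian_linear(1)[OF \<phi>(1) \<psi>(1)])
  qed
  have l2: "U \<subseteq> l2_space m"
    unfolding U_def using test_functions_l2 laplacian_test(1) by auto
  have null: "l2_norm m h = 0" if h: "h \<in> l2_space m" and orth: "\<And>u. u \<in> U \<Longrightarrow> l2_inner m h u = 0" for h
    by (rule laplacian_range_orth[OF h orth]) (simp add: U_def)
  have "\<exists>u. (\<forall>n. u n \<in> U) \<and> (\<lambda>n. l2_norm m (u n - k)) \<longlonglongrightarrow> 0"
    using sub l2 null k by (rule L.dense_if_orth_null)
  then obtain u where u: "\<forall>n. u n \<in> U" "(\<lambda>n. l2_norm m (u n - k)) \<longlonglongrightarrow> 0"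
    by (elim exE conjE) (rule that)
  have "\<forall>n. \<exists>\<phi>. \<phi> \<in> test_functions \<and> u n = \<phi> + ?L \<phi>" using u(1) by (auto simp: U_def)
  then have "\<exists>\<phi>. \<forall>n. \<phi> n \<in> test_functions \<and> u n = \<phi> n + ?L (\<phi> n)" by (rule choice)
  then obtain \<phi> where \<phi>: "\<forall>n. \<phi> n \<in> test_functions \<and> u n = \<phi> n + ?L (\<phi> n)" by (elim exE) (rule that)
  have "(\<lambda>n. l2_norm m (\<phi> n + ?L (\<phi> n) - k)) = (\<lambda>n. l2_norm m (u n - k))"
    using \<phi> by simp
  then show ?thesis using \<phi> u(2) by (intro exI[of _ \<phi>]) simp
qed

lemma op_closure_iff:
  "(f, g) \<in> op_closure m A \<longleftrightarrow> f \<in> l2_space m \<and> g \<in> l2_space m \<and>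
    (\<forall>e>0. \<exists>u v. (u, v) \<in> A \<and> u \<in> l2_space m \<and> v \<in> l2_space m \<and> l2_norm m (f - u) < e \<and> l2_norm m (g - v) < e)"
  unfolding op_closure_def fun_diff_def by (auto simp: Bex_def)

section \<open>The form operator is the closure of the Laplacian\<close>

interpretation EF: dense_closed_form m DL EL
  by (rule DL_dense_closed)

text \<open>The graph of \<open>L\<close> on test functions lies in the closed graph
  \<open>EF.form_op\<close>. Conversely, for \<open>(f, g)\<close> in that graph, test functions
  with \<open>\<phi> n + L (\<phi> n)\<close> tending to \<open>f + g\<close> already tend to
  \<open>f\<close>, because adding 1 to a nonnegative operator yields one that does not decrease
  norms.\<close>

theorem form_op_EL: "EF.form_op = laplacian_op m C"
proof (intro equalityI subrelI)
  let ?L = "hier_laplacian m C"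
  interpret S: nonneg_selfadjoint_op m EF.form_op
    by unfold_locales (rule EF.form_op_selfadjoint)
  have graph: "(\<phi>, ?L \<phi>) \<in> EF.form_op" if "\<phi> \<in> test_functions" for \<phi>
    using test_functions_DL[OF that] laplacian_test[OF that] by (simp add: EF.form_op_def)
  {
    fix f g assume "(f, g) \<in> laplacian_op m C"
    then have fg: "f \<in> l2_space m" "g \<in> l2_space m"
      and ap: "\<And>e. 0 < e \<Longrightarrow> \<exists>u v. (u, v) \<in> {(f, ?L f) |f. f \<in> test_functions} \<and> u \<in> l2_space m \<and> v \<in> l2_space m
        \<and> l2_norm m (f - u) < e \<and> l2_norm m (g - v) < e"
      unfolding laplacian_op_def op_closure_iff by blast+
    have "\<forall>n. \<exists>\<phi>. \<phi> \<in> test_functions \<and> l2_norm m (f - \<phi>) < inverse (real (Suc n))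
        \<and> l2_norm m (g - ?L \<phi>) < inverse (real (Suc n))"
    proof
      fix n
      show "\<exists>\<phi>. \<phi> \<in> test_functions \<and> l2_norm m (f - \<phi>) < inverse (real (Suc n))
        \<and> l2_norm m (g - ?L \<phi>) < inverse (real (Suc n))"
        using ap[of "inverse (real (Suc n))"] by fastforce
    qed
    then have "\<exists>\<phi>. \<forall>n. \<phi> n \<in> test_functions \<and> l2_norm m (f - \<phi> n) < inverse (real (Suc n))
        \<and> l2_norm m (g - ?L (\<phi> n)) < inverse (real (Suc n))" by (rule choice)
    then obtain \<phi> where \<phi>: "\<forall>n. \<phi> n \<in> test_functions \<and> l2_norm m (f - \<phi> n) < inverse (real (Suc n))
        \<and> l2_norm m (g - ?L (\<phi> n)) < inverse (real (Suc n))" by (elim exE) (rule that)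
    have l: "\<phi> n \<in> l2_space m" "?L (\<phi> n) \<in> l2_space m" for n
      using \<phi> test_functions_l2 laplacian_test(1) by auto
    have lim1: "(\<lambda>n. l2_norm m (\<phi> n - f)) \<longlonglongrightarrow> 0"
    proof (rule Lim_null_comparison[OF _ LIMSEQ_inverse_real_of_nat], intro always_eventually allI)
      show "norm (l2_norm m (\<phi> n - f)) \<le> inverse (real (Suc n))" for n
        using \<phi> L.nrm_minus_commute[OF l(1) fg(1), of n] L.nrm_ge_0[OF L.mem(3)[OF fg(1) l(1)], of n]
        by (metis abs_of_nonneg less_imp_le real_norm_def)
    qed
    have lim2: "(\<lambda>n. l2_norm m (?L (\<phi> n) - g)) \<longlonglongrightarrow> 0"
    proof (rule Lim_null_comparison[OF _ LIMSEQ_inverse_real_of_nat], intro always_eventually allI)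
      show "norm (l2_norm m (?L (\<phi> n) - g)) \<le> inverse (real (Suc n))" for n
        using \<phi> L.nrm_minus_commute[OF l(2) fg(2), of n] L.nrm_ge_0[OF L.mem(3)[OF fg(2) l(2)], of n]
        by (metis abs_of_nonneg less_imp_le real_norm_def)
    qed
    have gr: "(\<phi> n, ?L (\<phi> n)) \<in> EF.form_op" for n using \<phi> graph by blast
    show "(f, g) \<in> EF.form_op"
      by (rule S.graph_closed[of "\<lambda>n. (\<phi> n)" "\<lambda>n. ?L (\<phi> n)", OF gr fg lim1 lim2])
  }
  fix f g assume fg: "(f, g) \<in> EF.form_op"
  note l = EF.form_opD[OF fg]
  have "f + g \<in> l2_space m" using l by simp
  then obtain \<phi> where \<phi>': "\<forall>n. \<phi> n \<in> test_functions"
    and lim: "(\<lambda>n. l2_norm m (\<phi> n + ?L (\<phi> n) - (f + g))) \<longlonglongrightarrow> 0"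
    by (elim laplacian_range_dense[THEN exE] conjE) (rule that)
  have \<phi>: "\<phi> n \<in> test_functions" for n using \<phi>' by simp
  have pl: "\<phi> n \<in> l2_space m" "?L (\<phi> n) \<in> l2_space m" for n
    using \<phi> test_functions_l2 laplacian_test(1) by auto
  define a b where "a n = \<phi> n - f" and "b n = ?L (\<phi> n) - g" for n
  have ab: "(a n, b n) \<in> EF.form_op" for n
    unfolding a_def b_def by (rule S.graph_diff[OF graph[OF \<phi>] fg])
  note abl = EF.form_opD[OF ab]
  have sum: "a n + b n = \<phi> n + ?L (\<phi> n) - (f + g)" for n by (simp add: a_def b_def)
  \<comment> \<open>\<open><b n, a n>\<close> is an energy, hence nonnegative, so
    \<open>|a n|^2 <= <a n + b n, a n>\<close>.\<close>
  have a_le: "l2_norm m (a n) \<le> l2_norm m (a n + b n)" for n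
  proof -
    have "EL (a n) (a n) = l2_inner m (b n) (a n)" by (rule abl(4)[OF abl(1)])
    then have "0 \<le> l2_inner m (b n) (a n)" using EL_nonneg[OF abl(1)[of n]] by simp
    then have "(l2_norm m (a n))\<^sup>2 \<le> l2_inner m (a n + b n) (a n)"
      by (simp add: L.nrm_sq[OF abl(2)] L.ip_add_left[OF abl(2,3,2)])
    also have "\<dots> \<le> l2_norm m (a n + b n) * l2_norm m (a n)"
      using L.cauchy_schwarz[OF L.mem(2)[OF abl(2,3)] abl(2), of n n n] by linarith
    finally have "l2_norm m (a n) * l2_norm m (a n) \<le> l2_norm m (a n + b n) * l2_norm m (a n)"
      by (simp add: power2_eq_square)
    then show ?thesis
      using L.nrm_ge_0[OF abl(2), of n] L.nrm_ge_0[OF L.mem(2)[OF abl(2,3)], of n n]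
      by (cases "l2_norm m (a n) = 0") (auto simp: mult_le_cancel_right)
  qed
  have slim: "(\<lambda>n. l2_norm m (a n + b n)) \<longlonglongrightarrow> 0" using lim by (simp only: sum)
  have alim: "(\<lambda>n. l2_norm m (a n)) \<longlonglongrightarrow> 0"
  proof (rule Lim_null_comparison[OF _ slim], intro always_eventually allI)
    show "norm (l2_norm m (a n)) \<le> l2_norm m (a n + b n)" for n
      using a_le[of n] L.nrm_ge_0[OF abl(2), of n] by (simp only: real_norm_def abs_of_nonneg)
  qed
  have blim: "(\<lambda>n. l2_norm m (b n)) \<longlonglongrightarrow> 0"
  proof (rule Lim_null_comparison, intro always_eventually allI)
    show "(\<lambda>n. l2_norm m (a n + b n) + l2_norm m (a n)) \<longlonglongrightarrow> 0"
      using tendsto_add[OF slim alim] by simp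
    show "norm (l2_norm m (b n)) \<le> l2_norm m (a n + b n) + l2_norm m (a n)" for n
    proof -
      have "l2_norm m (b n) = l2_norm m ((a n + b n) - a n)" by simp
      also have "\<dots> \<le> l2_norm m (a n + b n) + l2_norm m (a n)"
        using L.nrm_triangle_sub[OF L.mem(2)[OF abl(2,3)] L.mem(1) abl(2), of n n n]
          L.nrm_minus_commute[OF L.mem(1) abl(2), of n] by simp
      finally show ?thesis using L.nrm_ge_0[OF abl(3), of n] by (simp only: real_norm_def abs_of_nonneg)
    qed
  qed
  show "(f, g) \<in> laplacian_op m C"
    unfolding laplacian_op_def op_closure_iff
  proof (intro conjI allI impI l(2,3))
    fix e :: real assume e: "0 < e"
    have "\<forall>\<^sub>F n in sequentially. l2_norm m (a n) < e \<and> l2_norm m (b n) < e"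
      using order_tendstoD(2)[OF alim e] order_tendstoD(2)[OF blim e] by (rule eventually_conj)
    then obtain n where n: "l2_norm m (a n) < e" "l2_norm m (b n) < e"
      using eventually_happens trivial_limit_sequentially by blast
    show "\<exists>u v. (u, v) \<in> {(f, ?L f) |f. f \<in> test_functions} \<and> u \<in> l2_space m \<and> v \<in> l2_space m
        \<and> l2_norm m (f - u) < e \<and> l2_norm m (g - v) < e"
    proof (intro exI conjI)
      show "(\<phi> n, ?L (\<phi> n)) \<in> {(f, ?L f) |f. f \<in> test_functions}" using \<phi> by blast
      show "l2_norm m (f - \<phi> n) < e" using n(1) L.nrm_minus_commute[OF pl(1) l(2), of n] by (simp add: a_def)
      show "l2_norm m (g - ?L (\<phi> n)) < e" using n(2) L.nrm_minus_commute[OF pl(2) l(3), of n] by (simp add: b_def)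
    qed (rule pl)+
  qed
qed

theorem QL_eq: "QL_dom m C = DL" "u \<in> DL \<Longrightarrow> v \<in> DL \<Longrightarrow> QL m C u v = EL u v"
  using EF.op_form_form_op unfolding form_op_EL QL_dom_def QL_def by blast+

end

section \<open>Sums of closed forms\<close>

text \<open>\<open>Q_form\<close> is a total function defined through choices and is known to agree
  with the explicit form only on the domain; the conditions on a form look only there.\<close>

lemma dense_closed_form_cong:
  assumes "dense_closed_form m D E" and eq: "\<And>u v. u \<in> D \<Longrightarrow> v \<in> D \<Longrightarrow> E' u v = E u v"
  shows "dense_closed_form m D E'"
proof -
  interpret A: dense_closed_form m D E by fact
  have ne: "D \<noteq> {}" "D \<subseteq> l2_space m" using A.symmetric by (auto simp: symmetric_form_def)
  have norm: "form_norm m E' u = form_norm m E u" if "u \<in> D" for u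
    using eq[OF that that] by (simp add: form_norm_def)
  have diff: "u - v \<in> D" if "u \<in> D" "v \<in> D" for u v
    by (rule subspace_diff[OF A.dom_subspace that])
  show ?thesis
  proof
    show "symmetric_form m D E'"
      unfolding symmetric_form_def combine_fun_eq
    proof (intro conjI ballI allI impI ne)
      fix u u' assume u: "u \<in> D" "u' \<in> l2_space m" "AE x in m. u x = u' x"
      show u': "u' \<in> D" by (rule A.dom_AE(1)[OF u])
      show "E' u' w = E' u w" if "w \<in> D" for w
        using A.dom_AE(2)[OF u that] eq[OF u' that] eq[OF u(1) that] by simp
    next
      fix u v a b assume uv: "u \<in> D" "v \<in> D"
      show c: "a *\<^sub>R u + b *\<^sub>R v \<in> D" by (rule A.combine(1)[OF uv])
      show "E' (a *\<^sub>R u + b *\<^sub>R v) w = a * E' u w + b * E' v w" if "w \<in> D" for w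
        using A.combine(2)[OF uv that] eq[OF c that] eq[OF uv(1) that] eq[OF uv(2) that] by simp
      show "E' u v = E' v u"
        using A.form_commute[OF uv] eq[OF uv] eq[OF uv(2,1)] by simp
    qed
    show "l2_dense m D" by (rule A.dense)
    show "0 \<le> E' u u" if "u \<in> D" for u using A.nonneg[OF that] eq[OF that that] by simp
    show "closed_form m D E'"
      unfolding closed_form_iff
    proof (intro allI impI)
      fix u :: "nat \<Rightarrow> 'a \<Rightarrow> real"
      assume "(\<forall>n. u n \<in> D) \<and> (\<forall>e>0. \<exists>N. \<forall>j\<ge>N. \<forall>k\<ge>N. form_norm m E' (u j - u k) < e)"
      then have u: "\<forall>n. u n \<in> D" and c: "\<forall>e>0. \<exists>N. \<forall>j\<ge>N. \<forall>k\<ge>N. form_norm m E' (u j - u k) < e"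
        by auto
      have n: "form_norm m E' (u j - w) = form_norm m E (u j - w)" if "w \<in> D" for j w
        using norm[OF diff[OF _ that]] u by simp
      have "\<exists>w\<in>D. (\<lambda>n. form_norm m E (u n - w)) \<longlonglongrightarrow> 0"
      proof (rule A.closed[unfolded closed_form_iff, THEN spec[of _ u], THEN mp], rule conjI[OF u])
        show "\<forall>e>0. \<exists>N. \<forall>j\<ge>N. \<forall>k\<ge>N. form_norm m E (u j - u k) < e"
          using c n u by simp
      qed
      then show "\<exists>w\<in>D. (\<lambda>n. form_norm m E' (u n - w)) \<longlonglongrightarrow> 0"
        using n by simp
    qed
  qed
qed

text \<open>A sequence that is Cauchy for the sum is Cauchy for each form. The two limits agree in
  \<open>L2\<close>, hence almost everywhere, and invariance under such changes lets the first limit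
  serve both forms.\<close>

lemma dense_closed_form_add:
  assumes "dense_closed_form m D1 E1" "dense_closed_form m D2 E2" and dense: "l2_dense m (D1 \<inter> D2)"
  shows "dense_closed_form m (D1 \<inter> D2) (\<lambda>u v. E1 u v + E2 u v)"
proof -
  interpret A: dense_closed_form m D1 E1 by fact
  interpret B: dense_closed_form m D2 E2 by fact
  let ?E = "\<lambda>u v. E1 u v + E2 u v"
  have le: "form_norm m E1 u \<le> form_norm m ?E u" "form_norm m E2 u \<le> form_norm m ?E u"
    "form_norm m ?E u \<le> form_norm m E1 u + form_norm m E2 u" if u: "u \<in> D1" "u \<in> D2" for u
  proof -
    have nn: "0 \<le> E1 u u" "0 \<le> E2 u u" "0 \<le> l2_inner m u u"
      using A.nonneg[OF u(1)] B.nonneg[OF u(2)] A.L.ip_ge_0[OF A.dom_l2[OF u(1)]] by auto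
    then show "form_norm m E1 u \<le> form_norm m ?E u" "form_norm m E2 u \<le> form_norm m ?E u"
      by (simp_all add: form_norm_def)
    have "form_norm m ?E u \<le> sqrt ((E1 u u + l2_inner m u u) + (E2 u u + l2_inner m u u))"
      unfolding form_norm_def using nn by (intro real_sqrt_le_mono) simp
    also have "\<dots> \<le> form_norm m E1 u + form_norm m E2 u"
      unfolding form_norm_def using nn by (intro sqrt_add_le_add_sqrt add_nonneg_nonneg)
    finally show "form_norm m ?E u \<le> form_norm m E1 u + form_norm m E2 u" .
  qed
  have diff: "u - v \<in> D1" "u - v \<in> D2" if "u \<in> D1 \<inter> D2" "v \<in> D1 \<inter> D2" for u v
    using subspace_diff[OF A.dom_subspace, of u v] subspace_diff[OF B.dom_subspace, of u v] that by auto
  show ?thesis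
  proof
    show "symmetric_form m (D1 \<inter> D2) ?E"
      unfolding symmetric_form_def combine_fun_eq
    proof (intro conjI ballI allI impI)
      show "D1 \<inter> D2 \<noteq> {}"
        using subspace_0[OF A.dom_subspace] subspace_0[OF B.dom_subspace] by blast
      show "D1 \<inter> D2 \<subseteq> l2_space m" using A.dom_l2 by blast
    next
      fix u u' assume u: "u \<in> D1 \<inter> D2" "u' \<in> l2_space m" "AE x in m. u x = u' x"
      have u12: "u \<in> D1" "u \<in> D2" using u(1) by auto
      show "u' \<in> D1 \<inter> D2"
        using A.dom_AE(1)[OF u12(1) u(2,3)] B.dom_AE(1)[OF u12(2) u(2,3)] by blast
      show "E1 u' w + E2 u' w = E1 u w + E2 u w" if "w \<in> D1 \<inter> D2" for w
        using A.dom_AE(2)[OF u12(1) u(2,3), of w] B.dom_AE(2)[OF u12(2) u(2,3), of w] that by simp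
    next
      fix u v a b assume uv: "u \<in> D1 \<inter> D2" "v \<in> D1 \<inter> D2"
      show "a *\<^sub>R u + b *\<^sub>R v \<in> D1 \<inter> D2"
        using A.combine(1)[of u v a b] B.combine(1)[of u v a b] uv by simp
      show "E1 (a *\<^sub>R u + b *\<^sub>R v) w + E2 (a *\<^sub>R u + b *\<^sub>R v) w = a * (E1 u w + E2 u w) + b * (E1 v w + E2 v w)"
        if "w \<in> D1 \<inter> D2" for w
        using A.combine(2)[of u v w a b] B.combine(2)[of u v w a b] uv that by (simp add: distrib_left)
      show "E1 u v + E2 u v = E1 v u + E2 v u"
        using A.form_commute[of u v] B.form_commute[of u v] uv by simp
    qed
    show "l2_dense m (D1 \<inter> D2)" by (rule dense)
    show "0 \<le> E1 u u + E2 u u" if "u \<in> D1 \<inter> D2" for u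
      using A.nonneg[of u] B.nonneg[of u] that by simp
    show "closed_form m (D1 \<inter> D2) ?E"
      unfolding closed_form_iff
    proof (intro allI impI)
      fix u :: "nat \<Rightarrow> 'a \<Rightarrow> real"
      assume "(\<forall>n. u n \<in> D1 \<inter> D2) \<and> (\<forall>e>0. \<exists>N. \<forall>j\<ge>N. \<forall>k\<ge>N. form_norm m ?E (u j - u k) < e)"
      then have u: "\<forall>n. u n \<in> D1 \<inter> D2" and c: "\<forall>e>0. \<exists>N. \<forall>j\<ge>N. \<forall>k\<ge>N. form_norm m ?E (u j - u k) < e"
        by auto
      have u1: "u n \<in> D1" and u2: "u n \<in> D2" for n using u by auto
      have d: "u j - u k \<in> D1" "u j - u k \<in> D2" for j k using diff u by auto
      have "\<exists>w\<in>D1. (\<lambda>n. form_norm m E1 (u n - w)) \<longlonglongrightarrow> 0"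
      proof (rule A.closed[unfolded closed_form_iff, THEN spec[of _ u], THEN mp], intro conjI allI impI u1)
        fix e :: real assume "0 < e"
        then obtain N where N: "\<forall>j\<ge>N. \<forall>k\<ge>N. form_norm m ?E (u j - u k) < e" using c by auto
        show "\<exists>N. \<forall>j\<ge>N. \<forall>k\<ge>N. form_norm m E1 (u j - u k) < e"
          using N le_less_trans[OF le(1)[OF d]] by (intro exI[of _ N]) simp
      qed
      then obtain v where v: "v \<in> D1" "(\<lambda>n. form_norm m E1 (u n - v)) \<longlonglongrightarrow> 0" by (elim bexE) (rule that)
      have "\<exists>w\<in>D2. (\<lambda>n. form_norm m E2 (u n - w)) \<longlonglongrightarrow> 0"
      proof (rule B.closed[unfolded closed_form_iff, THEN spec[of _ u], THEN mp], intro conjI allI impI u2)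
        fix e :: real assume "0 < e"
        then obtain N where N: "\<forall>j\<ge>N. \<forall>k\<ge>N. form_norm m ?E (u j - u k) < e" using c by auto
        show "\<exists>N. \<forall>j\<ge>N. \<forall>k\<ge>N. form_norm m E2 (u j - u k) < e"
          using N le_less_trans[OF le(2)[OF d]] by (intro exI[of _ N]) simp
      qed
      then obtain w where w: "w \<in> D2" "(\<lambda>n. form_norm m E2 (u n - w)) \<longlonglongrightarrow> 0" by (elim bexE) (rule that)
      note vl = A.dom_l2[OF v(1)] and wl = B.dom_l2[OF w(1)] and ul = A.dom_l2[OF u1]
      have "(\<lambda>n. l2_norm m (u n - v) + l2_norm m (u n - w)) \<longlonglongrightarrow> 0 + 0"
        by (intro tendsto_add A.form_norm_tendsto_l2 B.form_norm_tendsto_l2 u1 u2 v w)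
      moreover have "l2_norm m (v - w) \<le> l2_norm m (u n - v) + l2_norm m (u n - w)" for n
        using A.L.nrm_triangle_sub[OF vl ul wl, of n] A.L.nrm_minus_commute[OF ul vl, of n] by simp
      ultimately have "l2_norm m (v - w) \<le> 0"
        by (intro LIMSEQ_le_const[of _ "0 :: real"]) auto
      then have null: "l2_norm m (v - w) = 0" using A.L.nrm_ge_0[OF A.L.mem(3)[OF vl wl]] by simp
      then have ae: "AE x in m. v x = w x" using l2_norm_diff_eq_0_iff[OF vl wl] by simp
      then have "AE x in m. w x = v x" by (simp add: eq_commute)
      then have v2: "v \<in> D2" by (rule B.dom_AE(1)[OF w(1) vl])
      \<comment> \<open>\<open>w - v\<close> is null in \<open>L2\<close>, hence also in the second
        form norm, so \<open>w\<close> may be traded for \<open>v\<close>.\<close>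
      have "form_norm m E2 (w - v) = 0"
        using null A.L.nrm_minus_commute[OF vl wl]
        by (intro B.form_norm_null subspace_diff[OF B.dom_subspace] w v2) simp
      then have le2: "form_norm m E2 (u n - v) \<le> form_norm m E2 (u n - w)" for n
        using B.F.nrm_triangle_sub[OF u2 w(1) v2, of n] by simp
      have dv: "u n - v \<in> D1" "u n - v \<in> D2" for n
        using subspace_diff[OF A.dom_subspace u1 v(1)] subspace_diff[OF B.dom_subspace u2 v2] by auto
      have "(\<lambda>n. form_norm m ?E (u n - v)) \<longlonglongrightarrow> 0"
      proof (rule Lim_null_comparison, intro always_eventually allI)
        show "(\<lambda>n. form_norm m E1 (u n - v) + form_norm m E2 (u n - w)) \<longlonglongrightarrow> 0"
          using tendsto_add[OF v(2) w(2)] by simp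
        show "norm (form_norm m ?E (u n - v)) \<le> form_norm m E1 (u n - v) + form_norm m E2 (u n - w)" for n
          using le(3)[OF dv, of n] le(1)[OF dv, of n] le2[of n] A.F.nrm_ge_0[OF dv(1), of n] by simp
      qed
      then show "\<exists>w\<in>D1 \<inter> D2. (\<lambda>n. form_norm m ?E (u n - w)) \<longlonglongrightarrow> 0"
        using v(1) v2 by (intro bexI[of _ v]) auto
    qed
  qed
qed

section \<open>The potential\<close>

lemma l2_space_bound:
  assumes "u \<in> borel_measurable m" "g \<in> l2_space m" "\<And>x. \<bar>u x\<bar> \<le> \<bar>g x\<bar>"
  shows "u \<in> l2_space m"
proof -
  have "integrable m (\<lambda>x. (u x)\<^sup>2)"
    using assms by (intro Bochner_Integration.integrable_bound[OF l2_spaceD(2)[OF assms(2)]])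
      (auto simp: abs_le_square_iff)
  then show ?thesis using assms(1) by (simp add: l2_space_def)
qed

locale hierarchical_schroedinger = hierarchical_space m C
  for m :: "'a::metric_space measure" and C +
  fixes V :: "'a \<Rightarrow> real"
  assumes locally_integrable: "locally_integrable m V"
    and V_nonneg: "AE x in m. 0 \<le> V x"
begin

text \<open>The form norm of the potential is the \<open>L\<^sup>2\<close> norm of the measure with density \<open>1 + |V|\<close>.\<close>

definition weighted :: "'a measure" where
  "weighted = density m (\<lambda>x. ennreal (1 + \<bar>V x\<bar>))"

lemma V_measurable [measurable]: "V \<in> borel_measurable m"
  using locally_integrable by (simp add: locally_integrable_def)

lemma weighted_measurable: "borel_measurable weighted = borel_measurable m"
  unfolding weighted_def by (rule measurable_cong_sets) simp_all

lemma weighted_integrable_iff: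
  assumes "f \<in> borel_measurable m"
  shows "integrable weighted f \<longleftrightarrow> integrable m f \<and> integrable m (\<lambda>x. \<bar>V x\<bar> * f x)"
proof -
  have "integrable weighted f \<longleftrightarrow> integrable m (\<lambda>x. (1 + \<bar>V x\<bar>) * f x)"
    unfolding weighted_def using assms by (subst integrable_density) auto
  also have "\<dots> \<longleftrightarrow> integrable m f \<and> integrable m (\<lambda>x. \<bar>V x\<bar> * f x)"
  proof
    assume i: "integrable m (\<lambda>x. (1 + \<bar>V x\<bar>) * f x)"
    have "integrable m f"
      using assms by (intro Bochner_Integration.integrable_bound[OF i]) (auto simp: abs_mult mult_le_cancel_right1)
    moreover have "integrable m (\<lambda>x. \<bar>V x\<bar> * f x)"
      using assms by (intro Bochner_Integration.integrable_bound[OF i]) (auto simp: abs_mult mult_right_mono)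
    ultimately show "integrable m f \<and> integrable m (\<lambda>x. \<bar>V x\<bar> * f x)" ..
  next
    assume "integrable m f \<and> integrable m (\<lambda>x. \<bar>V x\<bar> * f x)"
    then have "integrable m (\<lambda>x. f x + \<bar>V x\<bar> * f x)" by simp
    then show "integrable m (\<lambda>x. (1 + \<bar>V x\<bar>) * f x)" by (simp add: distrib_right)
  qed
  finally show ?thesis .
qed

lemma QV_dom_eq: "QV_dom m V = l2_space weighted"
  unfolding QV_dom_def l2_space_def weighted_measurable
  by (intro Collect_cong) (auto simp: weighted_integrable_iff)

lemma QV_dom_l2: "u \<in> QV_dom m V \<Longrightarrow> u \<in> l2_space m"
  by (simp add: QV_dom_def)

lemma weighted_inner:
  assumes "u \<in> QV_dom m V" "v \<in> QV_dom m V"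
  shows "l2_inner weighted u v = QV m V u v + l2_inner m u v"
proof -
  have meas: "(\<lambda>x. u x * v x) \<in> borel_measurable m"
    using assms[THEN QV_dom_l2, THEN l2_spaceD(1)] by measurable
  have "integrable weighted (\<lambda>x. u x * v x)"
    using assms unfolding QV_dom_eq by (rule l2_integrable_mult)
  then have i: "integrable m (\<lambda>x. u x * v x)" "integrable m (\<lambda>x. \<bar>V x\<bar> * (u x * v x))"
    using weighted_integrable_iff[OF meas] by auto
  have "l2_inner weighted u v = (LINT x|m. (1 + \<bar>V x\<bar>) * (u x * v x))"
    unfolding weighted_def l2_inner_def using meas by (subst integral_density) auto
  also have "\<dots> = (LINT x|m. u x * v x + \<bar>V x\<bar> * (u x * v x))" by (simp add: distrib_right)
  also have "\<dots> = l2_inner m u v + (LINT x|m. \<bar>V x\<bar> * (u x * v x))"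
    using i by (simp add: l2_inner_def)
  also have "(LINT x|m. \<bar>V x\<bar> * (u x * v x)) = QV m V u v"
    unfolding QV_def
  proof (rule integral_cong_AE)
    show "AE x in m. \<bar>V x\<bar> * (u x * v x) = V x * u x * v x"
      using V_nonneg by (auto elim!: eventually_mono)
    show "(\<lambda>x. \<bar>V x\<bar> * (u x * v x)) \<in> borel_measurable m" using meas by measurable
    show "(\<lambda>x. V x * u x * v x) \<in> borel_measurable m"
      using assms[THEN QV_dom_l2, THEN l2_spaceD(1)] by measurable
  qed
  finally show ?thesis by simp
qed

lemma QV_form_norm: "u \<in> QV_dom m V \<Longrightarrow> form_norm m (QV m V) u = l2_norm weighted u"
  by (simp add: form_norm_def l2_norm_def weighted_inner)

lemma weighted_AE:
  assumes "AE x in m. P x"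
  shows "AE x in weighted. P x"
  unfolding weighted_def using assms by (subst AE_density) (auto elim!: eventually_mono)

text \<open>Local integrability of \<open>V\<close> puts the indicator of each \<open>B0 n\<close>
  into \<open>l2_space weighted\<close>; a multiple of it dominates \<open>u\<close>.\<close>

lemma bounded_support_weighted:
  assumes "u \<in> borel_measurable m" "\<And>x. \<bar>u x\<bar> \<le> M" "\<And>x. x \<notin> B0 n \<Longrightarrow> u x = 0"
  shows "u \<in> l2_space weighted"
proof (rule l2_space_bound)
  have eq: "(\<lambda>x. \<bar>V x\<bar> * (indicator (B0 n) x)\<^sup>2) = (\<lambda>x. \<bar>indicator (B0 n) x *\<^sub>R V x\<bar>)"
    by (rule ext) (simp add: indicator_def)
  have "set_integrable m (B0 n) V"
    using locally_integrable balls_compact[OF B0_balls] by (simp add: locally_integrable_def)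
  then have "integrable m (\<lambda>x. \<bar>indicator (B0 n) x *\<^sub>R V x\<bar>)"
    unfolding set_integrable_def by (rule integrable_abs)
  then have i: "indicat_real (B0 n) \<in> l2_space weighted"
    unfolding QV_dom_eq[symmetric] QV_dom_def eq[symmetric] by simp
  show "M *\<^sub>R indicat_real (B0 n) \<in> l2_space weighted"
    by (rule subspace_scale[OF l2_space_subspace i])
  show "\<bar>u x\<bar> \<le> \<bar>(M *\<^sub>R indicat_real (B0 n)) x\<bar>" for x
    using assms(2)[of x] assms(3)[of x] by (cases "x \<in> B0 n") auto
  show "u \<in> borel_measurable weighted" using assms(1) by (simp only: weighted_measurable)
qed

lemma test_functions_QV:
  assumes "\<phi> \<in> test_functions"
  shows "\<phi> \<in> QV_dom m V"
proof -
  obtain r n M where "0 < r" and c: "\<phi> \<in> const_scale r" and s: "\<And>x. x \<notin> B0 n \<Longrightarrow> \<phi> x = 0" and b: "\<And>x. \<bar>\<phi> x\<bar> \<le> M"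
    by (rule test_functionsE[OF assms]) (rule that)
  show ?thesis
    unfolding QV_dom_eq by (rule bounded_support_weighted[OF l2_spaceD(1)[OF const_scaleD(1)[OF c]] b s])
qed

lemma QV_dense_closed: "dense_closed_form m (QV_dom m V) (QV m V)"
proof
  interpret W: semi_hilbert "l2_space weighted" "l2_inner weighted"
    rewrites "semi_inner.nrm (l2_inner weighted) = l2_norm weighted" by (rule l2_semi_hilbert l2_nrm_eq)+
  have sub: "subspace (QV_dom m V)" unfolding QV_dom_eq by (rule l2_space_subspace)
  have QV: "QV m V u v = l2_inner weighted u v - l2_inner m u v" if "u \<in> QV_dom m V" "v \<in> QV_dom m V" for u v
    using weighted_inner[OF that] by simp
  show "symmetric_form m (QV_dom m V) (QV m V)"
    unfolding symmetric_form_def combine_fun_eq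
  proof (intro conjI ballI allI impI)
    show "QV_dom m V \<noteq> {}" using subspace_0[OF sub] by blast
    show "QV_dom m V \<subseteq> l2_space m" using QV_dom_l2 by blast
  next
    fix u u' assume u: "u \<in> QV_dom m V" "u' \<in> l2_space m" "AE x in m. u x = u' x"
    note [measurable] = l2_spaceD(1)[OF u(2)] l2_spaceD(1)[OF QV_dom_l2[OF u(1)]]
    have ui: "integrable m (\<lambda>x. \<bar>V x\<bar> * (u x)\<^sup>2)" using u(1) by (simp add: QV_dom_def)
    have "integrable m (\<lambda>x. \<bar>V x\<bar> * (u x)\<^sup>2) \<longleftrightarrow> integrable m (\<lambda>x. \<bar>V x\<bar> * (u' x)\<^sup>2)"
    proof (rule integrable_cong_AE)
      show "AE x in m. \<bar>V x\<bar> * (u x)\<^sup>2 = \<bar>V x\<bar> * (u' x)\<^sup>2" using u(3) by (rule eventually_mono) simp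
    qed measurable
    then show "u' \<in> QV_dom m V" using u(2) ui by (simp add: QV_dom_def)
    show "QV m V u' w = QV m V u w" if "w \<in> QV_dom m V" for w
      unfolding QV_def
    proof (rule integral_cong_AE)
      note [measurable] = l2_spaceD(1)[OF QV_dom_l2[OF that]]
      show "(\<lambda>x. V x * u' x * w x) \<in> borel_measurable m" "(\<lambda>x. V x * u x * w x) \<in> borel_measurable m"
        by measurable
      show "AE x in m. V x * u' x * w x = V x * u x * w x" using u(3) by (rule eventually_mono) simp
    qed
  next
    fix u v a b assume uv: "u \<in> QV_dom m V" "v \<in> QV_dom m V"
    note l = uv[unfolded QV_dom_eq] uv[THEN QV_dom_l2]
    show c: "a *\<^sub>R u + b *\<^sub>R v \<in> QV_dom m V"
      by (intro subspace_add[OF sub] subspace_scale[OF sub] uv)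
    show "QV m V (a *\<^sub>R u + b *\<^sub>R v) w = a * QV m V u w + b * QV m V v w" if w: "w \<in> QV_dom m V" for w
      unfolding QV[OF c w] QV[OF uv(1) w] QV[OF uv(2) w]
      using l w[unfolded QV_dom_eq] QV_dom_l2[OF w] by (simp add: W.ip_simps L.ip_simps algebra_simps)
    show "QV m V u v = QV m V v u" by (simp add: QV_def mult.commute mult.left_commute)
  qed
  show "l2_dense m (QV_dom m V)"
  proof (rule l2_dense_mono[OF test_functions_dense])
    show "test_functions \<subseteq> QV_dom m V" using test_functions_QV by blast
    show "QV_dom m V \<subseteq> l2_space m" using QV_dom_l2 by blast
  qed
  show "0 \<le> QV m V u u" for u
    unfolding QV_def using V_nonneg
    by (intro integral_nonneg_AE) (auto elim!: eventually_mono simp: mult.assoc)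
  show "closed_form m (QV_dom m V) (QV m V)"
    unfolding closed_form_iff
  proof (intro allI impI)
    fix u :: "nat \<Rightarrow> 'a \<Rightarrow> real"
    assume "(\<forall>n. u n \<in> QV_dom m V) \<and> (\<forall>e>0. \<exists>N. \<forall>j\<ge>N. \<forall>k\<ge>N. form_norm m (QV m V) (u j - u k) < e)"
    then have u: "\<And>n. u n \<in> QV_dom m V" and c: "\<forall>e>0. \<exists>N. \<forall>j\<ge>N. \<forall>k\<ge>N. form_norm m (QV m V) (u j - u k) < e"
      by auto
    have norm: "form_norm m (QV m V) (u j - w) = l2_norm weighted (u j - w)" if "w \<in> QV_dom m V" for j w
      by (rule QV_form_norm[OF subspace_diff[OF sub u that]])
    have "W.cauchy_seq u"
      unfolding W.cauchy_seq_def using c norm[OF u] by simp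
    then have "\<exists>w\<in>l2_space weighted. (\<lambda>n. l2_norm weighted (u n - w)) \<longlonglongrightarrow> 0"
      using u[unfolded QV_dom_eq] by (intro W.complete)
    then show "\<exists>w\<in>QV_dom m V. (\<lambda>n. form_norm m (QV m V) (u n - w)) \<longlonglongrightarrow> 0"
      unfolding QV_dom_eq[symmetric] using norm by simp
  qed
qed

section \<open>The sum of the two forms\<close>

lemma Q_dom_eq: "Q_dom m C V = DL \<inter> l2_space weighted"
  by (simp add: Q_dom_def QL_eq(1) QV_dom_eq)

lemma Q_form_eq: "u \<in> Q_dom m C V \<Longrightarrow> v \<in> Q_dom m C V \<Longrightarrow> Q_form m C V u v = EL u v + QV m V u v"
  by (simp add: Q_form_def QL_eq(2) Q_dom_eq)

lemma test_functions_Q: "\<phi> \<in> test_functions \<Longrightarrow> \<phi> \<in> Q_dom m C V"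
  using test_functions_QV test_functions_DL by (simp add: Q_dom_eq QV_dom_eq)

lemma Q_dense_closed: "dense_closed_form m (Q_dom m C V) (Q_form m C V)"
proof (rule dense_closed_form_cong[OF _ Q_form_eq])
  have "l2_dense m (Q_dom m C V)"
  proof (rule l2_dense_mono[OF test_functions_dense])
    show "test_functions \<subseteq> Q_dom m C V" using test_functions_Q by blast
    show "Q_dom m C V \<subseteq> l2_space m" using DLD(1) by (auto simp: Q_dom_eq)
  qed
  then show "dense_closed_form m (Q_dom m C V) (\<lambda>u v. EL u v + QV m V u v)"
    unfolding Q_dom_def QL_eq(1)
    by (intro dense_closed_form_add DL_dense_closed QV_dense_closed)
qed

sublocale Q: dense_closed_form m "Q_dom m C V" "Q_form m C V"
  by (rule Q_dense_closed)

lemma QV_diag: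
  assumes "u \<in> QV_dom m V"
  shows "QV m V u u = (LINT x|m. \<bar>V x\<bar> * (u x)\<^sup>2)"
  unfolding QV_def
proof (rule integral_cong_AE)
  note [measurable] = l2_spaceD(1)[OF QV_dom_l2[OF assms]]
  show "(\<lambda>x. V x * u x * u x) \<in> borel_measurable m" "(\<lambda>x. \<bar>V x\<bar> * (u x)\<^sup>2) \<in> borel_measurable m"
    by measurable
  show "AE x in m. V x * u x * u x = \<bar>V x\<bar> * (u x)\<^sup>2"
    using V_nonneg by (rule eventually_mono) (simp add: power2_eq_square)
qed

lemma QV_mono:
  assumes "u \<in> QV_dom m V" "v \<in> QV_dom m V" "\<And>x. \<bar>v x\<bar> \<le> \<bar>u x\<bar>"
  shows "QV m V v v \<le> QV m V u u"
  unfolding QV_diag[OF assms(1)] QV_diag[OF assms(2)]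
proof (rule integral_mono)
  show "integrable m (\<lambda>x. \<bar>V x\<bar> * (v x)\<^sup>2)" "integrable m (\<lambda>x. \<bar>V x\<bar> * (u x)\<^sup>2)"
    using assms(1,2) by (simp_all add: QV_dom_def)
  show "\<bar>V x\<bar> * (v x)\<^sup>2 \<le> \<bar>V x\<bar> * (u x)\<^sup>2" for x
    using assms(3)[of x] by (intro mult_left_mono) (simp_all add: abs_le_square_iff)
qed

text \<open>Truncation to the unit interval does not raise \<open>EL\<close>, being a normal
  contraction, and does not raise the potential term because \<open>|p t| <= |t|\<close>.\<close>

lemma Q_markovian: "markovian_form (Q_dom m C V) (Q_form m C V)"
  unfolding markovian_form_def
proof (intro ballI)
  fix u assume u: "u \<in> Q_dom m C V"
  define p :: "real \<Rightarrow> real" where "p t = min (max t 0) 1" for t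
  have p: "p \<in> borel_measurable borel" "p 0 = 0" "\<bar>p a - p b\<bar> \<le> \<bar>a - b\<bar>" "\<bar>p a\<bar> \<le> \<bar>a\<bar>" for a b
    unfolding p_def by auto
  have ul: "u \<in> l2_space m" and uD: "u \<in> DL" and uW: "u \<in> l2_space weighted"
    using u DLD(1) by (auto simp: Q_dom_eq)
  note nc = normal_contraction[OF ul p(1-3)]
  let ?v = "\<lambda>x. p (u x)"
  have vW: "?v \<in> l2_space weighted"
  proof (rule l2_space_bound[OF _ uW])
    show "?v \<in> borel_measurable weighted" using l2_spaceD(1)[OF nc(1)] by (simp only: weighted_measurable)
  qed (rule p(4))
  then have v: "?v \<in> Q_dom m C V" using nc(3)[OF uD] by (simp add: Q_dom_eq)
  have "QV m V ?v ?v \<le> QV m V u u"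
    using uW vW p(4) unfolding QV_dom_eq[symmetric] by (rule QV_mono)
  then have "Q_form m C V ?v ?v \<le> Q_form m C V u u"
    using nc(4)[OF uD] unfolding Q_form_eq[OF u u] Q_form_eq[OF v v] by linarith
  with v have "?v \<in> Q_dom m C V \<and> Q_form m C V ?v ?v \<le> Q_form m C V u u" ..
  then show "(\<lambda>x. min (max (u x) 0) 1) \<in> Q_dom m C V \<and>
      Q_form m C V (\<lambda>x. min (max (u x) 0) 1) (\<lambda>x. min (max (u x) 0) 1) \<le> Q_form m C V u u"
    unfolding p_def .
qed

end

section \<open>Test functions are a core\<close>

context hierarchical_space
begin

text \<open>A finite set \<open>F\<close> carries all but \<open>e\<close> of the weight above
  \<open>B0 0\<close>. Once \<open>B0 k\<close> contains every ball of \<open>F\<close>, none of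
  them lies strictly above \<open>B0 k\<close>, so a finite set of balls above \<open>B0 k\<close>
  can use only the remaining weight.\<close>

lemma sum_above_B0_small:
  assumes e: "0 < e"
  shows "\<exists>n. \<forall>k\<ge>n. \<forall>G. finite G \<and> G \<subseteq> above (B0 k) \<longrightarrow> sum C G \<le> e"
proof -
  have "(C has_sum mu (B0 0)) (above (B0 0))"
    unfolding mu_def by (rule has_sum_infsum[OF C_summable_above[OF B0_balls]])
  from has_sum_finite_approximation[OF this e]
  obtain F where F: "finite F" "F \<subseteq> above (B0 0)" "dist (sum C F) (mu (B0 0)) \<le> e" by auto
  have Fb: "F \<subseteq> balls" using F(2) by (auto simp: above_def)
  have "bounded (\<Union>F)"
    using F(1) Fb balls_compact compact_imp_bounded by (intro bounded_Union) auto
  then obtain n where n: "\<Union>F \<subseteq> B0 n" by (rule bounded_subset_B0)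
  have "sum C G \<le> e" if k: "n \<le> k" and G: "finite G" "G \<subseteq> above (B0 k)" for k G
  proof -
    have "G \<inter> F = {}"
    proof (rule equals0I)
      fix T assume T: "T \<in> G \<inter> F"
      then have "B0 k \<subset> T" using G(2) by (auto simp: above_def)
      moreover have "T \<subseteq> B0 k" using T n B0_mono[OF k] by blast
      ultimately show False by blast
    qed
    moreover have "G \<union> F \<subseteq> above (B0 0)"
      using G(2) F(2) B0_mono[of 0 k] by (auto simp: above_def)
    ultimately have "sum C G + sum C F \<le> mu (B0 0)"
      using sum_above_le_mu[OF B0_balls, of "G \<union> F" 0] G(1) F(1) by (simp add: sum.union_disjoint)
    then show ?thesis using F(3) by (simp add: dist_real_def)
  qed
  then show ?thesis by (intro exI[of _ n]) simp
qed

text \<open>A ball \<open>B\<close> disjoint from \<open>A\<close> sees 0 and one inside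
  \<open>A\<close> sees \<open>u\<close> unchanged; only for \<open>B\<close> strictly above
  \<open>A\<close> can the cut-off add energy, at most \<open>C B * |u|^2\<close>.\<close>

lemma eB_restrict_le:
  assumes A: "A \<in> balls" and B: "B \<in> balls" and u: "u \<in> l2_space m"
  shows "eB B (restrict_to A u) (restrict_to A u) \<le> eB B u u + (if B \<in> above A then C B * (l2_norm m u)\<^sup>2 else 0)"
proof -
  have l: "restrict_to A u \<in> l2_space m" using A u by simp
  consider "A \<inter> B = {}" | "B \<subseteq> A" | "B \<in> above A"
    using balls_nested[OF A B] B by (auto simp: above_def)
  then show ?thesis
  proof cases
    case 1
    then have "dev B (restrict_to A u) = 0"
      by (intro dev_zero_const[OF B, of _ 0]) (auto simp: restrict_to_def indicator_def)
    then show ?thesis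
      using C_pos[OF B] eB_nonneg[OF B u] by (simp add: eB_def)
  next
    case 2
    then have eq: "indicator B x * restrict_to A u x = indicator B x * u x" for x
      by (auto simp: restrict_to_def indicator_def)
    have "l2_inner m (indicator B) (restrict_to A u) = l2_inner m (indicator B) u"
      unfolding l2_inner_def eq ..
    then have "dev B (restrict_to A u) = dev B u"
      by (intro ext) (simp add: dev_def avg_def right_diff_distrib eq)
    moreover have "B \<notin> above A" using 2 by (auto simp: above_def)
    ultimately show ?thesis by (simp add: eB_def)
  next
    case 3
    have "l2_norm m (dev B (restrict_to A u)) \<le> l2_norm m u"
      using dev_norm_le[OF B l] restrict_to_norm_le[OF u A] by simp
    then have "C B * (l2_norm m (dev B (restrict_to A u)))\<^sup>2 \<le> C B * (l2_norm m u)\<^sup>2"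
      using C_pos[OF B] L.nrm_ge_0[OF dev_l2[OF B l]] by (intro mult_left_mono power_mono) auto
    then show ?thesis using eB_norm[OF B l] eB_nonneg[OF B u] 3 by simp
  qed
qed

text \<open>The excess energy is at most \<open>|u|^2\<close> times the weight of the balls above
  \<open>B0 n\<close>, which tends to 0.\<close>

lemma EL_restrict:
  assumes u: "u \<in> DL"
  shows "0 < e \<Longrightarrow> \<forall>\<^sub>F n in sequentially. EL (restrict_to (B0 n) u) (restrict_to (B0 n) u) \<le> EL u u + e"
    "restrict_to (B0 n) u \<in> DL"
proof -
  have l: "u \<in> l2_space m" by (rule DLD(1)[OF u])
  let ?N = "(l2_norm m u)\<^sup>2"
  have sum_le: "(\<Sum>B\<in>F. eB B (restrict_to (B0 n) u) (restrict_to (B0 n) u)) \<le> EL u u + M * ?N"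
    if F: "finite F" "F \<subseteq> balls" and M: "\<And>G. finite G \<Longrightarrow> G \<subseteq> above (B0 n) \<Longrightarrow> sum C G \<le> M" for F n M
  proof -
    have "(\<Sum>B\<in>F. eB B (restrict_to (B0 n) u) (restrict_to (B0 n) u))
        \<le> (\<Sum>B\<in>F. eB B u u + (if B \<in> above (B0 n) then C B * ?N else 0))"
      using F eB_restrict_le[OF B0_balls _ l] by (intro sum_mono) blast
    also have "\<dots> = (\<Sum>B\<in>F. eB B u u) + sum C (F \<inter> above (B0 n)) * ?N"
      using F by (simp add: sum.distrib sum.If_cases sum_distrib_right Int_def)
    also have "\<dots> \<le> EL u u + M * ?N"
      using F by (intro add_mono sum_eB_le_EL[OF u] mult_right_mono M) auto
    finally show ?thesis .
  qed
  have rl: "restrict_to (B0 n) u \<in> l2_space m" for n using l by simp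
  show "restrict_to (B0 n) u \<in> DL"
    by (rule DL_I(1)[OF rl sum_le[OF _ _ sum_above_le_mu[OF B0_balls]]])
  show "\<forall>\<^sub>F n in sequentially. EL (restrict_to (B0 n) u) (restrict_to (B0 n) u) \<le> EL u u + e" if e: "0 < e"
  proof -
    have N: "0 < ?N + 1" by (simp add: add_nonneg_pos)
    then have "0 < e / (?N + 1)" using e by simp
    then obtain n where n: "\<forall>k\<ge>n. \<forall>G. finite G \<and> G \<subseteq> above (B0 k) \<longrightarrow> sum C G \<le> e / (?N + 1)"
      by (elim sum_above_B0_small[THEN exE]) (rule that)
    have "EL (restrict_to (B0 k) u) (restrict_to (B0 k) u) \<le> EL u u + e" if k: "n \<le> k" for k
    proof -
      have M: "sum C G \<le> e / (?N + 1)" if "finite G" "G \<subseteq> above (B0 k)" for G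
        using n k that by simp
      have "EL (restrict_to (B0 k) u) (restrict_to (B0 k) u) \<le> EL u u + e / (?N + 1) * ?N"
        by (rule DL_I(2)[OF rl sum_le[OF _ _ M]])
      moreover have "e / (?N + 1) * ?N \<le> e"
        using N e by (simp add: field_simps)
      ultimately show ?thesis by linarith
    qed
    then show ?thesis by (rule eventually_sequentiallyI)
  qed
qed

text \<open>Averages have deviations \<^term>\<open>dev B (average r u)\<close> that are again constant at scale \<open>r\<close>, so
  testing them against \<^term>\<open>u\<close> instead of \<^term>\<open>average r u\<close> changes nothing.\<close>

lemma EL_average:
  assumes r: "0 < r" and u: "u \<in> DL"
  shows "average r u \<in> DL" "EL (average r u) (average r u) \<le> EL u u"
proof -
  have l: "u \<in> l2_space m" by (rule DLD(1)[OF u])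
  note p = average_props[OF r l]
  have pl: "average r u \<in> l2_space m" by (rule const_scaleD(1)[OF p(1)])
  have le: "eB B (average r u) (average r u) \<le> eB B u u" if B: "B \<in> balls" for B
  proof -
    let ?d = "dev B (average r u)"
    have dl: "?d \<in> l2_space m" "dev B u \<in> l2_space m" using B pl l by auto
    have d: "?d \<in> const_scale r"
      by (rule const_scaleI[OF dl(1)]) (rule dev_local[OF r p(1) B])
    have "(l2_norm m ?d)\<^sup>2 = l2_inner m ?d (average r u)"
      using dev_ip[OF B pl pl] L.nrm_sq[OF dl(1)] by simp
    also have "\<dots> = l2_inner m u ?d"
      using p(2)[OF d] L.ip_commute[OF dl(1) pl] by simp
    also have "\<dots> = l2_inner m ?d (dev B u)"
      using dev_ip[OF B pl l] L.ip_commute[OF dl(1) l] by simp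
    also have "\<dots> \<le> l2_norm m ?d * l2_norm m (dev B u)"
      using L.cauchy_schwarz[OF dl] by simp
    finally have "l2_norm m ?d * l2_norm m ?d \<le> l2_norm m ?d * l2_norm m (dev B u)"
      by (simp add: power2_eq_square)
    then have "l2_norm m ?d \<le> l2_norm m (dev B u)"
      using L.nrm_ge_0[OF dl(1)] L.nrm_ge_0[OF dl(2)] by (cases "l2_norm m ?d = 0") (auto simp: mult_le_cancel_left)
    then have "C B * (l2_norm m ?d)\<^sup>2 \<le> C B * (l2_norm m (dev B u))\<^sup>2"
      using C_pos[OF B] L.nrm_ge_0[OF dl(1)] by (intro mult_left_mono power_mono) auto
    then show ?thesis using eB_norm[OF B pl] eB_norm[OF B l] by simp
  qed
  have sum_le: "(\<Sum>B\<in>F. eB B (average r u) (average r u)) \<le> EL u u" if F: "finite F" "F \<subseteq> balls" for F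
  proof -
    have "(\<Sum>B\<in>F. eB B (average r u) (average r u)) \<le> (\<Sum>B\<in>F. eB B u u)"
      using F le by (intro sum_mono) blast
    then show ?thesis using sum_eB_le_EL[OF u F] by linarith
  qed
  show "average r u \<in> DL" by (rule DL_I(1)[OF pl sum_le])
  show "EL (average r u) (average r u) \<le> EL u u" by (rule DL_I(2)[OF pl sum_le])
qed

text \<open>\<open>average s u\<close> is the best approximation of \<open>u\<close> in
  \<open>const_scale s\<close>, so it is at least as close as a nearby test function, which belongs
  to \<open>const_scale s\<close> for all small \<open>s\<close>.\<close>

lemma average_tendsto:
  assumes u: "u \<in> l2_space m"
  shows "(\<lambda>n. l2_norm m (average (inverse (real (Suc n))) u - u)) \<longlonglongrightarrow> 0"
proof (rule tendstoI)
  fix e :: real assume e: "0 < e"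
  obtain \<phi> where \<phi>: "\<phi> \<in> test_functions" "l2_norm m (u - \<phi>) < e"
    using l2_denseD(2)[OF test_functions_dense u e] by (elim bexE) (rule that)
  obtain r where r: "0 < r" and c: "\<phi> \<in> const_scale r"
    by (rule test_functionsE[OF \<phi>(1)]) (rule that)
  have \<phi>l: "\<phi> \<in> l2_space m" by (rule const_scaleD(1)[OF c])
  have le: "l2_norm m (average s u - u) < e" if s: "0 < s" "s \<le> r" for s
  proof -
    have cs: "\<phi> \<in> const_scale s"
    proof (rule const_scaleI[OF \<phi>l])
      fix x y :: 'a assume "dist x y < s"
      then have "dist x y < r" using s(2) by simp
      then show "\<phi> x = \<phi> y" by (rule const_scaleD(2)[OF c])
    qed
    note p = average_props[OF s(1) u]
    let ?p = "average s u"
    have pl: "?p \<in> l2_space m" by (rule const_scaleD(1)[OF p(1)])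
    have d: "u - ?p \<in> l2_space m" using u pl by simp
    have "l2_inner m u (\<phi> - ?p) = l2_inner m ?p (\<phi> - ?p)"
      using p(2)[OF subspace_diff[OF const_scale_subspace cs p(1)]] by simp
    then have z: "l2_inner m (u - ?p) (\<phi> - ?p) = 0"
      using L.ip_diff_left[OF u pl L.mem(3)[OF \<phi>l pl]] by simp
    have "u - ?p = (u - \<phi>) + (\<phi> - ?p)" by simp
    then have "(l2_norm m (u - ?p))\<^sup>2 = l2_inner m (u - ?p) ((u - \<phi>) + (\<phi> - ?p))"
      using L.nrm_sq[OF d] by simp
    also have "\<dots> = l2_inner m (u - ?p) (u - \<phi>)"
      using L.ip_add_right[OF L.mem(3)[OF u \<phi>l] L.mem(3)[OF \<phi>l pl] d] z by simp
    also have "\<dots> \<le> l2_norm m (u - ?p) * l2_norm m (u - \<phi>)"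
      using L.cauchy_schwarz[OF d L.mem(3)[OF u \<phi>l]] by simp
    finally have "l2_norm m (u - ?p) * l2_norm m (u - ?p) \<le> l2_norm m (u - ?p) * l2_norm m (u - \<phi>)"
      by (simp add: power2_eq_square)
    then have "l2_norm m (u - ?p) \<le> l2_norm m (u - \<phi>)"
      using L.nrm_ge_0[OF d] L.nrm_ge_0[OF L.mem(3)[OF u \<phi>l]]
      by (cases "l2_norm m (u - ?p) = 0") (auto simp: mult_le_cancel_left)
    then show ?thesis using \<phi>(2) L.nrm_minus_commute[OF u pl] by simp
  qed
  obtain N where N: "inverse (real (Suc N)) < r" using reals_Archimedean[OF r] by blast
  have "dist (l2_norm m (average (inverse (real (Suc n))) u - u)) 0 < e" if "N \<le> n" for n
  proof -
    have inv: "inverse (real (Suc n)) \<le> inverse (real (Suc N))" using that by (intro le_imp_inverse_le) auto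
    have pos: "0 < inverse (real (Suc n))" by simp
    have "average (inverse (real (Suc n))) u \<in> l2_space m"
      by (rule const_scaleD(1)[OF average_props(1)[OF pos u]])
    then have "0 \<le> l2_norm m (average (inverse (real (Suc n))) u - u)"
      using u by (intro L.nrm_ge_0 L.mem)
    then show ?thesis
      using le[OF pos less_imp_le[OF le_less_trans[OF inv N]]]
      by (simp only: dist_real_def diff_0_right abs_of_nonneg)
  qed
  then show "\<forall>\<^sub>F n in sequentially. dist (l2_norm m (average (inverse (real (Suc n))) u - u)) 0 < e"
    by (rule eventually_sequentiallyI)
qed

text \<open>Since \<open>r <= 1\<close>, a ball of averaging lies inside \<open>B0 n\<close> or
  misses it.\<close>

lemma average_bounded_support:
  assumes r: "0 < r" "r \<le> 1" and u: "u \<in> l2_space m" and b: "\<And>x. \<bar>u x\<bar> \<le> M" and s: "\<And>x. x \<notin> B0 n \<Longrightarrow> u x = 0"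
  shows "\<bar>average r u x\<bar> \<le> M" "x \<notin> B0 n \<Longrightarrow> average r u x = 0"
proof -
  have B: "ball y r \<in> balls" for y :: 'a using r(1) by (auto simp: balls_def)
  show "\<bar>average r u x\<bar> \<le> M" unfolding average_def by (rule avg_bound[OF B u b])
  show "average r u x = 0" if x: "x \<notin> B0 n"
  proof -
    have "ball x r \<subseteq> B0 n \<or> ball x r \<inter> B0 n = {}"
      unfolding B0_def using r(2) by (intro ball_subset_or_disjoint) simp
    moreover have "x \<in> ball x r" using r(1) by simp
    ultimately have "ball x r \<inter> B0 n = {}" using x by blast
    then have disj: "y \<notin> B0 n" if "y \<in> ball x r" for y using that by blast
    have z: "indicat_real (ball x r) y * u y = 0" for y
    proof (cases "y \<in> ball x r")
      case True
      then show ?thesis using s[OF disj[OF True]] by simp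
    next
      case False
      then show ?thesis by (simp add: indicator_def)
    qed
    show ?thesis unfolding average_def avg_def l2_inner_def z by simp
  qed
qed

end

section \<open>Approximation in the form norm by test functions\<close>

context hierarchical_schroedinger
begin

text \<open>The squared form norm is \<open>EL\<close> plus the squared norm of
  \<open>l2_space weighted\<close>. Convergence in the latter implies convergence in
  \<open>l2_space m\<close>, which \<open>EL_tendsto_0\<close> turns into convergence of the
  energy.\<close>

lemma Q_tendsto:
  assumes u: "\<And>n. u n \<in> DL" "\<And>n. u n \<in> l2_space weighted" and w: "w \<in> Q_dom m C V"
    and lim: "(\<lambda>n. l2_norm weighted (u n - w)) \<longlonglongrightarrow> 0"
    and le: "\<And>e. 0 < e \<Longrightarrow> \<forall>\<^sub>F n in sequentially. EL (u n) (u n) \<le> EL w w + e"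
  shows "(\<lambda>n. form_norm m (Q_form m C V) (u n - w)) \<longlonglongrightarrow> 0"
proof -
  have wD: "w \<in> DL" "w \<in> l2_space weighted" using w by (auto simp: Q_dom_eq)
  have un: "u n \<in> Q_dom m C V" for n using u by (simp add: Q_dom_eq)
  have d: "u n - w \<in> Q_dom m C V" for n by (rule subspace_diff[OF Q.dom_subspace un w])
  have dV: "u n - w \<in> QV_dom m V" for n using d[of n] by (simp add: Q_dom_eq QV_dom_eq)
  have "(\<lambda>n. l2_norm m (u n - w)) \<longlonglongrightarrow> 0"
  proof (rule Lim_null_comparison[OF _ lim], intro always_eventually allI)
    interpret QVF: dense_closed_form m "QV_dom m V" "QV m V" by (rule QV_dense_closed)
    show "norm (l2_norm m (u n - w)) \<le> l2_norm weighted (u n - w)" for n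
      using QVF.l2_norm_le_form_norm[OF dV[of n]] QV_form_norm[OF dV[of n]] L.nrm_ge_0[OF QV_dom_l2[OF dV[of n]]]
      by simp
  qed
  then have E0: "(\<lambda>n. EL (u n - w) (u n - w)) \<longlonglongrightarrow> 0"
    by (rule EL_tendsto_0[OF u(1) wD(1) _ le])
  have "form_norm m (Q_form m C V) (u n - w) = sqrt (EL (u n - w) (u n - w) + (l2_norm weighted (u n - w))\<^sup>2)" for n
  proof -
    have "l2_inner weighted (u n - w) (u n - w) = (l2_norm weighted (u n - w))\<^sup>2"
      by (simp add: l2_norm_def l2_inner_def)
    then show ?thesis
      using weighted_inner[OF dV dV, of n n] Q_form_eq[OF d d, of n n] by (simp add: form_norm_def)
  qed
  moreover have "(\<lambda>n. sqrt (EL (u n - w) (u n - w) + (l2_norm weighted (u n - w))\<^sup>2)) \<longlonglongrightarrow> sqrt (0 + 0\<^sup>2)"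
    by (intro tendsto_intros E0 lim)
  ultimately show ?thesis by simp
qed

definition approximable :: "('a \<Rightarrow> real) set \<Rightarrow> ('a \<Rightarrow> real) \<Rightarrow> bool" where
  "approximable S w \<longleftrightarrow> (\<forall>e>0. \<exists>v\<in>S. form_norm m (Q_form m C V) (w - v) < e)"

lemma approximable_seq:
  assumes u: "\<And>n. u n \<in> S" "S \<subseteq> Q_dom m C V" and w: "w \<in> Q_dom m C V"
    and lim: "(\<lambda>n. form_norm m (Q_form m C V) (u n - w)) \<longlonglongrightarrow> 0"
  shows "approximable S w"
  unfolding approximable_def
proof (intro allI impI)
  fix e :: real assume "0 < e"
  from order_tendstoD(2)[OF lim this]
  obtain n where "form_norm m (Q_form m C V) (u n - w) < e"
    using eventually_happens trivial_limit_sequentially by blast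
  moreover have "u n \<in> Q_dom m C V" using u by blast
  ultimately have "form_norm m (Q_form m C V) (w - u n) < e"
    using Q.F.nrm_minus_commute[OF w] by simp
  then show "\<exists>v\<in>S. form_norm m (Q_form m C V) (w - v) < e" using u(1) by blast
qed

lemma approximable_trans:
  assumes S: "S \<subseteq> Q_dom m C V" and T: "T \<subseteq> Q_dom m C V" and w: "w \<in> Q_dom m C V"
    and "approximable S w" and ST: "\<And>v. v \<in> S \<Longrightarrow> approximable T v"
  shows "approximable T w"
  unfolding approximable_def
proof (intro allI impI)
  fix e :: real assume "0 < e"
  then have e: "0 < e / 2" by simp
  obtain v where v: "v \<in> S" "form_norm m (Q_form m C V) (w - v) < e / 2"
    using assms(4)[unfolded approximable_def, rule_format, OF e] by (elim bexE) (rule that)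
  obtain t where t: "t \<in> T" "form_norm m (Q_form m C V) (v - t) < e / 2"
    using ST[OF v(1), unfolded approximable_def, rule_format, OF e] by (elim bexE) (rule that)
  have mem: "v \<in> Q_dom m C V" "t \<in> Q_dom m C V" using v(1) t(1) S T by auto
  have "form_norm m (Q_form m C V) (w - t) < e"
    using Q.F.nrm_triangle_sub[OF w mem] v(2) t(2) by simp
  then show "\<exists>v\<in>T. form_norm m (Q_form m C V) (w - v) < e" using t(1) by blast
qed

text \<open>Intermediate class between the domain and the test functions: averages are dominated in
  \<open>l2_space weighted\<close> once the function is bounded with bounded support, so both
  properties are arranged before averaging.\<close>

definition bounded_dom :: "('a \<Rightarrow> real) set" where
  "bounded_dom = {u \<in> Q_dom m C V. \<exists>M. \<forall>x. \<bar>u x\<bar> \<le> M}"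

definition bounded_support_dom :: "('a \<Rightarrow> real) set" where
  "bounded_support_dom = {u \<in> bounded_dom. \<exists>n. \<forall>x. x \<notin> B0 n \<longrightarrow> u x = 0}"

lemma approximable_bounded:
  assumes w: "w \<in> Q_dom m C V"
  shows "approximable bounded_dom w"
proof -
  define p :: "nat \<Rightarrow> real \<Rightarrow> real" where "p n t = max (- real n) (min (real n) t)" for n t
  have p: "p n \<in> borel_measurable borel" "p n 0 = 0" "\<bar>p n a - p n b\<bar> \<le> \<bar>a - b\<bar>" "\<bar>p n a\<bar> \<le> \<bar>a\<bar>"
    "\<bar>p n a - a\<bar> \<le> \<bar>a\<bar>" "\<bar>p n a\<bar> \<le> real n" for n a b
    unfolding p_def by auto
  have wl: "w \<in> l2_space m" and wD: "w \<in> DL" and wW: "w \<in> l2_space weighted"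
    using w DLD(1) by (auto simp: Q_dom_eq)
  define u where "u n = (\<lambda>x. p n (w x))" for n
  note nc = normal_contraction[OF wl p(1-3), folded u_def]
  have uW: "u n \<in> l2_space weighted" for n
  proof (rule l2_space_bound[OF _ wW])
    show "u n \<in> borel_measurable weighted" using l2_spaceD(1)[OF nc(1)] by (simp only: weighted_measurable)
    show "\<bar>u n x\<bar> \<le> \<bar>w x\<bar>" for x unfolding u_def by (rule p(4))
  qed
  have lim: "(\<lambda>n. l2_norm weighted (u n - w)) \<longlonglongrightarrow> 0"
  proof (rule l2_dominated[OF uW wW wW])
    show "\<bar>u n x - w x\<bar> \<le> \<bar>w x\<bar>" for n x unfolding u_def by (rule p(5))
    show "AE x in weighted. (\<lambda>n. u n x) \<longlonglongrightarrow> w x"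
    proof (intro AE_I2 tendsto_eventually)
      fix x
      obtain N where N: "\<bar>w x\<bar> \<le> real N" using real_arch_simple by blast
      have "u n x = w x" if "N \<le> n" for n
      proof -
        have "real N \<le> real n" using that by simp
        then show ?thesis using N by (simp add: u_def p_def)
      qed
      then show "\<forall>\<^sub>F n in sequentially. u n x = w x" by (rule eventually_sequentiallyI)
    qed
  qed
  have uD: "u n \<in> DL" for n by (rule nc(3)[OF wD])
  have "(\<lambda>n. form_norm m (Q_form m C V) (u n - w)) \<longlonglongrightarrow> 0"
  proof (rule Q_tendsto[OF uD uW w lim])
    show "\<forall>\<^sub>F n in sequentially. EL (u n) (u n) \<le> EL w w + e" if "0 < e" for e
    proof (intro always_eventually allI)
      show "EL (u n) (u n) \<le> EL w w + e" for n using nc(4)[OF wD, of n] that by linarith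
    qed
  qed
  moreover have "u n \<in> bounded_dom" for n
  proof -
    have "\<bar>u n x\<bar> \<le> real n" for x unfolding u_def by (rule p(6))
    then show ?thesis using uD[of n] uW[of n] by (auto simp: bounded_dom_def Q_dom_eq)
  qed
  ultimately show ?thesis
    using w by (intro approximable_seq[of u]) (auto simp: bounded_dom_def)
qed

lemma approximable_bounded_support:
  assumes "w \<in> bounded_dom"
  shows "approximable bounded_support_dom w"
proof -
  have w: "w \<in> Q_dom m C V" and b: "\<exists>M. \<forall>x. \<bar>w x\<bar> \<le> M" using assms by (auto simp: bounded_dom_def)
  obtain M where M: "\<bar>w x\<bar> \<le> M" for x using b by auto
  have wl: "w \<in> l2_space m" and wD: "w \<in> DL" and wW: "w \<in> l2_space weighted"
    using w DLD(1) by (auto simp: Q_dom_eq)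
  define u where "u n = restrict_to (B0 n) w" for n
  have le: "\<bar>u n x\<bar> \<le> \<bar>w x\<bar>" "\<bar>u n x - w x\<bar> \<le> \<bar>w x\<bar>" "x \<notin> B0 n \<Longrightarrow> u n x = 0" for n x
    by (auto simp: u_def restrict_to_def indicator_def)
  have ul: "u n \<in> l2_space m" for n using wl by (simp add: u_def)
  have uW: "u n \<in> l2_space weighted" for n
  proof (rule l2_space_bound[OF _ wW le(1)])
    show "u n \<in> borel_measurable weighted" using l2_spaceD(1)[OF ul] by (simp only: weighted_measurable)
  qed
  have lim: "(\<lambda>n. l2_norm weighted (u n - w)) \<longlonglongrightarrow> 0"
  proof (rule l2_dominated[OF uW wW wW le(2)])
    show "AE x in weighted. (\<lambda>n. u n x) \<longlonglongrightarrow> w x"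
      unfolding u_def by (intro AE_I2 restrict_B0_tendsto_pointwise)
  qed
  have uD: "u n \<in> DL" for n unfolding u_def by (rule EL_restrict(2)[OF wD])
  have "(\<lambda>n. form_norm m (Q_form m C V) (u n - w)) \<longlonglongrightarrow> 0"
    by (rule Q_tendsto[OF uD uW w lim]) (unfold u_def, rule EL_restrict(1)[OF wD])
  moreover have "u n \<in> bounded_support_dom" for n
  proof -
    have "\<bar>u n x\<bar> \<le> M" for x using le(1)[of n x] M[of x] by linarith
    then have "u n \<in> bounded_dom" using uD[of n] uW[of n] by (auto simp: bounded_dom_def Q_dom_eq)
    then show ?thesis using le(3)[of _ n] by (auto simp: bounded_support_dom_def)
  qed
  ultimately show ?thesis
    using w by (intro approximable_seq[of u]) (auto simp: bounded_dom_def bounded_support_dom_def)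
qed

text \<open>The averages are known to converge in \<open>L2\<close> of \<open>m\<close>; a
  subsequence converges almost everywhere, and the common bound and support allow dominated
  convergence for \<open>weighted\<close>, where \<open>V\<close> may be unbounded.\<close>

lemma approximable_test_functions:
  assumes "w \<in> bounded_support_dom"
  shows "approximable test_functions w"
proof -
  have w: "w \<in> Q_dom m C V" and b: "\<exists>M. \<forall>x. \<bar>w x\<bar> \<le> M" and s: "\<exists>n. \<forall>x. x \<notin> B0 n \<longrightarrow> w x = 0"
    using assms by (auto simp: bounded_dom_def bounded_support_dom_def)
  obtain M where M: "\<And>x. \<bar>w x\<bar> \<le> M" using b by auto
  obtain k where k: "\<And>x. x \<notin> B0 k \<Longrightarrow> w x = 0" using s by auto
  have wl: "w \<in> l2_space m" and wD: "w \<in> DL" and wW: "w \<in> l2_space weighted"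
    using w DLD(1) by (auto simp: Q_dom_eq)
  define a where "a n = average (inverse (real (Suc n))) w" for n
  have r: "0 < inverse (real (Suc n))" "inverse (real (Suc n)) \<le> 1" for n
    by (simp_all add: inverse_le_1_iff)
  have ac: "a n \<in> const_scale (inverse (real (Suc n)))" for n
    unfolding a_def by (rule average_props(1)[OF r(1) wl])
  have al: "a n \<in> l2_space m" for n by (rule const_scaleD(1)[OF ac])
  have ab: "\<bar>a n x\<bar> \<le> M" for n x unfolding a_def by (rule average_bounded_support(1)[OF r wl M k])
  have az: "a n x = 0" if "x \<notin> B0 k" for n x
    unfolding a_def by (rule average_bounded_support(2)[OF r wl M k that])
  obtain q where q: "strict_mono q" "AE x in m. (\<lambda>n. a (q n) x) \<longlonglongrightarrow> w x"
    by (rule l2_subseq_AE[OF al wl average_tendsto[OF wl, folded a_def]])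
  define u where "u n = a (q n)" for n
  have uW: "u n \<in> l2_space weighted" for n
    unfolding u_def by (rule bounded_support_weighted[OF l2_spaceD(1)[OF al] ab az])
  \<comment> \<open>The dominating function: \<open>|u n - w| <= 2 * M\<close> on
    \<open>B0 k\<close>, and both functions vanish outside it.\<close>
  have i: "(2 * M) *\<^sub>R indicat_real (B0 k) \<in> l2_space weighted"
  proof (rule bounded_support_weighted[of _ "\<bar>2 * M\<bar>" k])
    show "(2 * M) *\<^sub>R indicat_real (B0 k) \<in> borel_measurable m"
      by (intro l2_spaceD(1) L.mem indicator_l2 B0_balls)
  qed (auto simp: indicator_def)
  have lim: "(\<lambda>n. l2_norm weighted (u n - w)) \<longlonglongrightarrow> 0"
  proof (rule l2_dominated[OF uW wW i])
    show "\<bar>u n x - w x\<bar> \<le> \<bar>((2 * M) *\<^sub>R indicat_real (B0 k)) x\<bar>" for n x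
      using ab[of "q n" x] M[of x] az[of x "q n"] k[of x] by (cases "x \<in> B0 k") (auto simp: u_def)
    show "AE x in weighted. (\<lambda>n. u n x) \<longlonglongrightarrow> w x"
      unfolding u_def by (rule weighted_AE[OF q(2)])
  qed
  have uD: "u n \<in> DL" for n unfolding u_def a_def by (rule EL_average(1)[OF r(1) wD])
  have uE: "EL (u n) (u n) \<le> EL w w" for n unfolding u_def a_def by (rule EL_average(2)[OF r(1) wD])
  have "(\<lambda>n. form_norm m (Q_form m C V) (u n - w)) \<longlonglongrightarrow> 0"
  proof (rule Q_tendsto[OF uD uW w lim])
    show "\<forall>\<^sub>F n in sequentially. EL (u n) (u n) \<le> EL w w + e" if "0 < e" for e
    proof (intro always_eventually allI)
      show "EL (u n) (u n) \<le> EL w w + e" for n using uE[of n] that by linarith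
    qed
  qed
  moreover have "u n \<in> test_functions" for n
    unfolding u_def by (rule test_functionsI[OF r(1) ac az])
  ultimately show ?thesis
    using w test_functions_Q by (intro approximable_seq[of u]) auto
qed

lemma test_functions_approximable:
  assumes w: "w \<in> Q_dom m C V"
  shows "approximable test_functions w"
proof -
  have sub: "bounded_dom \<subseteq> Q_dom m C V" "bounded_support_dom \<subseteq> Q_dom m C V" "test_functions \<subseteq> Q_dom m C V"
    using test_functions_Q by (auto simp: bounded_dom_def bounded_support_dom_def)
  have "approximable bounded_support_dom w"
    by (rule approximable_trans[OF sub(1,2) w approximable_bounded[OF w] approximable_bounded_support])
  then show ?thesis
    by (rule approximable_trans[OF sub(2,3) w _ approximable_test_functions])
qed

text \<open>Stated for every \<open>S\<close> between the test functions and all of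
  \<open>Q_dom m C V \<inter> continuous_compact\<close>; the two extreme choices give the core
  property of the test functions and regularity.\<close>

lemma form_core_test_functions:
  assumes S: "test_functions \<subseteq> S" "S \<subseteq> Q_dom m C V \<inter> continuous_compact"
  shows "form_core m (Q_dom m C V) (Q_form m C V) S"
  unfolding form_core_def
proof (intro conjI ballI allI impI S(2))
  fix u and e :: real assume u: "u \<in> Q_dom m C V" and e: "0 < e"
  obtain w where "w \<in> test_functions" "form_norm m (Q_form m C V) (u - w) < e"
    using test_functions_approximable[OF u, unfolded approximable_def, rule_format, OF e]
    by (elim bexE) (rule that)
  then show "\<exists>w\<in>S. form_norm m (Q_form m C V) (\<lambda>x. u x - w x) < e"
    using S(1) unfolding fun_diff_def by blast
next
  fix u :: "'a \<Rightarrow> real" and e :: real assume u: "u \<in> continuous_compact" and e: "0 < e"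
  show "\<exists>w\<in>S. \<forall>x. \<bar>u x - w x\<bar> < e"
    using test_functions_uniformly_dense[OF u e] S(1) by blast
qed

lemma test_functions_continuous_compact: "test_functions \<subseteq> (continuous_compact :: ('a \<Rightarrow> real) set)"
proof
  fix \<phi> :: "'a \<Rightarrow> real" assume \<phi>: "\<phi> \<in> test_functions"
  obtain r where r: "0 < r" "\<phi> \<in> const_scale r"
    by (rule test_functionsE[OF \<phi>]) (rule that)
  have "continuous_on UNIV \<phi>"
    by (rule locally_constant_continuous[OF r(1)]) (rule const_scaleD(2)[OF r(2)])
  then show "\<phi> \<in> continuous_compact"
    using \<phi> by (simp add: continuous_compact_def test_functions_def)
qed

end

theorem theorem3p4:
  fixes m :: "'a::metric_space measure" and C :: "'a set \<Rightarrow> real" and V :: "'a \<Rightarrow> real"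
  assumes "ultrametric_measure_space m"
    and "homogeneous m"
    and "\<not> compact (UNIV :: 'a set)"
    and "choice_function C"
    and "locally_integrable m V"
    and "AE x in m. 0 \<le> V x"
  shows "regular_dirichlet_form m (Q_dom m C V) (Q_form m C V)
    \<and> (\<exists>H. nonneg_selfadjoint m H \<and> Q_dom m C V = op_form_dom m H \<and>
          (\<forall>u\<in>Q_dom m C V. Q_form m C V u u = op_form m H u u))
    \<and> form_core m (Q_dom m C V) (Q_form m C V) test_functions"
proof -
  interpret hierarchical_schroedinger m C V
    by unfold_locales (rule assms)+
  have test: "test_functions \<subseteq> Q_dom m C V \<inter> continuous_compact"
    using test_functions_Q test_functions_continuous_compact by blast
  show ?thesis
  proof (intro conjI exI[of _ Q.form_op] ballI)
    have "dirichlet_form m (Q_dom m C V) (Q_form m C V)"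
      unfolding dirichlet_form_def using Q.symmetric Q.dense Q.nonneg Q.closed Q_markovian by simp
    then show "regular_dirichlet_form m (Q_dom m C V) (Q_form m C V)"
      unfolding regular_dirichlet_form_def
      using form_core_test_functions[OF test order_refl] by simp
    show "form_core m (Q_dom m C V) (Q_form m C V) test_functions"
      by (rule form_core_test_functions[OF order_refl test])
    show "nonneg_selfadjoint m Q.form_op" by (rule Q.form_op_selfadjoint)
    show "Q_dom m C V = op_form_dom m Q.form_op" by (rule Q.op_form_form_op(1)[symmetric])
    show "Q_form m C V u u = op_form m Q.form_op u u" if "u \<in> Q_dom m C V" for u
      by (rule Q.op_form_form_op(2)[OF that that, symmetric])
  qed
qed

end
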